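(* Consider two manifolds of constant curvature of dimension $n\geqslant3$ carrying abundant (second order) properly superintegrable systems that are conformally equivalent. Denote their metrics by $g$ and $\tilde g=\Omega^2g$, and let $B$ and $\tilde B$ be the structure functions of the respective systems. Then $$\tilde B=\Omega^2B\quad\text{modulo gauge transformations.}$$
   Context: A (second order) properly superintegrable system is a Hamiltonian $H=g^{ij}p_ip_j+V$ with $2n-1$ functionally independent integrals $F=K^{ij}p_ip_j+W$, $\{F,H\}=0$ ($K$ Killing, $dW=K\,dV$). With $\mathcal K$ the space of its Killing tensors, $\mathcal V^{\max}=\{V: d(K\,dV)=0\ \forall K\in\mathcal K\}$ and $\mathcal K^{\max}=\{K\text{ Killing}: d(K\,dV)=0\ \forall V\in\mathcal V^{\max}\}$. It is abundant if its potentials satisfy $V_{,ij}=T_{ij}{}^kV_{,k}+\frac1ng_{ij}\Delta V$ with $T_{ijk}$ symmetric and trace-free in $i,j$, $\dim\mathcal V^{\max}=n+2$ and $\dim\mathcal K^{\max}=\frac{n(n+1)}2$. Then $T_{ijk}=S_{ijk}+\bar t_ig_{jk}+\bar t_jg_{ik}-\frac2ng_{ij}\bar t_k$ with $S_{ijk}$ totally symmetric and trace-free. Two systems are conformally equivalent if $\tilde H=\Omega^{-2}H$ and the trace-free parts of their Killing tensors, with upper indices, span the same space. Structure function: on a constant curvature manifold of dimension $n\geqslant3$ (known result), for an abundant properly superintegrable system there is a function $B$ with $$T_{ijk}=\big(B_{,(ijk)}\big)_\circ+A_ig_{jk}+A_jg_{ik}-\tfrac2ng_{ij}A_k,\qquad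 A_j=\tfrac1{n+2}\Big((\Delta B)_{,j}+\tfrac{2(n+1)}{n(n-1)}R\,B_{,j}\Big),$$ where commas are covariant derivatives, round brackets denote (normalised) symmetrisation, $\circ$ the trace-free part and $R$ the scalar curvature; $B$ is called structure function. A gauge transformation of a structure function is the addition of a function $\beta$ that leaves $S_{ijk}=(B_{,(ijk)})_\circ$ unchanged, i.e. $(\beta_{,(ijk)})_\circ=0$; for $\tilde B$ covariant derivatives and traces are those of $\tilde g$. *)

theory Defs
  imports "HOL-Analysis.Analysis" "HOL-Library.Function_Algebras"
begin

text \<open>Pointwise real vector space structure on functions, so that the library notions of
  \<open>span\<close> and \<open>dim\<close> apply to spaces of functions and tensor fields.\<close>

instantiation "fun" :: (type, real_vector) real_vector
begin

definition scaleR_fun :: "real \<Rightarrow> ('a \<Rightarrow> 'b) \<Rightarrow> 'a \<Rightarrow> 'b" where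
  "scaleR_fun r f = (\<lambda>x. r *\<^sub>R f x)"

instance
  by standard
    (simp_all add: scaleR_fun_def plus_fun_def fun_eq_iff scaleR_add_right scaleR_add_left)

end


section \<open>Calculus on open subsets of coordinate space\<close>

definition pd :: "'n::finite \<Rightarrow> (real^'n \<Rightarrow> real) \<Rightarrow> real^'n \<Rightarrow> real" where
  "pd i f x = frechet_derivative f (at x) (axis i 1)"

text \<open>\<open>C\<^sup>\<infinity>\<close> on an open set: all iterated partial derivatives exist and are differentiable.\<close>

definition smooth_on :: "(real^'n::finite) set \<Rightarrow> (real^'n \<Rightarrow> real) \<Rightarrow> bool" where
  "smooth_on U f \<longleftrightarrow> (\<forall>is. foldr pd is f differentiable_on U)"


section \<open>Tensor calculus in one coordinate system\<close>

text \<open>Throughout this section \<open>g x i j\<close> are the components of a metric of arbitrary signature.  In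
  covariant derivatives the index of differentiation comes last, as in the comma notation.\<close>

type_synonym 'n comps1 = "real^'n \<Rightarrow> 'n \<Rightarrow> real"
type_synonym 'n comps2 = "real^'n \<Rightarrow> 'n \<Rightarrow> 'n \<Rightarrow> real"
type_synonym 'n comps3 = "real^'n \<Rightarrow> 'n \<Rightarrow> 'n \<Rightarrow> 'n \<Rightarrow> real"

definition inv_metric :: "'n::finite comps2 \<Rightarrow> 'n comps2" where
  "inv_metric g x i j = matrix_inv (\<chi> a b. g x a b) $ i $ j"

text \<open>\<open>christoffel g x k i j\<close> is \<open>\<Gamma>\<^sup>k\<^sub>i\<^sub>j\<close>.\<close>

definition christoffel :: "'n::finite comps2 \<Rightarrow> real^'n \<Rightarrow> 'n \<Rightarrow> 'n \<Rightarrow> 'n \<Rightarrow> real" where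
  "christoffel g x k i j =
     (\<Sum>l\<in>UNIV. inv_metric g x k l *
        (pd i (\<lambda>y. g y j l) x + pd j (\<lambda>y. g y i l) x - pd l (\<lambda>y. g y i j) x)) / 2"

definition cov_deriv1 :: "'n::finite comps2 \<Rightarrow> 'n comps1 \<Rightarrow> 'n comps2" where
  "cov_deriv1 g w x i j = pd j (\<lambda>y. w y i) x - (\<Sum>k\<in>UNIV. christoffel g x k i j * w x k)"

definition cov_deriv2 :: "'n::finite comps2 \<Rightarrow> 'n comps2 \<Rightarrow> 'n comps3" where
  "cov_deriv2 g h x i j k = pd k (\<lambda>y. h y i j) x
     - (\<Sum>l\<in>UNIV. christoffel g x l i k * h x l j)
     - (\<Sum>l\<in>UNIV. christoffel g x l j k * h x i l)"

definition grad :: "(real^'n::finite \<Rightarrow> real) \<Rightarrow> 'n comps1" where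
  "grad f x i = pd i f x"

definition hessian :: "'n::finite comps2 \<Rightarrow> (real^'n \<Rightarrow> real) \<Rightarrow> 'n comps2" where
  "hessian g f = cov_deriv1 g (grad f)"

definition third_deriv :: "'n::finite comps2 \<Rightarrow> (real^'n \<Rightarrow> real) \<Rightarrow> 'n comps3" where
  "third_deriv g f = cov_deriv2 g (hessian g f)"

definition laplacian :: "'n::finite comps2 \<Rightarrow> (real^'n \<Rightarrow> real) \<Rightarrow> real^'n \<Rightarrow> real" where
  "laplacian g f x = (\<Sum>i\<in>UNIV. \<Sum>j\<in>UNIV. inv_metric g x i j * hessian g f x i j)"

text \<open>\<open>riemann g x l k i j\<close> is \<open>R\<^sup>l\<^sub>k\<^sub>i\<^sub>j\<close>, the \<open>l\<close>-th component of
  \<open>R(\<partial>\<^sub>i, \<partial>\<^sub>j) \<partial>\<^sub>k\<close>; with this sign convention round spheres have positive scalar curvature.\<close>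

definition riemann :: "'n::finite comps2 \<Rightarrow> real^'n \<Rightarrow> 'n \<Rightarrow> 'n \<Rightarrow> 'n \<Rightarrow> 'n \<Rightarrow> real" where
  "riemann g x l k i j =
     pd i (\<lambda>y. christoffel g y l j k) x - pd j (\<lambda>y. christoffel g y l i k) x
     + (\<Sum>m\<in>UNIV. christoffel g x l i m * christoffel g x m j k
                 - christoffel g x l j m * christoffel g x m i k)"

definition scalar_curv :: "'n::finite comps2 \<Rightarrow> real^'n \<Rightarrow> real" where
  "scalar_curv g x =
     (\<Sum>k\<in>UNIV. \<Sum>j\<in>UNIV. inv_metric g x k j * (\<Sum>i\<in>UNIV. riemann g x i k i j))"

definition sym3 :: "'n::finite comps3 \<Rightarrow> 'n comps3" where
  "sym3 t x i j k =
     (t x i j k + t x j k i + t x k i j + t x j i k + t x i k j + t x k j i) / 6"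

text \<open>Trace-free part of a \<^emph>\<open>totally symmetric\<close> covariant tensor of rank three; the coefficient
  \<open>1/(n+2)\<close> is correct for totally symmetric arguments only.\<close>

definition trace_free3 :: "'n::finite comps2 \<Rightarrow> 'n comps3 \<Rightarrow> 'n comps3" where
  "trace_free3 g s x i j k =
     (let \<tau> = (\<lambda>l. \<Sum>a\<in>UNIV. \<Sum>b\<in>UNIV. inv_metric g x a b * s x a b l)
      in s x i j k - (g x i j * \<tau> k + g x j k * \<tau> i + g x k i * \<tau> j) / (real CARD('n) + 2))"

text \<open>\<open>(f\<^sub>,\<^sub>(\<^sub>i\<^sub>j\<^sub>k\<^sub>))\<^sub>\<circ>\<close>\<close>

definition tf_sym_third_deriv :: "'n::finite comps2 \<Rightarrow> (real^'n \<Rightarrow> real) \<Rightarrow> 'n comps3" where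
  "tf_sym_third_deriv g f = trace_free3 g (sym3 (third_deriv g f))"

text \<open>Lowering both, respectively the first, index of \<open>K\<^sup>i\<^sup>j\<close>; \<open>contract g K f\<close> is the 1-form
  \<open>K df\<close>, i.e. \<open>K\<^sub>i\<^sup>j f\<^sub>,\<^sub>j\<close>.\<close>

definition lower2 :: "'n::finite comps2 \<Rightarrow> 'n comps2 \<Rightarrow> 'n comps2" where
  "lower2 g K x i j = (\<Sum>a\<in>UNIV. \<Sum>b\<in>UNIV. g x i a * g x j b * K x a b)"

definition contract :: "'n::finite comps2 \<Rightarrow> 'n comps2 \<Rightarrow> (real^'n \<Rightarrow> real) \<Rightarrow> 'n comps1" where
  "contract g K f x i = (\<Sum>a\<in>UNIV. \<Sum>j\<in>UNIV. g x i a * K x a j * pd j f x)"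

text \<open>Functions on phase space, in canonical coordinates \<open>(x, p)\<close>.\<close>

definition dpos :: "'n::finite \<Rightarrow> (real^'n \<Rightarrow> real^'n \<Rightarrow> real) \<Rightarrow> real^'n \<Rightarrow> real^'n \<Rightarrow> real" where
  "dpos i F x p = pd i (\<lambda>y. F y p) x"

definition dmom :: "'n::finite \<Rightarrow> (real^'n \<Rightarrow> real^'n \<Rightarrow> real) \<Rightarrow> real^'n \<Rightarrow> real^'n \<Rightarrow> real" where
  "dmom i F x p = pd i (\<lambda>q. F x q) p"

definition poisson ::
  "(real^'n::finite \<Rightarrow> real^'n \<Rightarrow> real) \<Rightarrow> (real^'n \<Rightarrow> real^'n \<Rightarrow> real) \<Rightarrow> real^'n \<Rightarrow> real^'n \<Rightarrow> real" where
  "poisson F G x p = (\<Sum>i\<in>UNIV. dpos i F x p * dmom i G x p - dmom i F x p * dpos i G x p)"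

definition quad_fun :: "'n::finite comps2 \<Rightarrow> (real^'n \<Rightarrow> real) \<Rightarrow> real^'n \<Rightarrow> real^'n \<Rightarrow> real" where
  "quad_fun K W x p = (\<Sum>i\<in>UNIV. \<Sum>j\<in>UNIV. K x i j * p $ i * p $ j) + W x"


section \<open>Manifolds and tensor fields\<close>

text \<open>A chart is a domain together with a coordinate map.\<close>

type_synonym ('a, 'n) chart = "'a set \<times> ('a \<Rightarrow> real^'n)"

abbreviation cdom :: "('a, 'n::finite) chart \<Rightarrow> 'a set" where "cdom c \<equiv> fst c"
abbreviation cmap :: "('a, 'n::finite) chart \<Rightarrow> 'a \<Rightarrow> real^'n" where "cmap c \<equiv> snd c"

definition cran :: "('a, 'n::finite) chart \<Rightarrow> (real^'n) set" where
  "cran c = cmap c ` cdom c"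

definition cinv :: "('a, 'n::finite) chart \<Rightarrow> real^'n \<Rightarrow> 'a" where
  "cinv c = inv_into (cdom c) (cmap c)"

definition loc :: "('a, 'n::finite) chart \<Rightarrow> ('a \<Rightarrow> real) \<Rightarrow> real^'n \<Rightarrow> real" where
  "loc c f = (\<lambda>x. f (cinv c x))"

definition overlap :: "('a, 'n::finite) chart \<Rightarrow> ('a, 'n) chart \<Rightarrow> (real^'n) set" where
  "overlap c d = cmap c ` (cdom c \<inter> cdom d)"

definition transition :: "('a, 'n::finite) chart \<Rightarrow> ('a, 'n) chart \<Rightarrow> real^'n \<Rightarrow> real^'n" where
  "transition c d x = cmap d (cinv c x)"

text \<open>Connected smooth manifolds; the dimension is \<open>CARD('n)\<close>.\<close>

definition smooth_manifold :: "'a topology \<Rightarrow> ('a, 'n::finite) chart set \<Rightarrow> bool" where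
  "smooth_manifold M \<A> \<longleftrightarrow>
     Hausdorff_space M \<and> second_countable M \<and> connected_space M \<and>
     (\<Union>c\<in>\<A>. cdom c) = topspace M \<and>
     (\<forall>c\<in>\<A>. openin M (cdom c) \<and> open (cran c) \<and>
        homeomorphic_map (subtopology M (cdom c)) (top_of_set (cran c)) (cmap c)) \<and>
     (\<forall>c\<in>\<A>. \<forall>d\<in>\<A>. \<forall>a. smooth_on (overlap c d) (\<lambda>x. transition c d x $ a))"

text \<open>Functions on the manifold are represented by functions vanishing outside its carrier, so that
  equality and linear dimension are those of functions on the manifold.\<close>

definition scalar_field :: "'a topology \<Rightarrow> ('a, 'n::finite) chart set \<Rightarrow> ('a \<Rightarrow> real) \<Rightarrow> bool" where
  "scalar_field M \<A> f \<longleftrightarrow>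
     (\<forall>c\<in>\<A>. smooth_on (cran c) (loc c f)) \<and> (\<forall>p. p \<notin> topspace M \<longrightarrow> f p = 0)"

text \<open>A tensor field is given by its components in the charts of the atlas, subject to the
  transformation law; \<open>jac c d x a i\<close> is \<open>\<partial>y\<^sup>a/\<partial>x\<^sup>i\<close>, where \<open>x\<close>, \<open>y\<close> are the coordinates of
  the charts \<open>c\<close>, \<open>d\<close>.\<close>

type_synonym ('a, 'n) tensor2 = "('a, 'n) chart \<Rightarrow> 'n comps2"
type_synonym ('a, 'n) tensor3 = "('a, 'n) chart \<Rightarrow> 'n comps3"

definition jac :: "('a, 'n::finite) chart \<Rightarrow> ('a, 'n) chart \<Rightarrow> real^'n \<Rightarrow> 'n \<Rightarrow> 'n \<Rightarrow> real" where
  "jac c d x a i = pd i (\<lambda>y. transition c d y $ a) x"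

definition cov_field2 :: "('a, 'n::finite) chart set \<Rightarrow> ('a, 'n) tensor2 \<Rightarrow> bool" where
  "cov_field2 \<A> h \<longleftrightarrow>
     (\<forall>c\<in>\<A>. \<forall>i j. smooth_on (cran c) (\<lambda>x. h c x i j)) \<and>
     (\<forall>c\<in>\<A>. \<forall>d\<in>\<A>. \<forall>x\<in>overlap c d. \<forall>i j. h c x i j =
        (\<Sum>a\<in>UNIV. \<Sum>b\<in>UNIV. jac c d x a i * jac c d x b j * h d (transition c d x) a b))"

definition cov_field3 :: "('a, 'n::finite) chart set \<Rightarrow> ('a, 'n) tensor3 \<Rightarrow> bool" where
  "cov_field3 \<A> T \<longleftrightarrow>
     (\<forall>c\<in>\<A>. \<forall>i j k. smooth_on (cran c) (\<lambda>x. T c x i j k)) \<and>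
     (\<forall>c\<in>\<A>. \<forall>d\<in>\<A>. \<forall>x\<in>overlap c d. \<forall>i j k. T c x i j k =
        (\<Sum>a\<in>UNIV. \<Sum>b\<in>UNIV. \<Sum>e\<in>UNIV.
           jac c d x a i * jac c d x b j * jac c d x e k * T d (transition c d x) a b e))"

text \<open>Symmetric contravariant fields \<open>K\<^sup>i\<^sup>j\<close>.  As for functions, components without meaning (in
  charts outside the atlas, or outside the chart's range) are zero.\<close>

definition contra_field2 :: "('a, 'n::finite) chart set \<Rightarrow> ('a, 'n) tensor2 \<Rightarrow> bool" where
  "contra_field2 \<A> K \<longleftrightarrow>
     (\<forall>c\<in>\<A>. \<forall>i j. smooth_on (cran c) (\<lambda>x. K c x i j)) \<and>
     (\<forall>c\<in>\<A>. \<forall>x\<in>cran c. \<forall>i j. K c x i j = K c x j i) \<and>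
     (\<forall>c\<in>\<A>. \<forall>d\<in>\<A>. \<forall>x\<in>overlap c d. \<forall>a b. K d (transition c d x) a b =
        (\<Sum>i\<in>UNIV. \<Sum>j\<in>UNIV. jac c d x a i * jac c d x b j * K c x i j)) \<and>
     (\<forall>c x. c \<notin> \<A> \<or> x \<notin> cran c \<longrightarrow> K c x = 0)"

definition metric_field :: "('a, 'n::finite) chart set \<Rightarrow> ('a, 'n) tensor2 \<Rightarrow> bool" where
  "metric_field \<A> g \<longleftrightarrow> cov_field2 \<A> g \<and>
     (\<forall>c\<in>\<A>. \<forall>x\<in>cran c. (\<forall>i j. g c x i j = g c x j i) \<and> invertible (\<chi> i j. g c x i j))"

definition constant_curvature :: "('a, 'n::finite) chart set \<Rightarrow> ('a, 'n) tensor2 \<Rightarrow> bool" where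
  "constant_curvature \<A> g \<longleftrightarrow>
     (\<exists>\<kappa>::real. \<forall>c\<in>\<A>. \<forall>x\<in>cran c. \<forall>l k i j.
        (\<Sum>m\<in>UNIV. g c x l m * riemann (g c) x m k i j)
          = \<kappa> * (g c x l i * g c x k j - g c x l j * g c x k i))"

definition killing_tensor ::
  "('a, 'n::finite) chart set \<Rightarrow> ('a, 'n) tensor2 \<Rightarrow> ('a, 'n) tensor2 \<Rightarrow> bool" where
  "killing_tensor \<A> g K \<longleftrightarrow> contra_field2 \<A> K \<and>
     (\<forall>c\<in>\<A>. \<forall>x\<in>cran c. \<forall>i j k.
        sym3 (cov_deriv2 (g c) (lower2 (g c) (K c))) x i j k = 0)"

text \<open>\<open>d(K dV) = 0\<close>\<close>

definition compatible ::
  "('a, 'n::finite) chart set \<Rightarrow> ('a, 'n) tensor2 \<Rightarrow> ('a, 'n) tensor2 \<Rightarrow> ('a \<Rightarrow> real) \<Rightarrow> bool" where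
  "compatible \<A> g K V \<longleftrightarrow> (\<forall>c\<in>\<A>. \<forall>x\<in>cran c. \<forall>i j.
     pd i (\<lambda>y. contract (g c) (K c) (loc c V) y j) x
       = pd j (\<lambda>y. contract (g c) (K c) (loc c V) y i) x)"

text \<open>Trace-free part of \<open>K\<^sup>i\<^sup>j\<close>, with upper indices.\<close>

definition trace_free2 ::
  "('a, 'n::finite) tensor2 \<Rightarrow> ('a, 'n) tensor2 \<Rightarrow> ('a, 'n) tensor2" where
  "trace_free2 g K c x i j = K c x i j
     - (\<Sum>a\<in>UNIV. \<Sum>b\<in>UNIV. g c x a b * K c x a b) * inv_metric (g c) x i j / real CARD('n)"


section \<open>Superintegrable systems\<close>

text \<open>A Hamiltonian \<open>g\<^sup>i\<^sup>j p\<^sub>i p\<^sub>j + V\<close> together with second order integrals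
  \<open>K\<^sup>i\<^sup>j p\<^sub>i p\<^sub>j + W\<close>, each given by the pair \<open>(K, W)\<close>.  The set of integrals may consist of
  \<open>2n - 1\<close> generators only, or of all second order integrals.\<close>

record ('a, 'n) hsystem =
  hmetric :: "('a, 'n) tensor2"
  hpot :: "'a \<Rightarrow> real"
  hints :: "(('a, 'n) tensor2 \<times> ('a \<Rightarrow> real)) set"

definition hamiltonian ::
  "('a, 'n::finite) hsystem \<Rightarrow> ('a, 'n) chart \<Rightarrow> real^'n \<Rightarrow> real^'n \<Rightarrow> real" where
  "hamiltonian S c = quad_fun (inv_metric (hmetric S c)) (loc c (hpot S))"

definition integral_fun ::
  "('a, 'n::finite) tensor2 \<times> ('a \<Rightarrow> real) \<Rightarrow> ('a, 'n) chart \<Rightarrow> real^'n \<Rightarrow> real^'n \<Rightarrow> real" where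
  "integral_fun F c = quad_fun (fst F c) (loc c (snd F))"

definition second_order_integral ::
  "'a topology \<Rightarrow> ('a, 'n::finite) chart set \<Rightarrow> ('a, 'n) hsystem
     \<Rightarrow> ('a, 'n) tensor2 \<times> ('a \<Rightarrow> real) \<Rightarrow> bool" where
  "second_order_integral M \<A> S F \<longleftrightarrow>
     contra_field2 \<A> (fst F) \<and> scalar_field M \<A> (snd F) \<and>
     (\<forall>c\<in>\<A>. \<forall>x\<in>cran c. \<forall>p. poisson (integral_fun F c) (hamiltonian S c) x p = 0)"

text \<open>Functional independence: the differentials are linearly independent on a dense subset of
  phase space.\<close>

definition functionally_independent ::
  "('a, 'n::finite) chart set \<Rightarrow> nat \<Rightarrow> (nat \<Rightarrow> ('a, 'n) tensor2 \<times> ('a \<Rightarrow> real)) \<Rightarrow> bool" where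
  "functionally_independent \<A> m F \<longleftrightarrow> (\<forall>c\<in>\<A>.
     cran c \<times> UNIV \<subseteq> closure {(x, p). x \<in> cran c \<and>
       (\<forall>r::nat \<Rightarrow> real.
          (\<forall>i. (\<Sum>\<alpha><m. r \<alpha> * dpos i (integral_fun (F \<alpha>) c) x p) = 0 \<and>
               (\<Sum>\<alpha><m. r \<alpha> * dmom i (integral_fun (F \<alpha>) c) x p) = 0)
          \<longrightarrow> (\<forall>\<alpha><m. r \<alpha> = 0))})"

definition properly_superintegrable ::
  "'a topology \<Rightarrow> ('a, 'n::finite) chart set \<Rightarrow> ('a, 'n) hsystem \<Rightarrow> bool" where
  "properly_superintegrable M \<A> S \<longleftrightarrow>
     metric_field \<A> (hmetric S) \<and> scalar_field M \<A> (hpot S) \<and>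
     (\<forall>F\<in>hints S. second_order_integral M \<A> S F) \<and>
     (\<exists>F. (\<forall>\<alpha> < 2 * CARD('n) - 1. F \<alpha> \<in> hints S) \<and>
          functionally_independent \<A> (2 * CARD('n) - 1) F)"

definition killing_space :: "('a, 'n::finite) hsystem \<Rightarrow> ('a, 'n) tensor2 set" where
  "killing_space S = span (fst ` hints S)"

definition Vmax ::
  "'a topology \<Rightarrow> ('a, 'n::finite) chart set \<Rightarrow> ('a, 'n) hsystem \<Rightarrow> ('a \<Rightarrow> real) set" where
  "Vmax M \<A> S =
     {V. scalar_field M \<A> V \<and> (\<forall>K\<in>killing_space S. compatible \<A> (hmetric S) K V)}"

definition Kmax ::
  "'a topology \<Rightarrow> ('a, 'n::finite) chart set \<Rightarrow> ('a, 'n) hsystem \<Rightarrow> ('a, 'n) tensor2 set" where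
  "Kmax M \<A> S =
     {K. killing_tensor \<A> (hmetric S) K \<and> (\<forall>V\<in>Vmax M \<A> S. compatible \<A> (hmetric S) K V)}"

text \<open>\<open>T\<close> has all indices lowered; the third one is raised in the equation
  \<open>V\<^sub>,\<^sub>i\<^sub>j = T\<^sub>i\<^sub>j\<^sup>k V\<^sub>,\<^sub>k + g\<^sub>i\<^sub>j \<Delta>V / n\<close>.\<close>

definition structure_tensor ::
  "'a topology \<Rightarrow> ('a, 'n::finite) chart set \<Rightarrow> ('a, 'n) hsystem \<Rightarrow> ('a, 'n) tensor3 \<Rightarrow> bool" where
  "structure_tensor M \<A> S T \<longleftrightarrow> cov_field3 \<A> T \<and>
     (\<forall>c\<in>\<A>. \<forall>x\<in>cran c.
        (\<forall>i j k. T c x i j k = T c x j i k) \<and>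
        (\<forall>k. (\<Sum>i\<in>UNIV. \<Sum>j\<in>UNIV. inv_metric (hmetric S c) x i j * T c x i j k) = 0) \<and>
        (\<forall>V\<in>Vmax M \<A> S. \<forall>i j. hessian (hmetric S c) (loc c V) x i j =
           (\<Sum>l\<in>UNIV. \<Sum>k\<in>UNIV.
              T c x i j l * inv_metric (hmetric S c) x l k * pd k (loc c V) x)
           + hmetric S c x i j * laplacian (hmetric S c) (loc c V) x / real CARD('n)))"

definition abundant ::
  "'a topology \<Rightarrow> ('a, 'n::finite) chart set \<Rightarrow> ('a, 'n) hsystem \<Rightarrow> bool" where
  "abundant M \<A> S \<longleftrightarrow> properly_superintegrable M \<A> S \<and>
     (\<exists>T. structure_tensor M \<A> S T) \<and>
     dim (Vmax M \<A> S) = CARD('n) + 2 \<and>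
     dim (Kmax M \<A> S) = CARD('n) * (CARD('n) + 1) div 2"

text \<open>\<open>H' = \<Omega>\<^sup>-\<^sup>2 H\<close> as functions on phase space, and equal spans of the trace-free parts.\<close>

definition conformally_equivalent ::
  "'a topology \<Rightarrow> ('a, 'n::finite) chart set \<Rightarrow> ('a \<Rightarrow> real)
     \<Rightarrow> ('a, 'n) hsystem \<Rightarrow> ('a, 'n) hsystem \<Rightarrow> bool" where
  "conformally_equivalent M \<A> \<Omega> S S' \<longleftrightarrow>
     scalar_field M \<A> \<Omega> \<and> (\<forall>q\<in>topspace M. \<Omega> q \<noteq> 0) \<and>
     (\<forall>c\<in>\<A>. \<forall>x\<in>cran c. \<forall>p. hamiltonian S' c x p = hamiltonian S c x p / (loc c \<Omega> x)\<^sup>2) \<and>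
     span (trace_free2 (hmetric S') ` killing_space S')
       = span (trace_free2 (hmetric S) ` killing_space S)"

definition trace_one_form :: "'n::finite comps2 \<Rightarrow> (real^'n \<Rightarrow> real) \<Rightarrow> 'n comps1" where
  "trace_one_form g B x j =
     (let n = real CARD('n) in
      (pd j (laplacian g B) x + 2 * (n + 1) / (n * (n - 1)) * scalar_curv g x * pd j B x) / (n + 2))"

definition structure_function ::
  "'a topology \<Rightarrow> ('a, 'n::finite) chart set \<Rightarrow> ('a, 'n) hsystem \<Rightarrow> ('a \<Rightarrow> real) \<Rightarrow> bool" where
  "structure_function M \<A> S B \<longleftrightarrow> scalar_field M \<A> B \<and>
     (\<exists>T. structure_tensor M \<A> S T \<and>
       (\<forall>c\<in>\<A>. \<forall>x\<in>cran c. \<forall>i j k.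
          let g = hmetric S c; A = trace_one_form g (loc c B) x in
          T c x i j k = tf_sym_third_deriv g (loc c B) x i j k
            + A i * g x j k + A j * g x i k - 2 / real CARD('n) * g x i j * A k))"

definition gauge_function ::
  "'a topology \<Rightarrow> ('a, 'n::finite) chart set \<Rightarrow> ('a, 'n) tensor2 \<Rightarrow> ('a \<Rightarrow> real) \<Rightarrow> bool" where
  "gauge_function M \<A> g \<beta> \<longleftrightarrow> scalar_field M \<A> \<beta> \<and>
     (\<forall>c\<in>\<A>. \<forall>x\<in>cran c. \<forall>i j k. tf_sym_third_deriv (g c) (loc c \<beta>) x i j k = 0)"

end

theory Submission
  imports Defs
begin

text \<open>
  Put \<open>\<beta> = B' - \<Omega>\<^sup>2 B\<close>.  Write \<open>D f\<close> for the trace-free symmetrised third derivative of \<open>f\<close>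
  with respect to \<open>g\<close>, and \<open>D'\<close> for the same operator of \<open>g' = \<Omega>\<^sup>2 g\<close>.  The claim is
  \<open>D' B' = D' (\<Omega>\<^sup>2 B)\<close>, and both sides turn out to be \<open>\<Omega>\<^sup>2 D B\<close>, for different reasons.

  The equation \<open>D' (\<Omega>\<^sup>2 B) = \<Omega>\<^sup>2 D B\<close> is conformal geometry (\<open>tf_sym_third_deriv_conf\<close>).  With
  \<open>\<Upsilon> = d\<Omega>/\<Omega>\<close>, the difference of the Ricci tensors of \<open>g'\<close> and \<open>g\<close> is
  \<open>(2 - n) (\<nabla>\<Upsilon> - \<Upsilon> \<otimes> \<Upsilon>)\<close> modulo \<open>g\<close>.  Both metrics have constant curvature and
  \<open>n \<ge> 3\<close>, so \<open>\<nabla>\<Upsilon> - \<Upsilon> \<otimes> \<Upsilon>\<close> is a multiple of \<open>g\<close> (\<open>schouten_pure_trace\<close>).  With this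
  relation all terms in the third derivative of \<open>\<Omega>\<^sup>2 B\<close> that contain a derivative of \<open>\<Omega>\<close> cancel,
  up to multiples of \<open>g\<close>.

  The equation \<open>D' B' = \<Omega>\<^sup>2 D B\<close> says that the totally symmetric part of the structure tensor, with
  one index raised, is conformally invariant.  It comes from the potentials.  If \<open>K\<close> and \<open>K'\<close> are
  Killing tensors of the two metrics with the same trace-free part, the difference of their Killing
  equations yields \<open>K' d(\<Omega>\<^sup>-\<^sup>2 V) = K dV + d(\<mu> V)\<close> with \<open>K' = K + \<mu> g\<^sup>-\<^sup>1\<close>.  Therefore
  \<open>V \<mapsto> \<Omega>\<^sup>-\<^sup>2 V\<close> maps the potentials of the first system to potentials of the second
  (\<open>Vmax_conf\<close>).  Both satisfy a Hessian equation, with coefficients \<open>T\<close> and \<open>T'\<close>.  At a point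
  where \<open>V\<close> vanishes, the conformal change of the Hessian of \<open>V\<close> only produces products of
  \<open>\<Upsilon>\<close> and \<open>dV\<close>, that is, trace terms.  So \<open>T\<close> and \<open>T'\<close> have the same totally symmetric
  trace-free part up to the factor \<open>\<Omega>\<^sup>2\<close> (\<open>structure_tensor_conf\<close>, \<open>tf_part_conf\<close>), provided
  that the differential of such a \<open>V\<close> can be prescribed arbitrarily.

  This last point is where abundance enters (\<open>Vmax_prescribed_differential\<close>).  The Hessian equation
  and its integrability condition determine all first derivatives of \<open>(V, dV, \<Delta>V)\<close>, so by Gronwall's
  inequality and connectedness a potential is determined by these \<open>n + 2\<close> numbers at one point.  As the
  space of potentials has dimension \<open>n + 2\<close>, every choice of the numbers occurs.
\<close>

section \<open>Smooth functions on open subsets of coordinate space\<close>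

lemma pd_cong:
  assumes "open U" "x \<in> U" "\<And>y. y \<in> U \<Longrightarrow> f y = h y"
  shows "pd i f x = pd i h x"
proof -
  have "((\<lambda>y. f y) has_derivative D) (at x) \<longleftrightarrow> ((\<lambda>y. h y) has_derivative D) (at x)" for D
    using assms has_derivative_transform_within_open[of f D x UNIV U h]
      has_derivative_transform_within_open[of h D x UNIV U f] by auto
  then show ?thesis by (simp add: pd_def frechet_derivative_def)
qed

lemma pd_has_derivative: "(f has_derivative D) (at x) \<Longrightarrow> pd i f x = D (axis i 1)"
  using frechet_derivative_at[of f D x] by (simp add: pd_def)

lemma pd_const [simp]: "pd i (\<lambda>y. c) x = 0"
  by (rule pd_has_derivative[where D = "\<lambda>v. 0"]) simp

lemma pd_add:
  assumes "f differentiable at x" "h differentiable at x"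
  shows "pd i (\<lambda>y. f y + h y) x = pd i f x + pd i h x"
  using has_derivative_add[of f "frechet_derivative f (at x)" "at x" h "frechet_derivative h (at x)"]
    assms frechet_derivative_works pd_has_derivative unfolding pd_def by (metis (no_types, lifting))

lemma pd_mult:
  assumes "f differentiable at x" "h differentiable at x"
  shows "pd i (\<lambda>y. f y * h y) x = f x * pd i h x + pd i f x * h x"
  using has_derivative_mult[of f "frechet_derivative f (at x)" x UNIV h "frechet_derivative h (at x)"]
    assms frechet_derivative_works pd_has_derivative unfolding pd_def by (metis (no_types, lifting))

lemma pd_cmult:
  assumes "f differentiable at x" shows "pd i (\<lambda>y. c * f y) x = c * pd i f x"
  using pd_mult[of "\<lambda>y. c" x f] assms by simp

lemma pd_uminus:
  assumes "f differentiable at x" shows "pd i (\<lambda>y. - f y) x = - pd i f x"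
  using pd_cmult[of f x i "-1"] assms by simp

lemma pd_diff:
  assumes "f differentiable at x" "h differentiable at x"
  shows "pd i (\<lambda>y. f y - h y) x = pd i f x - pd i h x"
  using pd_add[of f x "\<lambda>y. - h y"] pd_uminus[of h x] assms by (simp add: differentiable_minus)

lemma pd_inverse:
  assumes "f differentiable at x" "f x \<noteq> 0"
  shows "pd i (\<lambda>y. inverse (f y)) x = - (pd i f x * (inverse (f x))\<^sup>2)"
proof -
  have "(f has_derivative frechet_derivative f (at x)) (at x)"
    using assms frechet_derivative_works by blast
  from pd_has_derivative[OF Deriv.has_derivative_inverse[OF assms(2) this]]
  show ?thesis by (simp add: pd_def power2_eq_square mult_ac)
qed

lemma pd_sum:
  assumes "finite I" "\<And>a. a \<in> I \<Longrightarrow> f a differentiable at x"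
  shows "pd i (\<lambda>y. \<Sum>a\<in>I. f a y) x = (\<Sum>a\<in>I. pd i (f a) x)"
proof -
  have "((\<lambda>y. \<Sum>a\<in>I. f a y) has_derivative (\<lambda>v. \<Sum>a\<in>I. frechet_derivative (f a) (at x) v)) (at x)"
    using assms frechet_derivative_works by (intro has_derivative_sum) blast
  from pd_has_derivative[OF this] show ?thesis by (simp add: pd_def)
qed

text \<open>Closure properties of smoothness are proved by induction on the order of differentiability,
  because the product rule turns one derivative of a product into products of lower order.\<close>

fun times_differentiable :: "nat \<Rightarrow> (real^'n::finite) set \<Rightarrow> (real^'n \<Rightarrow> real) \<Rightarrow> bool" where
  "times_differentiable 0 U f \<longleftrightarrow> f differentiable_on U"
| "times_differentiable (Suc k) U f \<longleftrightarrow>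
     f differentiable_on U \<and> (\<forall>i. times_differentiable k U (pd i f))"

lemma times_differentiable_iff:
  "times_differentiable k U f \<longleftrightarrow> (\<forall>is. length is \<le> k \<longrightarrow> foldr pd is f differentiable_on U)"
proof (induction k arbitrary: f)
  case (Suc k)
  have "(\<forall>is. length is \<le> Suc k \<longrightarrow> foldr pd is f differentiable_on U) \<longleftrightarrow>
      foldr pd [] f differentiable_on U \<and>
      (\<forall>i is. length is \<le> k \<longrightarrow> foldr pd (is @ [i]) f differentiable_on U)" (is "?L \<longleftrightarrow> ?R")
  proof
    assume ?R
    show ?L
    proof (intro allI impI)
      fix js :: "'a list" assume "length js \<le> Suc k"
      with \<open>?R\<close> show "foldr pd js f differentiable_on U" by (cases js rule: rev_cases) auto
    qed
  qed (metis length_append_singleton Suc_le_mono le0 list.size(3))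
  then show ?case using Suc by simp
qed simp

lemma smooth_on_iff: "smooth_on U f \<longleftrightarrow> (\<forall>k. times_differentiable k U f)"
  unfolding times_differentiable_iff smooth_on_def by blast

lemma times_differentiable_Suc_imp: "times_differentiable (Suc k) U f \<Longrightarrow> times_differentiable k U f"
  by (simp add: times_differentiable_iff)

lemma differentiable_on_openD:
  "f differentiable_on U \<Longrightarrow> open U \<Longrightarrow> x \<in> U \<Longrightarrow> f differentiable at x"
  by (metis at_within_open differentiable_on_def)

lemma differentiable_on_transform:
  "(\<And>y. y \<in> U \<Longrightarrow> f y = h y) \<Longrightarrow> f differentiable_on U \<Longrightarrow> h differentiable_on U"
  unfolding differentiable_on_def differentiable_def by (metis has_derivative_transform)

lemma times_differentiable_cong:
  assumes "open U" "\<And>y. y \<in> U \<Longrightarrow> f y = h y" "times_differentiable k U f"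
  shows "times_differentiable k U h"
  using assms(2,3)
proof (induction k arbitrary: f h)
  case (Suc k)
  have "times_differentiable k U (pd i h)" for i
  proof (rule Suc.IH)
    show "pd i f y = pd i h y" if "y \<in> U" for y
      by (rule pd_cong[OF assms(1) that]) (rule Suc.prems(1))
    show "times_differentiable k U (pd i f)" using Suc.prems(2) by simp
  qed
  moreover have "h differentiable_on U"
    by (rule differentiable_on_transform[of U f]) (use Suc.prems in auto)
  ultimately show ?case by simp
qed (use differentiable_on_transform in auto)

lemma times_differentiable_add:
  assumes "open U" "times_differentiable k U f" "times_differentiable k U h"
  shows "times_differentiable k U (\<lambda>x. f x + h x)"
  using assms(2,3)
proof (induction k arbitrary: f h)
  case (Suc k)
  have "times_differentiable k U (pd i (\<lambda>x. f x + h x))" for i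
    by (rule times_differentiable_cong[OF assms(1), where f = "\<lambda>x. pd i f x + pd i h x"])
      (use Suc assms(1) in \<open>auto intro!: pd_add[symmetric] intro: differentiable_on_openD\<close>)
  then show ?case using Suc.prems by auto
qed auto

lemma times_differentiable_mult:
  assumes "open U" "times_differentiable k U f" "times_differentiable k U h"
  shows "times_differentiable k U (\<lambda>x. f x * h x)"
  using assms(2,3)
proof (induction k arbitrary: f h)
  case (Suc k)
  have "times_differentiable k U (pd i (\<lambda>x. f x * h x))" for i
  proof (rule times_differentiable_cong[OF assms(1), where f = "\<lambda>x. f x * pd i h x + pd i f x * h x"])
    show "times_differentiable k U (\<lambda>x. f x * pd i h x + pd i f x * h x)"
      using Suc.prems times_differentiable_Suc_imp[of k U]
      by (intro times_differentiable_add assms(1) Suc.IH) auto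
  qed (use Suc.prems assms(1) in \<open>auto intro!: pd_mult[symmetric] intro: differentiable_on_openD\<close>)
  then show ?case using Suc.prems by (auto intro: differentiable_on_mult)
qed (auto intro: differentiable_on_mult)

lemma times_differentiable_const: "times_differentiable k U (\<lambda>x. c)"
proof (induction k arbitrary: c)
  case (Suc k)
  have "pd i (\<lambda>x. c) = (\<lambda>x. 0 :: real)" for i :: 'a by (rule ext) simp
  then show ?case using Suc by simp
qed auto

lemma differentiable_on_inverse:
  fixes f :: "real^'n::finite \<Rightarrow> real"
  assumes "f differentiable_on U" "\<And>x. x \<in> U \<Longrightarrow> f x \<noteq> 0"
  shows "(\<lambda>x. inverse (f x)) differentiable_on U"
  using assms unfolding differentiable_on_def by (auto intro: differentiable_inverse)

lemma times_differentiable_inverse: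
  assumes "open U" "times_differentiable k U f" "\<And>x. x \<in> U \<Longrightarrow> f x \<noteq> 0"
  shows "times_differentiable k U (\<lambda>x. inverse (f x))"
  using assms(2)
proof (induction k)
  case (Suc k)
  have "times_differentiable k U (pd i (\<lambda>x. inverse (f x)))" for i
  proof (rule times_differentiable_cong[OF assms(1),
        where f = "\<lambda>x. (-1) * (pd i f x * (inverse (f x) * inverse (f x)))"])
    show "times_differentiable k U (\<lambda>x. (-1) * (pd i f x * (inverse (f x) * inverse (f x))))"
      using Suc times_differentiable_Suc_imp[of k U f]
      by (intro times_differentiable_mult times_differentiable_const assms(1)) auto
  next
    fix y assume "y \<in> U"
    then have "f differentiable at y" "f y \<noteq> 0"
      using Suc.prems assms differentiable_on_openD by auto
    then show "- 1 * (pd i f y * (inverse (f y) * inverse (f y))) = pd i (\<lambda>x. inverse (f x)) y"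
      by (simp add: pd_inverse power2_eq_square)
  qed
  then show ?case using Suc.prems assms(3) differentiable_on_inverse by auto
qed (use differentiable_on_inverse assms(3) in auto)

lemma smooth_on_cong:
  "open U \<Longrightarrow> (\<And>y. y \<in> U \<Longrightarrow> f y = h y) \<Longrightarrow> smooth_on U f \<Longrightarrow> smooth_on U h"
  using times_differentiable_cong unfolding smooth_on_iff by blast

lemma smooth_on_pd: "smooth_on U f \<Longrightarrow> smooth_on U (\<lambda>x. pd i f x)"
  by (metis smooth_on_iff times_differentiable.simps(2))

lemma smooth_on_differentiable: "smooth_on U f \<Longrightarrow> open U \<Longrightarrow> x \<in> U \<Longrightarrow> f differentiable at x"
  using differentiable_on_openD smooth_on_iff times_differentiable.simps(1) by blast

lemma smooth_on_continuous_on: "smooth_on U f \<Longrightarrow> continuous_on U f"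
  using differentiable_imp_continuous_on smooth_on_iff times_differentiable.simps(1) by blast

lemma smooth_on_const: "smooth_on U (\<lambda>x. c)"
  by (simp add: smooth_on_iff times_differentiable_const)

lemma smooth_on_add: "open U \<Longrightarrow> smooth_on U f \<Longrightarrow> smooth_on U h \<Longrightarrow> smooth_on U (\<lambda>x. f x + h x)"
  by (simp add: smooth_on_iff times_differentiable_add)

lemma smooth_on_mult: "open U \<Longrightarrow> smooth_on U f \<Longrightarrow> smooth_on U h \<Longrightarrow> smooth_on U (\<lambda>x. f x * h x)"
  by (simp add: smooth_on_iff times_differentiable_mult)

lemma smooth_on_inverse:
  "open U \<Longrightarrow> smooth_on U f \<Longrightarrow> (\<And>x. x \<in> U \<Longrightarrow> f x \<noteq> 0) \<Longrightarrow> smooth_on U (\<lambda>x. inverse (f x))"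
  by (simp add: smooth_on_iff times_differentiable_inverse)

lemma smooth_on_uminus: "open U \<Longrightarrow> smooth_on U f \<Longrightarrow> smooth_on U (\<lambda>x. - f x)"
  using smooth_on_mult[OF _ smooth_on_const, of U f "-1"] by simp

lemma smooth_on_diff: "open U \<Longrightarrow> smooth_on U f \<Longrightarrow> smooth_on U h \<Longrightarrow> smooth_on U (\<lambda>x. f x - h x)"
  using smooth_on_add[OF _ _ smooth_on_uminus, of U f h] by simp

lemma smooth_on_divide:
  "open U \<Longrightarrow> smooth_on U f \<Longrightarrow> smooth_on U h \<Longrightarrow> (\<And>x. x \<in> U \<Longrightarrow> h x \<noteq> 0) \<Longrightarrow>
   smooth_on U (\<lambda>x. f x / h x)"
  unfolding divide_inverse by (intro smooth_on_mult smooth_on_inverse)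

lemma smooth_on_power: "open U \<Longrightarrow> smooth_on U f \<Longrightarrow> smooth_on U (\<lambda>x. f x ^ m)"
  by (induction m) (auto intro: smooth_on_const smooth_on_mult)

lemma smooth_on_sum:
  assumes "open U" "finite I" "\<And>a. a \<in> I \<Longrightarrow> smooth_on U (f a)"
  shows "smooth_on U (\<lambda>x. \<Sum>a\<in>I. f a x)"
  using assms(2,3)
  by (induction I rule: finite_induct) (auto intro: smooth_on_const smooth_on_add[OF assms(1)])

lemma smooth_on_prod:
  assumes "open U" "finite I" "\<And>a. a \<in> I \<Longrightarrow> smooth_on U (f a)"
  shows "smooth_on U (\<lambda>x. \<Prod>a\<in>I. f a x)"
  using assms(2,3)
  by (induction I rule: finite_induct) (auto intro: smooth_on_const smooth_on_mult[OF assms(1)])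

lemmas smooth_on_intros =
  smooth_on_add smooth_on_mult smooth_on_uminus smooth_on_diff
  smooth_on_divide smooth_on_power smooth_on_sum

subsection \<open>Mixed partial derivatives\<close>

lemma pd_along_line:
  assumes "f differentiable at (a + s *\<^sub>R axis i 1)"
  shows "((\<lambda>s. f (a + s *\<^sub>R axis i 1)) has_real_derivative pd i f (a + s *\<^sub>R axis i 1)) (at s)"
proof -
  let ?D = "frechet_derivative f (at (a + s *\<^sub>R axis i 1))"
  have "(f has_derivative ?D) (at (a + s *\<^sub>R axis i 1))"
    using assms frechet_derivative_works by blast
  moreover have "((\<lambda>s. a + s *\<^sub>R axis i 1) has_derivative (\<lambda>t. t *\<^sub>R axis i 1)) (at s)"
    by (auto intro!: derivative_eq_intros)
  ultimately have "((\<lambda>s. f (a + s *\<^sub>R axis i 1)) has_derivative (\<lambda>t. ?D (t *\<^sub>R axis i 1))) (at s)"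
    using has_derivative_compose by blast
  moreover have "?D (t *\<^sub>R axis i 1) = pd i f (a + s *\<^sub>R axis i 1) * t" for t
    using linear_scale[OF linear_frechet_derivative[OF assms], of t "axis i 1"] by (simp add: pd_def)
  ultimately show ?thesis by (simp add: has_field_derivative_def)
qed

text \<open>The mean value theorem, applied in the two coordinate directions in turn.  The left-hand side is
  symmetric in \<open>i\<close> and \<open>j\<close>, so two mixed derivatives agree at points arbitrarily close to \<open>x\<close>.\<close>

lemma second_difference_mean_value:
  fixes f :: "real^'n::finite \<Rightarrow> real"
  assumes f: "smooth_on U f" "open U" and h: "0 < h"
    and U: "\<And>s t. \<lbrakk>0 \<le> s; s \<le> h; 0 \<le> t; t \<le> h\<rbrakk> \<Longrightarrow> x + s *\<^sub>R axis i 1 + t *\<^sub>R axis j 1 \<in> U"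
  shows "\<exists>s t. 0 < s \<and> s < h \<and> 0 < t \<and> t < h \<and>
     f (x + h *\<^sub>R axis i 1 + h *\<^sub>R axis j 1) - f (x + h *\<^sub>R axis i 1) - f (x + h *\<^sub>R axis j 1) + f x
       = h\<^sup>2 * pd j (pd i f) (x + s *\<^sub>R axis i 1 + t *\<^sub>R axis j 1)"
proof -
  let ?i = "axis i 1 :: real^'n" and ?j = "axis j 1 :: real^'n"
  note d = smooth_on_differentiable[OF _ f(2)]
  have "((\<lambda>s. f (x + h *\<^sub>R ?j + s *\<^sub>R ?i) - f (x + s *\<^sub>R ?i)) has_real_derivative
      pd i f (x + h *\<^sub>R ?j + s *\<^sub>R ?i) - pd i f (x + s *\<^sub>R ?i)) (at s)" if "0 \<le> s" "s \<le> h" for s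
    using U[of s h] U[of s 0] that h
    by (intro DERIV_diff pd_along_line d f(1)) (auto simp: add_ac)
  from MVT2[OF h this] obtain s where s: "0 < s" "s < h"
    and 1: "(f (x + h *\<^sub>R ?j + h *\<^sub>R ?i) - f (x + h *\<^sub>R ?i)) - (f (x + h *\<^sub>R ?j + 0 *\<^sub>R ?i) - f (x + 0 *\<^sub>R ?i))
       = (h - 0) * (pd i f (x + h *\<^sub>R ?j + s *\<^sub>R ?i) - pd i f (x + s *\<^sub>R ?i))" by blast
  have "((\<lambda>t. pd i f (x + s *\<^sub>R ?i + t *\<^sub>R ?j)) has_real_derivative
      pd j (pd i f) (x + s *\<^sub>R ?i + t *\<^sub>R ?j)) (at t)" if "0 \<le> t" "t \<le> h" for t
    using U[of s t] that s by (intro pd_along_line d smooth_on_pd f(1)) auto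
  from MVT2[OF h this] obtain t where t: "0 < t" "t < h"
    and 2: "pd i f (x + s *\<^sub>R ?i + h *\<^sub>R ?j) - pd i f (x + s *\<^sub>R ?i + 0 *\<^sub>R ?j)
       = (h - 0) * pd j (pd i f) (x + s *\<^sub>R ?i + t *\<^sub>R ?j)" by blast
  have e: "x + h *\<^sub>R ?j + r *\<^sub>R ?i = x + r *\<^sub>R ?i + h *\<^sub>R ?j" for r by (simp add: add_ac)
  have "f (x + h *\<^sub>R ?i + h *\<^sub>R ?j) - f (x + h *\<^sub>R ?i) - f (x + h *\<^sub>R ?j) + f x
       = h * (pd i f (x + s *\<^sub>R ?i + h *\<^sub>R ?j) - pd i f (x + s *\<^sub>R ?i))"
    using 1 unfolding e by simp
  also have "\<dots> = h\<^sup>2 * pd j (pd i f) (x + s *\<^sub>R ?i + t *\<^sub>R ?j)"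
    using 2 by (simp add: power2_eq_square)
  finally show ?thesis using s t by blast
qed

lemma pd_commute:
  fixes f :: "real^'n::finite \<Rightarrow> real"
  assumes f: "smooth_on U f" "open U" "x \<in> U"
  shows "pd i (pd j f) x = pd j (pd i f) x"
proof (rule ccontr)
  let ?a = "pd i (pd j f)" and ?b = "pd j (pd i f)"
  assume ne: "?a x \<noteq> ?b x"
  define e where "e = \<bar>?a x - ?b x\<bar> / 2"
  have "e > 0" using ne by (simp add: e_def)
  have "isCont ?a x" "isCont ?b x"
    using smooth_on_continuous_on[OF smooth_on_pd[OF smooth_on_pd[OF f(1)]]] f
    by (auto simp: continuous_on_eq_continuous_at)
  then obtain d1 d2 where d: "d1 > 0" "d2 > 0"
      "\<And>y. dist y x < d1 \<Longrightarrow> dist (?a y) (?a x) < e" "\<And>y. dist y x < d2 \<Longrightarrow> dist (?b y) (?b x) < e"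
    using \<open>e > 0\<close> unfolding continuous_at_eps_delta by metis
  obtain r where r: "r > 0" "ball x r \<subseteq> U" using f(2,3) openE by blast
  define h where "h = min r (min d1 d2) / 3"
  have h: "h > 0" using r d by (simp add: h_def)
  have near: "dist (x + s *\<^sub>R axis a 1 + t *\<^sub>R axis b 1) x < min r (min d1 d2)"
    if "0 \<le> s" "s \<le> h" "0 \<le> t" "t \<le> h" for s t and a b :: 'n
  proof -
    have "norm (s *\<^sub>R axis a 1 + t *\<^sub>R axis b 1 :: real^'n) \<le> s + t"
      by (rule order_trans[OF norm_triangle_ineq]) (use that in \<open>simp add: norm_axis_1\<close>)
    also have "\<dots> < 3 * h" using that h by simp
    finally show ?thesis by (simp add: h_def dist_norm add.assoc)
  qed
  have inU: "x + s *\<^sub>R axis a 1 + t *\<^sub>R axis b 1 \<in> U"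
    if "0 \<le> s" "s \<le> h" "0 \<le> t" "t \<le> h" for s t and a b :: 'n
    using near[OF that, of a b] r(2) by (auto simp: dist_commute)
  obtain s t where st: "0 < s" "s < h" "0 < t" "t < h" and
    1: "f (x + h *\<^sub>R axis i 1 + h *\<^sub>R axis j 1) - f (x + h *\<^sub>R axis i 1) - f (x + h *\<^sub>R axis j 1) + f x
       = h\<^sup>2 * ?b (x + s *\<^sub>R axis i 1 + t *\<^sub>R axis j 1)"
    using second_difference_mean_value[OF f(1,2) h inU, of i j] by blast
  obtain s' t' where st': "0 < s'" "s' < h" "0 < t'" "t' < h" and
    2: "f (x + h *\<^sub>R axis j 1 + h *\<^sub>R axis i 1) - f (x + h *\<^sub>R axis j 1) - f (x + h *\<^sub>R axis i 1) + f x
       = h\<^sup>2 * ?a (x + s' *\<^sub>R axis j 1 + t' *\<^sub>R axis i 1)"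
    using second_difference_mean_value[OF f(1,2) h inU, of j i] by blast
  have "h\<^sup>2 * ?a (x + s' *\<^sub>R axis j 1 + t' *\<^sub>R axis i 1) = h\<^sup>2 * ?b (x + s *\<^sub>R axis i 1 + t *\<^sub>R axis j 1)"
    using 1 2 unfolding add.assoc[of x] add.commute[of "h *\<^sub>R axis j 1"] by linarith
  then have "?a (x + s' *\<^sub>R axis j 1 + t' *\<^sub>R axis i 1) = ?b (x + s *\<^sub>R axis i 1 + t *\<^sub>R axis j 1)"
    using h by simp
  moreover have "dist (?a (x + s' *\<^sub>R axis j 1 + t' *\<^sub>R axis i 1)) (?a x) < e"
    using near[of s' t'] st' by (intro d) auto
  moreover have "dist (?b (x + s *\<^sub>R axis i 1 + t *\<^sub>R axis j 1)) (?b x) < e"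
    using near[of s t] st by (intro d) auto
  moreover have "\<bar>a - b\<bar> \<le> \<bar>z - a\<bar> + \<bar>z - b\<bar>" for a b z :: real by arith
  ultimately show False unfolding e_def dist_real_def by (metis field_sum_of_halves add_strict_mono not_less)
qed

section \<open>Metric calculus in one coordinate system\<close>

definition kronecker :: "'i \<Rightarrow> 'i \<Rightarrow> real" where
  "kronecker i j = (if i = j then 1 else 0)"

lemma kronecker_sums [simp]:
  fixes i :: "'i::finite"
  shows "(\<Sum>k\<in>UNIV. kronecker i k * f k) = f i" "(\<Sum>k\<in>UNIV. kronecker k i * f k) = f i"
    "(\<Sum>k\<in>UNIV. f k * kronecker i k) = f i" "(\<Sum>k\<in>UNIV. f k * kronecker k i) = f i"
  by (simp_all add: kronecker_def if_distrib[of "\<lambda>z. z * _"] if_distrib[of "\<lambda>z. _ * z"] cong: if_cong)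

lemma kronecker_trace [simp]: "(\<Sum>k\<in>(UNIV::'i::finite set). kronecker k k) = real CARD('i)"
  by (simp add: kronecker_def)

lemma pd_power2: "f differentiable at x \<Longrightarrow> pd i (\<lambda>y. (f y)\<^sup>2) x = 2 * f x * pd i f x"
  by (simp add: power2_eq_square pd_mult)

lemma matrix_inv:
  fixes A :: "real^'n^'n::finite"
  assumes "invertible A" shows "A ** matrix_inv A = mat 1" "matrix_inv A ** A = mat 1"
  using someI_ex[OF assms[unfolded invertible_def]] by (simp_all add: matrix_inv_def)

lemma matrix_inv_eqI:
  fixes A B :: "real^'n^'n::finite"
  assumes "A ** B = mat 1" shows "matrix_inv A = B"
proof -
  have "invertible A" using assms invertible_right_inverse by blast
  then have "matrix_inv A ** A = mat 1" by (metis matrix_inv(2))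
  then show ?thesis by (metis assms matrix_mul_assoc matrix_mul_lid matrix_mul_rid)
qed

locale metric_patch =
  fixes U :: "(real^'n::finite) set" and g :: "'n comps2"
  assumes open_U: "open U"
    and smooth_g: "\<And>i j. smooth_on U (\<lambda>x. g x i j)"
    and g_commute: "\<And>x i j. x \<in> U \<Longrightarrow> g x i j = g x j i"
    and g_invertible: "\<And>x. x \<in> U \<Longrightarrow> invertible (\<chi> i j. g x i j)"
begin

lemmas smooth_intros = smooth_on_intros[OF open_U] smooth_on_const smooth_on_pd
lemmas diff_at = smooth_on_differentiable[OF _ open_U]
lemmas cong_pd = pd_cong[OF open_U]

lemma inverse_metric_mult:
  assumes "x \<in> U"
  shows "(\<Sum>k\<in>UNIV. inv_metric g x i k * g x k j) = kronecker i j"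
    and "(\<Sum>k\<in>UNIV. g x i k * inv_metric g x k j) = kronecker i j"
proof -
  let ?A = "\<chi> i j. g x i j"
  have "(matrix_inv ?A ** ?A) $ i $ j = kronecker i j" "(?A ** matrix_inv ?A) $ i $ j = kronecker i j"
    by (simp_all only: matrix_inv[OF g_invertible[OF assms]]) (simp_all add: mat_def kronecker_def)
  then show "(\<Sum>k\<in>UNIV. inv_metric g x i k * g x k j) = kronecker i j"
    "(\<Sum>k\<in>UNIV. g x i k * inv_metric g x k j) = kronecker i j"
    by (simp_all add: matrix_matrix_mult_def inv_metric_def)
qed

lemma inv_metric_commute:
  assumes "x \<in> U" shows "inv_metric g x i j = inv_metric g x j i"
proof -
  let ?A = "\<chi> i j. g x i j"
  have "?A = transpose ?A" using g_commute[OF assms] by (simp add: transpose_def vec_eq_iff)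
  then have "?A ** transpose (matrix_inv ?A) = transpose (matrix_inv ?A ** ?A)"
    by (simp add: matrix_transpose_mul)
  also have "\<dots> = mat 1" using matrix_inv[OF g_invertible[OF assms]] by simp
  finally have "matrix_inv ?A = transpose (matrix_inv ?A)" by (rule matrix_inv_eqI)
  then have "matrix_inv ?A $ i $ j = transpose (matrix_inv ?A) $ i $ j" by simp
  then show ?thesis by (simp add: inv_metric_def transpose_def)
qed

text \<open>Cramer's rule expresses the inverse metric by determinants, hence by polynomials and one
  division.\<close>

lemma smooth_inv_metric: "smooth_on U (\<lambda>x. inv_metric g x i j)"
proof -
  define d where "d x = det (\<chi> a b. g x a b)" for x
  define c where "c x = det (\<chi> a b. if b = i then axis j 1 $ a else g x a b)" for x
  have nz: "d x \<noteq> 0" if "x \<in> U" for x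
    using g_invertible[OF that] by (simp add: d_def invertible_det_nz)
  have "inv_metric g x i j = c x / d x" if "x \<in> U" for x
  proof -
    let ?A = "\<chi> a b. g x a b"
    have "?A *v (matrix_inv ?A *v axis j 1) = axis j 1"
      using matrix_inv[OF g_invertible[OF that]] by (simp add: matrix_vector_mul_assoc)
    then have "(matrix_inv ?A *v axis j 1) = (\<chi> k. det (\<chi> a b. if b = k then axis j 1 $ a else ?A $ a $ b) / det ?A)"
      using nz[OF that] cramer[of ?A "matrix_inv ?A *v axis j 1" "axis j 1"] by (simp add: d_def)
    then have "(matrix_inv ?A *v axis j 1) $ i = c x / d x" by (simp add: c_def d_def cong: if_cong)
    moreover have "(matrix_inv ?A *v axis j 1) $ i = matrix_inv ?A $ i $ j"
      by (simp add: matrix_vector_mult_basis column_def)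
    ultimately show ?thesis by (simp add: inv_metric_def)
  qed
  moreover have "smooth_on U (\<lambda>x. c x / d x)"
  proof (intro smooth_on_divide open_U nz)
    have entry: "smooth_on U (\<lambda>x. if b = i then axis j 1 $ a else g x a b)" for a b
      by (cases "b = i") (auto intro: smooth_on_const smooth_g)
    show "smooth_on U c" unfolding c_def det_def
      by (intro smooth_on_sum smooth_on_mult smooth_on_const smooth_on_prod open_U) (auto intro: entry)
    show "smooth_on U d" unfolding d_def det_def
      by (intro smooth_on_sum smooth_on_mult smooth_on_const smooth_on_prod open_U) (auto intro: smooth_g)
  qed
  ultimately show ?thesis using smooth_on_cong[OF open_U, of "\<lambda>x. c x / d x"] by simp
qed

lemma smooth_christoffel: "smooth_on U (\<lambda>x. christoffel g x k i j)"
  unfolding christoffel_def by (intro smooth_intros smooth_inv_metric smooth_g) auto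

lemma pd_metric_commute: "x \<in> U \<Longrightarrow> pd k (\<lambda>y. g y i j) x = pd k (\<lambda>y. g y j i) x"
  by (rule cong_pd) (auto simp: g_commute)

lemma christoffel_commute: "x \<in> U \<Longrightarrow> christoffel g x k i j = christoffel g x k j i"
  using pd_metric_commute[of x _ i j] by (simp add: christoffel_def algebra_simps)

lemma raise_lower:
  assumes "x \<in> U"
  shows "(\<Sum>a\<in>UNIV. g x i a * (\<Sum>b\<in>UNIV. inv_metric g x a b * v b)) = v i"
    and "(\<Sum>a\<in>UNIV. inv_metric g x i a * (\<Sum>b\<in>UNIV. g x a b * v b)) = v i"
proof -
  have "(\<Sum>a\<in>UNIV. g x i a * (\<Sum>b\<in>UNIV. inv_metric g x a b * v b))
      = (\<Sum>b\<in>UNIV. (\<Sum>a\<in>UNIV. g x i a * inv_metric g x a b) * v b)"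
    by (simp add: sum_distrib_left sum_distrib_right mult.assoc) (rule sum.swap)
  then show "(\<Sum>a\<in>UNIV. g x i a * (\<Sum>b\<in>UNIV. inv_metric g x a b * v b)) = v i"
    by (simp add: inverse_metric_mult[OF assms])
  have "(\<Sum>a\<in>UNIV. inv_metric g x i a * (\<Sum>b\<in>UNIV. g x a b * v b))
      = (\<Sum>b\<in>UNIV. (\<Sum>a\<in>UNIV. inv_metric g x i a * g x a b) * v b)"
    by (simp add: sum_distrib_left sum_distrib_right mult.assoc) (rule sum.swap)
  then show "(\<Sum>a\<in>UNIV. inv_metric g x i a * (\<Sum>b\<in>UNIV. g x a b * v b)) = v i"
    by (simp add: inverse_metric_mult[OF assms])
qed

lemma lower_christoffel:
  assumes "x \<in> U"
  shows "(\<Sum>k\<in>UNIV. g x m k * christoffel g x k i j)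
     = (pd i (\<lambda>y. g y j m) x + pd j (\<lambda>y. g y i m) x - pd m (\<lambda>y. g y i j) x) / 2"
  using raise_lower(1)[OF assms, of m
      "\<lambda>l. (pd i (\<lambda>y. g y j l) x + pd j (\<lambda>y. g y i l) x - pd l (\<lambda>y. g y i j) x) / 2"]
  by (simp add: christoffel_def sum_divide_distrib)

lemma pd_metric:
  assumes "x \<in> U"
  shows "pd k (\<lambda>y. g y i j) x
     = (\<Sum>l\<in>UNIV. christoffel g x l i k * g x l j) + (\<Sum>l\<in>UNIV. christoffel g x l j k * g x i l)"
proof -
  have "(\<Sum>l\<in>UNIV. christoffel g x l i k * g x l j) = (\<Sum>l\<in>UNIV. g x j l * christoffel g x l i k)"
    using g_commute[OF assms] by (simp add: mult.commute)
  moreover have "(\<Sum>l\<in>UNIV. christoffel g x l j k * g x i l) = (\<Sum>l\<in>UNIV. g x i l * christoffel g x l j k)"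
    by (simp add: mult.commute)
  ultimately show ?thesis
    using pd_metric_commute[OF assms, of _ j i] pd_metric_commute[OF assms, of _ k i]
      pd_metric_commute[OF assms, of _ k j]
    by (simp add: lower_christoffel[OF assms] field_simps)
qed

lemma metric_trace:
  assumes "x \<in> U"
  shows "(\<Sum>i\<in>UNIV. \<Sum>j\<in>UNIV. inv_metric g x i j * g x i j) = real CARD('n)"
  using inverse_metric_mult(1)[OF assms] g_commute[OF assms]
  by simp

subsection \<open>Covariant derivatives\<close>

lemma cov_deriv2_cong:
  assumes "x \<in> U" "\<And>y i j. y \<in> U \<Longrightarrow> h y i j = h' y i j"
  shows "cov_deriv2 g h x i j k = cov_deriv2 g h' x i j k"
proof -
  have "pd k (\<lambda>y. h y i j) x = pd k (\<lambda>y. h' y i j) x" using assms by (intro cong_pd) auto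
  then show ?thesis by (simp add: cov_deriv2_def assms)
qed

lemma cov_deriv2_add:
  assumes "x \<in> U" "\<And>i j. smooth_on U (\<lambda>y. h y i j)" "\<And>i j. smooth_on U (\<lambda>y. h' y i j)"
  shows "cov_deriv2 g (\<lambda>y i j. h y i j + h' y i j) x i j k
     = cov_deriv2 g h x i j k + cov_deriv2 g h' x i j k"
  using assms by (simp add: cov_deriv2_def pd_add[OF diff_at diff_at] algebra_simps sum.distrib)

lemma cov_deriv2_scale:
  assumes "x \<in> U" "smooth_on U a" "\<And>i j. smooth_on U (\<lambda>y. h y i j)"
  shows "cov_deriv2 g (\<lambda>y i j. a y * h y i j) x i j k
     = a x * cov_deriv2 g h x i j k + pd k a x * h x i j"
  using assms by (simp add: cov_deriv2_def pd_mult[OF diff_at diff_at] algebra_simps sum_distrib_left)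

lemma cov_deriv2_tensor:
  assumes "x \<in> U" "\<And>i. smooth_on U (\<lambda>y. \<alpha> y i)" "\<And>i. smooth_on U (\<lambda>y. \<beta> y i)"
  shows "cov_deriv2 g (\<lambda>y i j. \<alpha> y i * \<beta> y j) x i j k
     = \<alpha> x i * cov_deriv1 g \<beta> x j k + cov_deriv1 g \<alpha> x i k * \<beta> x j"
  using assms
  by (simp add: cov_deriv2_def cov_deriv1_def pd_mult[OF diff_at diff_at] algebra_simps sum_distrib_left)

lemma cov_deriv2_metric:
  assumes "x \<in> U" shows "cov_deriv2 g g x i j k = 0"
  by (simp add: cov_deriv2_def pd_metric[OF assms])

lemma smooth_hessian: "smooth_on U f \<Longrightarrow> smooth_on U (\<lambda>x. hessian g f x i j)"
  unfolding hessian_def cov_deriv1_def grad_def by (intro smooth_intros smooth_christoffel) auto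

lemma smooth_laplacian: "smooth_on U f \<Longrightarrow> smooth_on U (laplacian g f)"
  using smooth_on_sum[OF open_U, of UNIV "\<lambda>i x. \<Sum>j\<in>UNIV. inv_metric g x i j * hessian g f x i j"]
  unfolding laplacian_def[abs_def]
  by (auto intro!: smooth_on_sum smooth_on_mult open_U smooth_inv_metric smooth_hessian)

lemma hessian_commute:
  assumes "x \<in> U" "smooth_on U f" shows "hessian g f x i j = hessian g f x j i"
  using pd_commute[OF assms(2) open_U assms(1), of i j]
  by (simp add: hessian_def cov_deriv1_def grad_def[abs_def] christoffel_commute[OF assms(1), of _ i j])

end

section \<open>Conformal change of the metric\<close>

locale conformal_patch = metric_patch U g for U :: "(real^'n::finite) set" and g :: "'n comps2" +
  fixes w :: "real^'n \<Rightarrow> real" and g' :: "'n comps2"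
  assumes smooth_w: "smooth_on U w" and w_nonzero: "\<And>x. x \<in> U \<Longrightarrow> w x \<noteq> 0"
    and g'_eq: "\<And>x i j. x \<in> U \<Longrightarrow> g' x i j = (w x)\<^sup>2 * g x i j"
begin

definition \<Upsilon> :: "'n comps1" where "\<Upsilon> x i = pd i w x / w x"

definition \<Upsilon>_up :: "'n comps1" where "\<Upsilon>_up x k = (\<Sum>l\<in>UNIV. inv_metric g x k l * \<Upsilon> x l)"

definition \<Upsilon>_square :: "real^'n \<Rightarrow> real" where "\<Upsilon>_square x = (\<Sum>k\<in>UNIV. \<Upsilon> x k * \<Upsilon>_up x k)"

lemma smooth_\<Upsilon>: "smooth_on U (\<lambda>x. \<Upsilon> x i)"
  unfolding \<Upsilon>_def by (intro smooth_intros smooth_w w_nonzero)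

lemma smooth_\<Upsilon>_up: "smooth_on U (\<lambda>x. \<Upsilon>_up x i)"
  unfolding \<Upsilon>_up_def by (intro smooth_intros smooth_\<Upsilon> smooth_inv_metric) auto

lemma pd_w: "x \<in> U \<Longrightarrow> pd i w x = w x * \<Upsilon> x i"
  by (simp add: \<Upsilon>_def w_nonzero)

lemma pd_\<Upsilon>_commute:
  assumes "x \<in> U" shows "pd i (\<lambda>y. \<Upsilon> y j) x = pd j (\<lambda>y. \<Upsilon> y i) x"
proof -
  have "pd i (pd j w) x = w x * pd i (\<lambda>y. \<Upsilon> y j) x + pd i w x * \<Upsilon> x j" for i j
  proof -
    have "pd i (pd j w) x = pd i (\<lambda>y. w y * \<Upsilon> y j) x"
      by (rule cong_pd[OF assms]) (rule pd_w)
    then show ?thesis by (simp add: pd_mult[OF diff_at diff_at] smooth_w smooth_\<Upsilon> assms)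
  qed
  from this[of i j] this[of j i] pd_commute[OF smooth_w open_U assms, of i j] w_nonzero[OF assms]
  show ?thesis by (simp add: pd_w[OF assms])
qed

lemma g'_inverse:
  assumes "x \<in> U"
  shows "(\<chi> i j. g' x i j) ** (\<chi> i j. inv_metric g x i j / (w x)\<^sup>2) = mat 1"
  using inverse_metric_mult(2)[OF assms] w_nonzero[OF assms]
  by (simp add: matrix_matrix_mult_def vec_eq_iff mat_def kronecker_def g'_eq[OF assms])

lemma inv_g':
  assumes "x \<in> U" shows "inv_metric g' x i j = inv_metric g x i j / (w x)\<^sup>2"
  by (simp add: inv_metric_def[of g'] matrix_inv_eqI[OF g'_inverse[OF assms]])

sublocale conf: metric_patch U g'
proof
  show "smooth_on U (\<lambda>x. g' x i j)" for i j
    by (rule smooth_on_cong[OF open_U g'_eq[symmetric]])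
      (auto intro!: smooth_intros smooth_w smooth_g)
  show "invertible (\<chi> i j. g' x i j)" if "x \<in> U" for x
    using g'_inverse[OF that] invertible_right_inverse by blast
qed (use open_U g_commute g'_eq in auto)

lemma lower_\<Upsilon>_up: "x \<in> U \<Longrightarrow> (\<Sum>k\<in>UNIV. g x i k * \<Upsilon>_up x k) = \<Upsilon> x i"
  unfolding \<Upsilon>_up_def by (rule raise_lower)

lemma lower_\<Upsilon>_up': "x \<in> U \<Longrightarrow> (\<Sum>k\<in>UNIV. g x k i * \<Upsilon>_up x k) = \<Upsilon> x i"
  using lower_\<Upsilon>_up[of x i] g_commute[of x i] by simp

text \<open>The difference of the Christoffel symbols of \<open>g'\<close> and \<open>g\<close>.\<close>

definition shift :: "real^'n \<Rightarrow> 'n \<Rightarrow> 'n \<Rightarrow> 'n \<Rightarrow> real" where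
  "shift x k i j = \<Upsilon> x i * kronecker k j + \<Upsilon> x j * kronecker k i - g x i j * \<Upsilon>_up x k"

lemma christoffel_conf:
  assumes "x \<in> U"
  shows "christoffel g' x k i j = christoffel g x k i j + shift x k i j"
proof -
  have pd': "pd a (\<lambda>y. g' y i j) x = (w x)\<^sup>2 * (pd a (\<lambda>y. g y i j) x + 2 * \<Upsilon> x a * g x i j)" for a i j
  proof -
    have "pd a (\<lambda>y. g' y i j) x = pd a (\<lambda>y. (w y)\<^sup>2 * g y i j) x"
      by (rule cong_pd[OF assms]) (rule g'_eq)
    also have "\<dots> = (w x)\<^sup>2 * pd a (\<lambda>y. g y i j) x + 2 * w x * pd a w x * g x i j"
      using assms smooth_w smooth_g smooth_on_power[OF open_U smooth_w, of 2]
      by (simp add: pd_mult[OF diff_at diff_at] pd_power2[OF diff_at])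
    finally show ?thesis by (simp add: pd_w[OF assms] power2_eq_square algebra_simps)
  qed
  have "inv_metric g' x k l * (pd i (\<lambda>y. g' y j l) x + pd j (\<lambda>y. g' y i l) x - pd l (\<lambda>y. g' y i j) x)
      = inv_metric g x k l * (pd i (\<lambda>y. g y j l) x + pd j (\<lambda>y. g y i l) x - pd l (\<lambda>y. g y i j) x)
        + 2 * (\<Upsilon> x i * (inv_metric g x k l * g x l j) + \<Upsilon> x j * (inv_metric g x k l * g x l i)
          - g x i j * (inv_metric g x k l * \<Upsilon> x l))" for l
    using w_nonzero[OF assms] g_commute[OF assms, of j l] g_commute[OF assms, of i l]
    by (simp add: pd' inv_g'[OF assms] field_simps)
  then have "christoffel g' x k i j = christoffel g x k i j
      + (\<Upsilon> x i * (\<Sum>l\<in>UNIV. inv_metric g x k l * g x l j)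
        + \<Upsilon> x j * (\<Sum>l\<in>UNIV. inv_metric g x k l * g x l i) - g x i j * \<Upsilon>_up x k)"
    by (simp add: christoffel_def \<Upsilon>_up_def sum.distrib sum_subtractf add_divide_distrib
        sum_distrib_left[symmetric])
  then show ?thesis by (simp add: shift_def inverse_metric_mult[OF assms])
qed

lemma shift_contract:
  "(\<Sum>l\<in>UNIV. shift x l i j * v l) = \<Upsilon> x i * v j + \<Upsilon> x j * v i - g x i j * (\<Sum>l\<in>UNIV. \<Upsilon>_up x l * v l)"
proof -
  have "shift x l i j * v l = \<Upsilon> x i * (kronecker l j * v l) + \<Upsilon> x j * (kronecker l i * v l)
      - g x i j * (\<Upsilon>_up x l * v l)" for l by (simp add: shift_def algebra_simps)
  then show ?thesis by (simp add: sum.distrib sum_subtractf sum_distrib_left[symmetric])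
qed

lemma shift_\<Upsilon>:
  "(\<Sum>m\<in>UNIV. shift x m i k * \<Upsilon> x m) = 2 * \<Upsilon> x i * \<Upsilon> x k - g x i k * \<Upsilon>_square x"
  unfolding shift_contract[of x i k "\<Upsilon> x"] \<Upsilon>_square_def by (simp add: mult.commute[of "\<Upsilon>_up x _"])

lemma hessian_conf:
  assumes "x \<in> U"
  shows "hessian g' f x i j = hessian g f x i j - \<Upsilon> x i * pd j f x - \<Upsilon> x j * pd i f x
     + g x i j * (\<Sum>l\<in>UNIV. \<Upsilon>_up x l * pd l f x)"
proof -
  have "hessian g' f x i j = hessian g f x i j - (\<Sum>l\<in>UNIV. shift x l i j * pd l f x)"
    by (simp add: hessian_def cov_deriv1_def grad_def christoffel_conf[OF assms] ring_distribs sum.distrib)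
  then show ?thesis by (simp add: shift_contract)
qed

lemma cov_deriv2_conf:
  assumes "x \<in> U"
  shows "cov_deriv2 g' h x i j k = cov_deriv2 g h x i j k
     - (\<Upsilon> x i * h x k j + \<Upsilon> x k * h x i j - g x i k * (\<Sum>l\<in>UNIV. \<Upsilon>_up x l * h x l j))
     - (\<Upsilon> x j * h x i k + \<Upsilon> x k * h x i j - g x j k * (\<Sum>l\<in>UNIV. \<Upsilon>_up x l * h x i l))"
proof -
  have "cov_deriv2 g' h x i j k = cov_deriv2 g h x i j k
      - (\<Sum>l\<in>UNIV. shift x l i k * h x l j) - (\<Sum>l\<in>UNIV. shift x l j k * h x i l)"
    by (simp add: cov_deriv2_def christoffel_conf[OF assms] ring_distribs sum.distrib)
  then show ?thesis
    using shift_contract[of x i k "\<lambda>l. h x l j"] shift_contract[of x j k "\<lambda>l. h x i l"] by simp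
qed

subsection \<open>Ricci curvature\<close>

lemma pd_shift:
  assumes "x \<in> U"
  shows "pd a (\<lambda>y. shift y l i j) x = pd a (\<lambda>y. \<Upsilon> y i) x * kronecker l j
     + pd a (\<lambda>y. \<Upsilon> y j) x * kronecker l i
     - (g x i j * pd a (\<lambda>y. \<Upsilon>_up y l) x + pd a (\<lambda>y. g y i j) x * \<Upsilon>_up x l)"
proof -
  have s: "smooth_on U (\<lambda>y. \<Upsilon> y i * kronecker l j)" "smooth_on U (\<lambda>y. \<Upsilon> y j * kronecker l i)"
    "smooth_on U (\<lambda>y. g y i j * \<Upsilon>_up y l)"
    by (intro smooth_intros smooth_\<Upsilon> smooth_g smooth_\<Upsilon>_up)+
  have "pd a (\<lambda>y. shift y l i j) x = pd a (\<lambda>y. \<Upsilon> y i * kronecker l j) x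
      + pd a (\<lambda>y. \<Upsilon> y j * kronecker l i) x - pd a (\<lambda>y. g y i j * \<Upsilon>_up y l) x"
    unfolding shift_def
    by (simp only: pd_diff[OF diff_at diff_at] pd_add[OF diff_at diff_at] s assms smooth_on_add[OF open_U])
  then show ?thesis
    by (simp add: pd_mult[OF diff_at diff_at] smooth_on_const assms smooth_\<Upsilon> smooth_g smooth_\<Upsilon>_up)
qed

lemma smooth_shift: "smooth_on U (\<lambda>y. shift y l i j)"
  unfolding shift_def by (intro smooth_intros smooth_\<Upsilon> smooth_g smooth_\<Upsilon>_up)

lemma shift_trace: "x \<in> U \<Longrightarrow> (\<Sum>i\<in>UNIV. shift x i i k) = real CARD('n) * \<Upsilon> x k"
  by (simp add: shift_def sum.distrib sum_subtractf sum_distrib_left[symmetric] lower_\<Upsilon>_up')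

lemma shift_square:
  assumes "x \<in> U"
  shows "(\<Sum>i\<in>UNIV. \<Sum>m\<in>UNIV. shift x i j m * shift x m i k)
     = (real CARD('n) + 2) * \<Upsilon> x j * \<Upsilon> x k - 2 * g x j k * \<Upsilon>_square x"
proof -
  have row: "(\<Sum>m\<in>UNIV. shift x i j m * shift x m i k)
      = \<Upsilon> x j * shift x i i k
        + kronecker i j * (\<Sum>m\<in>UNIV. shift x m i k * \<Upsilon> x m)
        - \<Upsilon>_up x i * (\<Sum>m\<in>UNIV. shift x m i k * g x j m)" for i
  proof -
    have "shift x i j m * shift x m i k = \<Upsilon> x j * (kronecker i m * shift x m i k)
        + kronecker i j * (shift x m i k * \<Upsilon> x m) - \<Upsilon>_up x i * (shift x m i k * g x j m)" for m
      by (simp add: shift_def[of x i j m] algebra_simps)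
    then show ?thesis by (simp add: sum.distrib sum_subtractf sum_distrib_left[symmetric])
  qed
  have lower: "(\<Sum>m\<in>UNIV. shift x m i k * g x j m) = \<Upsilon> x i * g x j k + \<Upsilon> x k * g x j i - g x i k * \<Upsilon> x j" for i
    using lower_\<Upsilon>_up[OF assms, of j] unfolding shift_contract[of x i k "\<lambda>m. g x j m"]
    by (simp add: mult.commute[of "\<Upsilon>_up x _"])
  have "(\<Sum>i\<in>UNIV. \<Sum>m\<in>UNIV. shift x i j m * shift x m i k)
      = (\<Sum>i\<in>UNIV. \<Upsilon> x j * shift x i i k + kronecker i j * (2 * \<Upsilon> x i * \<Upsilon> x k - g x i k * \<Upsilon>_square x)
        - (g x j k * (\<Upsilon> x i * \<Upsilon>_up x i) + \<Upsilon> x k * (g x j i * \<Upsilon>_up x i) - \<Upsilon> x j * (g x i k * \<Upsilon>_up x i)))"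
    by (simp only: row shift_\<Upsilon> lower) (simp add: algebra_simps)
  also have "\<dots> = \<Upsilon> x j * (real CARD('n) * \<Upsilon> x k) + (2 * \<Upsilon> x j * \<Upsilon> x k - g x j k * \<Upsilon>_square x)
        - (g x j k * \<Upsilon>_square x + \<Upsilon> x k * \<Upsilon> x j - \<Upsilon> x j * \<Upsilon> x k)"
    by (simp only: sum.distrib sum_subtractf sum_distrib_left[symmetric] shift_trace[OF assms]
        kronecker_sums lower_\<Upsilon>_up[OF assms] lower_\<Upsilon>_up'[OF assms] \<Upsilon>_square_def[symmetric])
  finally show ?thesis by (simp add: algebra_simps)
qed

text \<open>The Christoffel symbols change by the tensor \<^const>\<open>shift\<close>, so the curvature changes by the
  derivative of \<^const>\<open>shift\<close>, by mixed terms and by its square.  Metric compatibility combines the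
  derivative with the mixed terms to a covariant derivative of \<open>\<Upsilon>\<close>.  Only the multiple of
  \<open>g\<close> is left unspecified, since it does not affect trace-free parts.\<close>

lemma ricci_conf:
  assumes "x \<in> U"
  obtains s where "\<And>k j. (\<Sum>i\<in>UNIV. riemann g' x i k i j) = (\<Sum>i\<in>UNIV. riemann g x i k i j)
     + (2 - real CARD('n)) * (cov_deriv1 g \<Upsilon> x k j - \<Upsilon> x k * \<Upsilon> x j) + s * g x k j"
proof -
  let ?n = "real CARD('n)" and ?C = "christoffel g x"
  define \<gamma> where "\<gamma> m = (\<Sum>i\<in>UNIV. ?C i i m)" for m
  \<comment> \<open>all terms that carry a factor \<open>g\<^sub>j\<^sub>k\<close>, read off from the sums below\<close>
  define s where "s = - (\<Sum>i\<in>UNIV. pd i (\<lambda>y. \<Upsilon>_up y i) x) - (\<Sum>m\<in>UNIV. \<Upsilon>_up x m * \<gamma> m)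
      - (?n - 2) * \<Upsilon>_square x"
  show thesis
  proof
    fix k j
    have pd_conf: "pd a (\<lambda>y. christoffel g' y l i m) x
        = pd a (\<lambda>y. christoffel g y l i m) x + pd a (\<lambda>y. shift y l i m) x" for a l i m
    proof -
      have "pd a (\<lambda>y. christoffel g' y l i m) x = pd a (\<lambda>y. christoffel g y l i m + shift y l i m) x"
        by (rule cong_pd[OF assms]) (rule christoffel_conf)
      then show ?thesis by (simp add: pd_add[OF diff_at diff_at] assms smooth_christoffel smooth_shift)
    qed
    have "riemann g' x i k i j = riemann g x i k i j
        + pd i (\<lambda>y. shift y i j k) x - pd j (\<lambda>y. shift y i i k) x
        + (\<Sum>m\<in>UNIV. ?C i i m * shift x m j k) + (\<Sum>m\<in>UNIV. shift x i i m * (?C m j k + shift x m j k))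
        - (\<Sum>m\<in>UNIV. ?C i j m * shift x m i k) - (\<Sum>m\<in>UNIV. shift x i j m * ?C m i k)
        - (\<Sum>m\<in>UNIV. shift x i j m * shift x m i k)" for i
      by (simp add: riemann_def pd_conf christoffel_conf[OF assms] ring_distribs sum.distrib sum_subtractf)
    then have split: "(\<Sum>i\<in>UNIV. riemann g' x i k i j) = (\<Sum>i\<in>UNIV. riemann g x i k i j)
        + (\<Sum>i\<in>UNIV. pd i (\<lambda>y. shift y i j k) x) - (\<Sum>i\<in>UNIV. pd j (\<lambda>y. shift y i i k) x)
        + (\<Sum>i\<in>UNIV. \<Sum>m\<in>UNIV. ?C i i m * shift x m j k)
        + (\<Sum>i\<in>UNIV. \<Sum>m\<in>UNIV. shift x i i m * (?C m j k + shift x m j k))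
        - (\<Sum>i\<in>UNIV. \<Sum>m\<in>UNIV. ?C i j m * shift x m i k)
        - (\<Sum>i\<in>UNIV. \<Sum>m\<in>UNIV. shift x i j m * ?C m i k)
        - (\<Sum>i\<in>UNIV. \<Sum>m\<in>UNIV. shift x i j m * shift x m i k)"
      by (simp only: sum.distrib sum_subtractf)
    have 1: "(\<Sum>i\<in>UNIV. pd i (\<lambda>y. shift y i j k) x) = pd k (\<lambda>y. \<Upsilon> y j) x + pd j (\<lambda>y. \<Upsilon> y k) x
        - (g x j k * (\<Sum>i\<in>UNIV. pd i (\<lambda>y. \<Upsilon>_up y i) x) + (\<Sum>i\<in>UNIV. pd i (\<lambda>y. g y j k) x * \<Upsilon>_up x i))"
      by (simp add: pd_shift[OF assms] sum.distrib sum_subtractf sum_distrib_left[symmetric])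
    have 2: "(\<Sum>i\<in>UNIV. pd j (\<lambda>y. shift y i i k) x) = ?n * pd j (\<lambda>y. \<Upsilon> y k) x"
    proof -
      have "(\<Sum>i\<in>UNIV. pd j (\<lambda>y. shift y i i k) x) = pd j (\<lambda>y. \<Sum>i\<in>UNIV. shift y i i k) x"
        by (rule pd_sum[symmetric]) (auto intro: diff_at smooth_shift assms)
      also have "\<dots> = pd j (\<lambda>y. ?n * \<Upsilon> y k) x"
        by (rule cong_pd[OF assms]) (rule shift_trace)
      finally show ?thesis by (simp add: pd_cmult diff_at smooth_\<Upsilon> assms)
    qed
    have 3: "(\<Sum>i\<in>UNIV. \<Sum>m\<in>UNIV. ?C i i m * shift x m j k)
        = \<Upsilon> x j * \<gamma> k + \<Upsilon> x k * \<gamma> j - g x j k * (\<Sum>m\<in>UNIV. \<Upsilon>_up x m * \<gamma> m)"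
    proof -
      have "(\<Sum>i\<in>UNIV. \<Sum>m\<in>UNIV. ?C i i m * shift x m j k) = (\<Sum>m\<in>UNIV. shift x m j k * \<gamma> m)"
        by (subst sum.swap) (simp add: \<gamma>_def sum_distrib_left mult.commute)
      then show ?thesis by (simp add: shift_contract)
    qed
    have 4: "(\<Sum>i\<in>UNIV. \<Sum>m\<in>UNIV. shift x i i m * (?C m j k + shift x m j k))
        = ?n * ((\<Sum>m\<in>UNIV. \<Upsilon> x m * ?C m j k) + (2 * \<Upsilon> x j * \<Upsilon> x k - g x j k * \<Upsilon>_square x))"
    proof -
      have "(\<Sum>i\<in>UNIV. \<Sum>m\<in>UNIV. shift x i i m * (?C m j k + shift x m j k))
          = (\<Sum>m\<in>UNIV. ?n * \<Upsilon> x m * (?C m j k + shift x m j k))"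
        by (subst sum.swap) (simp add: sum_distrib_right[symmetric] shift_trace[OF assms])
      also have "\<dots> = ?n * ((\<Sum>m\<in>UNIV. \<Upsilon> x m * ?C m j k) + (\<Sum>m\<in>UNIV. shift x m j k * \<Upsilon> x m))"
        by (simp add: sum_distrib_left sum.distrib[symmetric] algebra_simps)
      finally show ?thesis by (simp only: shift_\<Upsilon>)
    qed
    have 5: "(\<Sum>i\<in>UNIV. \<Sum>m\<in>UNIV. ?C i j m * shift x m i k)
        = (\<Sum>m\<in>UNIV. \<Upsilon> x m * ?C m j k) + \<Upsilon> x k * \<gamma> j
          - (\<Sum>m\<in>UNIV. (\<Sum>i\<in>UNIV. ?C i j m * g x i k) * \<Upsilon>_up x m)"
    proof -
      have "(\<Sum>m\<in>UNIV. ?C i j m * shift x m i k)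
          = \<Upsilon> x i * ?C i j k + \<Upsilon> x k * ?C i j i - (\<Sum>m\<in>UNIV. ?C i j m * g x i k * \<Upsilon>_up x m)" for i
        using shift_contract[of x i k "\<lambda>m. ?C i j m"]
        by (simp add: mult.commute mult.left_commute sum_distrib_left)
      moreover have "(\<Sum>i\<in>UNIV. \<Upsilon> x k * ?C i j i) = \<Upsilon> x k * \<gamma> j"
        by (simp add: \<gamma>_def sum_distrib_left christoffel_commute[OF assms, of _ j])
      moreover have "(\<Sum>i\<in>UNIV. \<Sum>m\<in>UNIV. ?C i j m * g x i k * \<Upsilon>_up x m)
          = (\<Sum>m\<in>UNIV. (\<Sum>i\<in>UNIV. ?C i j m * g x i k) * \<Upsilon>_up x m)"
        by (subst sum.swap) (simp add: sum_distrib_right)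
      ultimately show ?thesis by (simp add: sum.distrib sum_subtractf)
    qed
    have 6: "(\<Sum>i\<in>UNIV. \<Sum>m\<in>UNIV. shift x i j m * ?C m i k)
        = \<Upsilon> x j * \<gamma> k + (\<Sum>m\<in>UNIV. \<Upsilon> x m * ?C m j k)
          - (\<Sum>m\<in>UNIV. (\<Sum>i\<in>UNIV. ?C i k m * g x j i) * \<Upsilon>_up x m)"
    proof -
      have "(\<Sum>i\<in>UNIV. \<Sum>m\<in>UNIV. shift x i j m * ?C m i k)
          = (\<Sum>m\<in>UNIV. \<Sum>i\<in>UNIV. shift x i j m * ?C m i k)" by (rule sum.swap)
      also have "\<dots> = (\<Sum>m\<in>UNIV. \<Upsilon> x j * ?C m m k + \<Upsilon> x m * ?C m j k
          - (\<Sum>i\<in>UNIV. ?C m k i * g x j m * \<Upsilon>_up x i))"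
        by (simp only: shift_contract) (simp add: sum_distrib_left christoffel_commute[OF assms, of _ k] mult_ac)
      also have "(\<Sum>m\<in>UNIV. \<Upsilon> x j * ?C m m k + \<Upsilon> x m * ?C m j k
          - (\<Sum>i\<in>UNIV. ?C m k i * g x j m * \<Upsilon>_up x i))
          = \<Upsilon> x j * \<gamma> k + (\<Sum>m\<in>UNIV. \<Upsilon> x m * ?C m j k)
            - (\<Sum>m\<in>UNIV. \<Sum>i\<in>UNIV. ?C m k i * g x j m * \<Upsilon>_up x i)"
        by (simp add: sum.distrib sum_subtractf \<gamma>_def sum_distrib_left)
      also have "(\<Sum>m\<in>UNIV. \<Sum>i\<in>UNIV. ?C m k i * g x j m * \<Upsilon>_up x i)
          = (\<Sum>m\<in>UNIV. (\<Sum>i\<in>UNIV. ?C i k m * g x j i) * \<Upsilon>_up x m)"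
        by (subst sum.swap) (simp add: sum_distrib_right)
      finally show ?thesis .
    qed
    have 7: "(\<Sum>i\<in>UNIV. pd i (\<lambda>y. g y j k) x * \<Upsilon>_up x i)
        = (\<Sum>m\<in>UNIV. (\<Sum>i\<in>UNIV. ?C i j m * g x i k) * \<Upsilon>_up x m)
          + (\<Sum>m\<in>UNIV. (\<Sum>i\<in>UNIV. ?C i k m * g x j i) * \<Upsilon>_up x m)"
      by (simp add: pd_metric[OF assms] ring_distribs sum.distrib)
    have 8: "cov_deriv1 g \<Upsilon> x k j = pd j (\<lambda>y. \<Upsilon> y k) x - (\<Sum>m\<in>UNIV. \<Upsilon> x m * ?C m j k)"
      by (simp add: cov_deriv1_def christoffel_commute[OF assms, of _ j] mult.commute)
    show "(\<Sum>i\<in>UNIV. riemann g' x i k i j) = (\<Sum>i\<in>UNIV. riemann g x i k i j)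
       + (2 - ?n) * (cov_deriv1 g \<Upsilon> x k j - \<Upsilon> x k * \<Upsilon> x j) + s * g x k j"
      unfolding split 1 2 3 4 5 6 7 8 shift_square[OF assms] s_def g_commute[OF assms, of k]
        pd_\<Upsilon>_commute[OF assms, of k] by (simp add: algebra_simps)
  qed
qed

end

subsection \<open>Constant curvature and conformal factors\<close>

lemma (in metric_patch) ricci_constant_curvature:
  assumes "x \<in> U"
    and curv: "\<And>l k i j. (\<Sum>m\<in>UNIV. g x l m * riemann g x m k i j)
      = \<kappa> * (g x l i * g x k j - g x l j * g x k i)"
  shows "(\<Sum>i\<in>UNIV. riemann g x i k i j) = \<kappa> * (real CARD('n) - 1) * g x k j"
proof -
  have rie: "riemann g x l k i j = \<kappa> * (kronecker l i * g x k j - kronecker l j * g x k i)" for l i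
  proof -
    have "riemann g x l k i j
        = (\<Sum>a\<in>UNIV. inv_metric g x l a * (\<Sum>m\<in>UNIV. g x a m * riemann g x m k i j))"
      by (rule raise_lower(2)[OF assms(1), symmetric])
    also have "\<dots> = (\<Sum>a\<in>UNIV. \<kappa> * g x k j * (inv_metric g x l a * g x a i)
        - \<kappa> * g x k i * (inv_metric g x l a * g x a j))"
      by (simp only: curv) (simp add: algebra_simps)
    also have "\<dots> = \<kappa> * g x k j * kronecker l i - \<kappa> * g x k i * kronecker l j"
      by (simp only: sum_subtractf sum_distrib_left[symmetric] inverse_metric_mult[OF assms(1)])
    finally show ?thesis by (simp add: algebra_simps)
  qed
  have "(\<Sum>i\<in>UNIV. riemann g x i k i j)
      = (\<Sum>i\<in>UNIV. \<kappa> * g x k j * kronecker i i - \<kappa> * (kronecker i j * g x k i))"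
    by (simp only: rie) (simp add: algebra_simps)
  also have "\<dots> = \<kappa> * g x k j * real CARD('n) - \<kappa> * g x k j"
    by (simp only: sum_subtractf sum_distrib_left[symmetric] kronecker_trace kronecker_sums)
  finally show ?thesis by (simp add: algebra_simps)
qed

context conformal_patch
begin

text \<open>Both Ricci tensors are multiples of the metric, hence so is their difference, and in dimension
  \<open>n \<ge> 3\<close> the factor \<open>2 - n\<close> can be divided out.  Equivalently, the Hessian of \<open>1/w\<close> is a
  multiple of \<open>g\<close>: it equals \<open>- (\<nabla>\<Upsilon> - \<Upsilon> \<otimes> \<Upsilon>) / w\<close>.\<close>

lemma schouten_pure_trace:
  assumes "CARD('n) \<ge> 3" and "x \<in> U"
    and curv: "\<And>l k i j. (\<Sum>m\<in>UNIV. g x l m * riemann g x m k i j)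
      = \<kappa> * (g x l i * g x k j - g x l j * g x k i)"
    and curv': "\<And>l k i j. (\<Sum>m\<in>UNIV. g' x l m * riemann g' x m k i j)
      = \<kappa>' * (g' x l i * g' x k j - g' x l j * g' x k i)"
  obtains e where "\<And>k j. cov_deriv1 g \<Upsilon> x k j = \<Upsilon> x k * \<Upsilon> x j + e * g x k j"
proof -
  let ?n = "real CARD('n)"
  obtain s where s: "\<And>k j. (\<Sum>i\<in>UNIV. riemann g' x i k i j) = (\<Sum>i\<in>UNIV. riemann g x i k i j)
     + (2 - ?n) * (cov_deriv1 g \<Upsilon> x k j - \<Upsilon> x k * \<Upsilon> x j) + s * g x k j"
    using ricci_conf[OF assms(2)] by blast
  define e where "e = (s + \<kappa> * (?n - 1) - \<kappa>' * (?n - 1) * (w x)\<^sup>2) / (?n - 2)"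
  have n: "?n - 2 > 0" using assms(1) by linarith
  have e: "(?n - 2) * e = s + \<kappa> * (?n - 1) - \<kappa>' * (?n - 1) * (w x)\<^sup>2"
    using n by (simp add: e_def)
  have "cov_deriv1 g \<Upsilon> x k j = \<Upsilon> x k * \<Upsilon> x j + e * g x k j" for k j
  proof -
    have "(?n - 2) * (cov_deriv1 g \<Upsilon> x k j - \<Upsilon> x k * \<Upsilon> x j)
        = ((?n - 2) * e) * g x k j"
      unfolding e using s[of k j] ricci_constant_curvature[OF assms(2) curv, of k j]
        conf.ricci_constant_curvature[OF assms(2) curv', of k j]
      by (simp add: g'_eq[OF assms(2)] algebra_simps)
    then have "cov_deriv1 g \<Upsilon> x k j - \<Upsilon> x k * \<Upsilon> x j = e * g x k j"
      using n by (simp only: mult.assoc mult_cancel_left) simp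
    then show ?thesis by simp
  qed
  then show thesis using that by blast
qed

lemma trace_free3_conf:
  assumes "x \<in> U" shows "trace_free3 g' t x i j k = trace_free3 g t x i j k"
  using w_nonzero[OF assms] by (simp add: trace_free3_def Let_def inv_g'[OF assms] g'_eq[OF assms]
      sum_divide_distrib[symmetric] divide_simps)

text \<open>For a power \<open>w\<^sup>m f\<close> the coefficient of \<open>\<Upsilon>\<^sub>i f\<^sub>j + \<Upsilon>\<^sub>j f\<^sub>i\<close> is \<open>m - 1\<close>; the weight \<open>m = 2\<close> is
  the one for which the products of \<open>\<Upsilon>\<close> with second derivatives of \<open>f\<close> cancel in the third
  derivative of \<open>w\<^sup>m f\<close>, modulo \<open>g\<close>.
  The hypothesis replaces second derivatives of \<open>w\<close> by \<open>\<Upsilon> \<otimes> \<Upsilon>\<close> and a trace term.\<close>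

lemma hessian_conf_weighted:
  assumes f: "smooth_on U f"
    and E: "\<And>x k j. x \<in> U \<Longrightarrow> cov_deriv1 g \<Upsilon> x k j = \<Upsilon> x k * \<Upsilon> x j + e x * g x k j"
    and x: "x \<in> U"
  shows "hessian g' (\<lambda>y. (w y)\<^sup>2 * f y) x i j
     = (w x)\<^sup>2 * (hessian g f x i j + \<Upsilon> x i * grad f x j + \<Upsilon> x j * grad f x i
         + 2 * f x * \<Upsilon> x i * \<Upsilon> x j
         + g x i j * (2 * f x * (e x + \<Upsilon>_square x) + (\<Sum>l\<in>UNIV. \<Upsilon>_up x l * grad f x l)))"
proof -
  let ?F = "\<lambda>y. (w y)\<^sup>2 * f y"
  have d1: "pd a ?F y = (w y)\<^sup>2 * (grad f y a + 2 * f y * \<Upsilon> y a)" if "y \<in> U" for y a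
    using that f smooth_on_power[OF open_U smooth_w, of 2]
    by (simp add: pd_mult[OF diff_at diff_at] pd_power2[OF diff_at] smooth_w pd_w grad_def
        power2_eq_square algebra_simps)
  have smooth_grad: "smooth_on U (\<lambda>y. grad f y a)" for a
    unfolding grad_def by (intro smooth_intros f)
  have smooth_in: "smooth_on U (\<lambda>y. grad f y a + 2 * f y * \<Upsilon> y a)" for a
    by (intro smooth_intros f smooth_\<Upsilon> smooth_grad)
  have d2: "pd j (pd i ?F) x = (w x)\<^sup>2 * (pd j (\<lambda>y. grad f y i) x + 2 * f x * pd j (\<lambda>y. \<Upsilon> y i) x
      + 2 * grad f x j * \<Upsilon> x i + 2 * \<Upsilon> x j * (grad f x i + 2 * f x * \<Upsilon> x i))"
  proof -
    have "pd j (pd i ?F) x = pd j (\<lambda>y. (w y)\<^sup>2 * (grad f y i + 2 * f y * \<Upsilon> y i)) x"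
      by (rule cong_pd[OF x]) (rule d1)
    also have "\<dots> = (w x)\<^sup>2 * pd j (\<lambda>y. grad f y i + 2 * f y * \<Upsilon> y i) x
        + 2 * w x * pd j w x * (grad f x i + 2 * f x * \<Upsilon> x i)"
      using x smooth_in smooth_on_power[OF open_U smooth_w, of 2] smooth_w
      by (simp add: pd_mult[OF diff_at diff_at] pd_power2[OF diff_at])
    also have "pd j (\<lambda>y. grad f y i + 2 * f y * \<Upsilon> y i) x
        = pd j (\<lambda>y. grad f y i) x + (2 * f x * pd j (\<lambda>y. \<Upsilon> y i) x + 2 * pd j f x * \<Upsilon> x i)"
      using x f smooth_grad smooth_\<Upsilon> smooth_on_mult[OF open_U smooth_on_const f, of 2]
        smooth_on_mult[OF open_U smooth_on_mult[OF open_U smooth_on_const f, of 2] smooth_\<Upsilon>[of i]]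
      by (simp add: pd_add[OF diff_at diff_at] pd_mult[OF diff_at diff_at] pd_cmult[OF diff_at])
    finally show ?thesis
      by (simp add: pd_w[OF x] power2_eq_square grad_def algebra_simps)
  qed
  have "(\<Sum>k\<in>UNIV. christoffel g x k i j * pd k ?F x)
      = (w x)\<^sup>2 * (\<Sum>k\<in>UNIV. christoffel g x k i j * grad f x k)
        + (w x)\<^sup>2 * (2 * f x * (\<Sum>k\<in>UNIV. christoffel g x k i j * \<Upsilon> x k))"
    by (simp only: d1[OF x]) (simp add: sum_distrib_left sum.distrib algebra_simps)
  then have h: "hessian g ?F x i j = (w x)\<^sup>2 * (hessian g f x i j + 2 * f x * cov_deriv1 g \<Upsilon> x i j
      + 2 * grad f x j * \<Upsilon> x i + 2 * \<Upsilon> x j * (grad f x i + 2 * f x * \<Upsilon> x i))"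
    unfolding hessian_def cov_deriv1_def grad_def[of ?F] d2 by (simp add: algebra_simps)
  have "(\<Sum>l\<in>UNIV. \<Upsilon>_up x l * pd l ?F x)
      = (w x)\<^sup>2 * (\<Sum>l\<in>UNIV. \<Upsilon>_up x l * grad f x l) + (w x)\<^sup>2 * (2 * f x * \<Upsilon>_square x)"
    by (simp only: d1[OF x]) (simp add: \<Upsilon>_square_def sum_distrib_left sum.distrib algebra_simps)
  then show ?thesis unfolding hessian_conf[OF x] h E[OF x] d1[OF x] by (simp add: algebra_simps)
qed

end

text \<open>The projection to the trace-free part annihilates the symmetrised products \<open>g\<^sub>(\<^sub>i\<^sub>j z\<^sub>k\<^sub>)\<close>; the
  coefficient \<open>1/(n+2)\<close> in its definition is chosen for this.\<close>

lemma (in metric_patch) trace_free3_pure_trace: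
  assumes "x \<in> U"
    and t: "\<And>i j k. t x i j k = a * s x i j k + g x i j * z k + g x j k * z i + g x k i * z j"
  shows "trace_free3 g t x i j k = a * trace_free3 g s x i j k"
proof -
  have "(\<Sum>i\<in>UNIV. \<Sum>j\<in>UNIV. inv_metric g x i j * t x i j l)
     = a * (\<Sum>i\<in>UNIV. \<Sum>j\<in>UNIV. inv_metric g x i j * s x i j l) + (real CARD('n) + 2) * z l" for l
  proof -
    have "inv_metric g x i j * t x i j l = a * (inv_metric g x i j * s x i j l)
        + z l * (inv_metric g x i j * g x i j)
        + z i * (inv_metric g x i j * g x j l) + z j * (inv_metric g x j i * g x i l)" for i j
      using inv_metric_commute[OF assms(1), of i j] g_commute[OF assms(1), of l i]
      by (simp add: t algebra_simps)
    then have "(\<Sum>i\<in>UNIV. \<Sum>j\<in>UNIV. inv_metric g x i j * t x i j l)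
        = a * (\<Sum>i\<in>UNIV. \<Sum>j\<in>UNIV. inv_metric g x i j * s x i j l)
          + z l * (\<Sum>i\<in>UNIV. \<Sum>j\<in>UNIV. inv_metric g x i j * g x i j)
          + (\<Sum>i\<in>UNIV. z i * (\<Sum>j\<in>UNIV. inv_metric g x i j * g x j l))
          + (\<Sum>i\<in>UNIV. \<Sum>j\<in>UNIV. z j * (inv_metric g x j i * g x i l))"
      by (simp add: sum.distrib sum_distrib_left)
    also have "(\<Sum>i\<in>UNIV. \<Sum>j\<in>UNIV. z j * (inv_metric g x j i * g x i l))
        = (\<Sum>j\<in>UNIV. z j * (\<Sum>i\<in>UNIV. inv_metric g x j i * g x i l))"
      by (subst sum.swap) (simp add: sum_distrib_left)
    finally show ?thesis
      by (simp only: inverse_metric_mult[OF assms(1)] metric_trace[OF assms(1)] kronecker_sums)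
        (simp add: algebra_simps)
  qed
  then show ?thesis
    by (simp add: trace_free3_def Let_def t add_pos_nonneg field_simps)
qed

section \<open>The trace-free symmetrised third derivative\<close>

context metric_patch
begin

lemma hessian_lincomb:
  assumes "x \<in> U" "smooth_on U f" "smooth_on U h"
  shows "hessian g (\<lambda>y. r * f y + s * h y) x i j = r * hessian g f x i j + s * hessian g h x i j"
proof -
  have 1: "pd a (\<lambda>y. r * f y + s * h y) y = r * pd a f y + s * pd a h y"
    if "y \<in> U" "smooth_on U f" "smooth_on U h" for y a and f h
    using that smooth_on_mult[OF open_U smooth_on_const]
    by (simp add: pd_add[OF diff_at diff_at] pd_cmult[OF diff_at])
  have "pd j (pd i (\<lambda>y. r * f y + s * h y)) x = pd j (\<lambda>y. r * pd i f y + s * pd i h y) x"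
    by (rule cong_pd[OF assms(1)]) (rule 1[OF _ assms(2,3)])
  also have "\<dots> = r * pd j (pd i f) x + s * pd j (pd i h) x"
    by (intro 1 assms smooth_on_pd)
  finally show ?thesis
    by (simp add: hessian_def cov_deriv1_def grad_def 1[OF assms] algebra_simps sum.distrib sum_distrib_left)
qed

lemma tf_sym_third_deriv_diff:
  assumes x: "x \<in> U" and f: "smooth_on U f" and h: "smooth_on U h"
  shows "tf_sym_third_deriv g (\<lambda>y. f y - h y) x i j k
     = tf_sym_third_deriv g f x i j k - tf_sym_third_deriv g h x i j k"
proof -
  have third: "third_deriv g (\<lambda>y. f y - h y) x i j k = third_deriv g f x i j k - third_deriv g h x i j k" for i j k
  proof -
    have "third_deriv g (\<lambda>y. f y - h y) x i j k
        = cov_deriv2 g (\<lambda>y i j. hessian g f y i j + (-1) * hessian g h y i j) x i j k"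
      unfolding third_deriv_def by (rule cov_deriv2_cong[OF x]) (use hessian_lincomb[OF _ f h, of _ 1 "-1"] in simp)
    also have "\<dots> = cov_deriv2 g (hessian g f) x i j k
        + cov_deriv2 g (\<lambda>y i j. (-1) * hessian g h y i j) x i j k"
      by (intro cov_deriv2_add x smooth_intros smooth_hessian f h)
    also have "cov_deriv2 g (\<lambda>y i j. (-1) * hessian g h y i j) x i j k
        = (-1) * cov_deriv2 g (hessian g h) x i j k + pd k (\<lambda>y. -1) x * hessian g h x i j"
      by (intro cov_deriv2_scale x smooth_intros smooth_hessian h)
    finally show ?thesis by (simp add: third_deriv_def)
  qed
  then have 3: "sym3 (third_deriv g (\<lambda>y. f y - h y)) x i j k
      = sym3 (third_deriv g f) x i j k - sym3 (third_deriv g h) x i j k" for i j k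
    by (simp add: sym3_def third diff_divide_distrib add_divide_distrib)
  show ?thesis
    by (simp add: tf_sym_third_deriv_def trace_free3_def Let_def 3 right_diff_distrib sum_subtractf
        diff_divide_distrib add_divide_distrib)
qed

lemma tf_sym_third_deriv_symmetric:
  assumes "x \<in> U"
  shows "tf_sym_third_deriv g f x i j k = tf_sym_third_deriv g f x j i k"
    and "tf_sym_third_deriv g f x i j k = tf_sym_third_deriv g f x i k j"
proof -
  have s: "sym3 t x i j k = sym3 t x j i k" "sym3 t x i j k = sym3 t x i k j" for t :: "'n comps3" and i j k
    by (simp_all add: sym3_def)
  show "tf_sym_third_deriv g f x i j k = tf_sym_third_deriv g f x j i k"
    using s(1)[of "third_deriv g f" i j k] g_commute[OF assms, of i j] g_commute[OF assms, of j k]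
      g_commute[OF assms, of k i]
    by (simp add: tf_sym_third_deriv_def trace_free3_def Let_def add_ac)
  show "tf_sym_third_deriv g f x i j k = tf_sym_third_deriv g f x i k j"
    using s(2)[of "third_deriv g f" i j k] g_commute[OF assms, of i j] g_commute[OF assms, of j k]
      g_commute[OF assms, of k i]
    by (simp add: tf_sym_third_deriv_def trace_free3_def Let_def add_ac)
qed

lemma trace_pure_trace:
  assumes "x \<in> U"
  shows "(\<Sum>i\<in>UNIV. \<Sum>j\<in>UNIV. inv_metric g x i j * (g x i j * b + a i * g x j k + a j * g x i k))
     = real CARD('n) * b + a k + a k"
proof -
  have "inv_metric g x i j * (g x i j * b + a i * g x j k + a j * g x i k)
      = inv_metric g x i j * g x i j * b + a i * (inv_metric g x i j * g x j k)
        + a j * (inv_metric g x j i * g x i k)" for i j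
    using inv_metric_commute[OF assms, of i j] by (simp add: algebra_simps)
  then have "(\<Sum>i\<in>UNIV. \<Sum>j\<in>UNIV. inv_metric g x i j * (g x i j * b + a i * g x j k + a j * g x i k))
      = (\<Sum>i\<in>UNIV. \<Sum>j\<in>UNIV. inv_metric g x i j * g x i j) * b
        + (\<Sum>i\<in>UNIV. a i * (\<Sum>j\<in>UNIV. inv_metric g x i j * g x j k))
        + (\<Sum>i\<in>UNIV. \<Sum>j\<in>UNIV. a j * (inv_metric g x j i * g x i k))"
    by (simp add: sum.distrib sum_distrib_left sum_distrib_right)
  also have "(\<Sum>i\<in>UNIV. \<Sum>j\<in>UNIV. a j * (inv_metric g x j i * g x i k))
      = (\<Sum>j\<in>UNIV. a j * (\<Sum>i\<in>UNIV. inv_metric g x j i * g x i k))"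
    by (subst sum.swap) (simp add: sum_distrib_left)
  finally show ?thesis
    by (simp only: inverse_metric_mult[OF assms] metric_trace[OF assms] kronecker_sums)
qed

lemma tf_sym_third_deriv_trace:
  assumes "x \<in> U"
  shows "(\<Sum>i\<in>UNIV. \<Sum>j\<in>UNIV. inv_metric g x i j * tf_sym_third_deriv g f x i j k) = 0"
proof -
  let ?n = "real CARD('n)" and ?s = "sym3 (third_deriv g f) x"
  define \<tau> where "\<tau> l = (\<Sum>i\<in>UNIV. \<Sum>j\<in>UNIV. inv_metric g x i j * ?s i j l)" for l
  have "tf_sym_third_deriv g f x i j k
      = ?s i j k - (g x i j * \<tau> k + \<tau> i * g x j k + \<tau> j * g x i k) / (?n + 2)" for i j
    using g_commute[OF assms, of k i]
    by (simp add: tf_sym_third_deriv_def trace_free3_def Let_def \<tau>_def mult.commute)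
  then have tr: "(\<Sum>i\<in>UNIV. \<Sum>j\<in>UNIV. inv_metric g x i j * tf_sym_third_deriv g f x i j k) = \<tau> k
      - (\<Sum>i\<in>UNIV. \<Sum>j\<in>UNIV. inv_metric g x i j * (g x i j * \<tau> k + \<tau> i * g x j k + \<tau> j * g x i k)) / (?n + 2)"
    by (simp add: right_diff_distrib sum_subtractf \<tau>_def[of k] sum_divide_distrib)
  show ?thesis unfolding tr trace_pure_trace[OF assms]
    by (simp add: field_simps add_nonneg_pos[THEN less_imp_neq, symmetric])
qed

text \<open>Structure tensors decompose uniquely into a totally symmetric trace-free part and a trace part:
  by symmetry, tracing over \<open>i, j\<close> and tracing over \<open>j, k\<close> give two linear equations for \<open>a\<close>
  and \<open>b\<close>, with determinant \<open>- (n + 2) (n - 1) \<noteq> 0\<close>.\<close>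

lemma symmetric_trace_free_eq_0:
  assumes x: "x \<in> U" and n: "CARD('n) \<ge> 2"
    and sym: "\<And>i j k. D i j k = D j i k" "\<And>i j k. D i j k = D i k j"
    and tf: "\<And>k. (\<Sum>i\<in>UNIV. \<Sum>j\<in>UNIV. inv_metric g x i j * D i j k) = 0"
    and D: "\<And>i j k. D i j k = a i * g x j k + a j * g x i k + g x i j * b k"
  shows "D i j k = 0"
proof -
  let ?n = "real CARD('n)"
  have 1: "?n * b k + 2 * a k = 0" for k
    using tf[of k] trace_pure_trace[OF x, of "b k" a k] by (simp add: D add_ac)
  \<comment> \<open>the trace over \<open>j, k\<close>, taken as a trace over \<open>i, j\<close> of the mean of two index permutations of
    \<open>D\<close>, which is symmetric in \<open>i, j\<close>\<close>
  have 2: "?n * a k + (a k + b k) = 0" for k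
  proof -
    have A: "D i j k = g x i j * a k + (a i * g x j k + b j * g x i k)" for i j
      using sym(1)[of i k j] sym(2)[of i j k] D[of k i j] g_commute[OF x, of k i] g_commute[OF x, of k j]
      by (simp add: mult.commute add_ac)
    have B: "D i j k = g x i j * a k + (b i * g x j k + a j * g x i k)" for i j
      using sym(1)[of i j k] sym(2)[of j i k] sym(1)[of j k i] D[of k j i]
        g_commute[OF x, of k i] g_commute[OF x, of k j] g_commute[OF x, of j i]
      by (simp add: mult.commute add_ac)
    have "2 * D i j k = g x i j * (2 * a k) + (a i + b i) * g x j k + (a j + b j) * g x i k" for i j
      using A[of i j] B[of i j] by (simp add: distrib_left distrib_right)
    then have "(\<Sum>i\<in>UNIV. \<Sum>j\<in>UNIV. inv_metric g x i j * (2 * D i j k)) = ?n * (2 * a k) + 2 * (a k + b k)"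
      by (simp only: trace_pure_trace[OF x]) simp
    moreover have "(\<Sum>i\<in>UNIV. \<Sum>j\<in>UNIV. inv_metric g x i j * (2 * D i j k)) = 0"
      using tf[of k] by (simp add: mult.left_commute[of _ 2] sum_distrib_left[symmetric])
    ultimately show ?thesis by simp
  qed
  have a0: "a k = 0" for k
  proof -
    have b: "b k = - ((?n + 1) * a k)" using 2[of k] by (simp add: algebra_simps)
    have "(?n * (?n + 1) - 2) * a k = 0" using 1[of k] unfolding b by (simp add: algebra_simps)
    moreover have "?n * (?n + 1) - 2 > 0"
    proof -
      have "2 \<le> ?n" using n by simp
      then have "2 * 3 \<le> ?n * (?n + 1)" by (intro mult_mono) auto
      then show ?thesis by simp
    qed
    ultimately show ?thesis by simp
  qed
  have "b k = 0" for k using 2[of k] a0 by simp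
  then show ?thesis by (simp add: D a0)
qed

end

context conformal_patch
begin

text \<open>All terms with a derivative of \<open>w\<close> cancel modulo \<open>g\<close>: those with a second derivative of \<open>f\<close>
  because of the weight, the others by the hypothesis on \<open>\<nabla>\<Upsilon>\<close>.\<close>

lemma third_deriv_conf:
  assumes f: "smooth_on U f"
    and E: "\<And>x k j. x \<in> U \<Longrightarrow> cov_deriv1 g \<Upsilon> x k j = \<Upsilon> x k * \<Upsilon> x j + e x * g x k j"
    and e: "smooth_on U e" and x: "x \<in> U"
  obtains r s where "\<And>i j k. third_deriv g' (\<lambda>y. (w y)\<^sup>2 * f y) x i j k
     = (w x)\<^sup>2 * (third_deriv g f x i j k + g x i k * r j + g x j k * r i + g x i j * s k)"
proof -
  let ?F = "\<lambda>y. (w y)\<^sup>2 * f y"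
  define s where "s y = 2 * f y * (e y + \<Upsilon>_square y) + (\<Sum>l\<in>UNIV. \<Upsilon>_up y l * grad f y l)" for y
  have smooth_grad: "smooth_on U (\<lambda>y. grad f y a)" for a
    unfolding grad_def by (intro smooth_intros f)
  have smooth_s: "smooth_on U s"
    unfolding s_def[abs_def] \<Upsilon>_square_def
    by (intro smooth_intros f e smooth_\<Upsilon>_up smooth_\<Upsilon> smooth_grad) auto
  \<comment> \<open>\<open>w\<^sup>2 I\<close> is the Hessian of \<open>w\<^sup>2 f\<close> for \<open>g'\<close>, with summands to which the product rules apply\<close>
  define I1 I2 I3 I4 where "I1 y i j = \<Upsilon> y i * grad f y j" and "I2 y i j = grad f y i * \<Upsilon> y j"
    and "I3 y i j = (2 * f y * \<Upsilon> y i) * \<Upsilon> y j" and "I4 y i j = s y * g y i j" for y i j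
  define I where "I y i j = (((hessian g f y i j + I1 y i j) + I2 y i j) + I3 y i j) + I4 y i j" for y i j
  have smooth: "smooth_on U (\<lambda>y. hessian g f y i j)" "smooth_on U (\<lambda>y. I1 y i j)"
    "smooth_on U (\<lambda>y. I2 y i j)" "smooth_on U (\<lambda>y. I3 y i j)" "smooth_on U (\<lambda>y. I4 y i j)"
    "smooth_on U (\<lambda>y. I y i j)" for i j
    unfolding I_def I1_def I2_def I3_def I4_def
    by (intro smooth_intros smooth_hessian f smooth_\<Upsilon> smooth_grad smooth_s smooth_g)+
  have I_commute: "I x i j = I x j i" for i j
    using hessian_commute[OF x f, of i j] g_commute[OF x, of i j]
    by (simp add: I_def I1_def I2_def I3_def I4_def mult_ac)
  have hess: "hessian g' ?F y i j = (w y)\<^sup>2 * I y i j" if "y \<in> U" for y i j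
    using hessian_conf_weighted[OF f E that, of i j] unfolding I_def I1_def I2_def I3_def I4_def s_def
    by (simp add: mult.commute[of _ "g y i j"])
  have d1: "cov_deriv2 g I1 x i j k = \<Upsilon> x i * hessian g f x j k + cov_deriv1 g \<Upsilon> x i k * grad f x j" for i j k
    unfolding I1_def hessian_def by (rule cov_deriv2_tensor[OF x smooth_\<Upsilon> smooth_grad])
  have d2: "cov_deriv2 g I2 x i j k = grad f x i * cov_deriv1 g \<Upsilon> x j k + hessian g f x i k * \<Upsilon> x j" for i j k
    unfolding I2_def hessian_def by (rule cov_deriv2_tensor[OF x smooth_grad smooth_\<Upsilon>])
  have d3: "cov_deriv2 g I3 x i j k = 2 * f x * \<Upsilon> x i * cov_deriv1 g \<Upsilon> x j k
      + (2 * f x * cov_deriv1 g \<Upsilon> x i k + 2 * grad f x k * \<Upsilon> x i) * \<Upsilon> x j" for i j k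
  proof -
    have "cov_deriv2 g I3 x i j k = 2 * f x * \<Upsilon> x i * cov_deriv1 g \<Upsilon> x j k
        + cov_deriv1 g (\<lambda>y i. 2 * f y * \<Upsilon> y i) x i k * \<Upsilon> x j"
      unfolding I3_def by (rule cov_deriv2_tensor[OF x]) (intro smooth_intros f smooth_\<Upsilon>)+
    moreover have "pd k (\<lambda>y. 2 * f y * \<Upsilon> y i) x = 2 * f x * pd k (\<lambda>y. \<Upsilon> y i) x + 2 * grad f x k * \<Upsilon> x i"
      using x f smooth_\<Upsilon> smooth_on_mult[OF open_U smooth_on_const f, of 2]
      by (simp add: pd_mult[OF diff_at diff_at] pd_cmult[OF diff_at] grad_def)
    ultimately show ?thesis by (simp add: cov_deriv1_def sum_distrib_left algebra_simps)
  qed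
  have d4: "cov_deriv2 g I4 x i j k = pd k s x * g x i j" for i j k
    unfolding I4_def by (simp add: cov_deriv2_scale[OF x smooth_s smooth_g] cov_deriv2_metric[OF x])
  have dI: "cov_deriv2 g I x i j k = third_deriv g f x i j k + cov_deriv2 g I1 x i j k
      + cov_deriv2 g I2 x i j k + cov_deriv2 g I3 x i j k + cov_deriv2 g I4 x i j k" for i j k
    unfolding I_def third_deriv_def
    by (subst cov_deriv2_add[OF x], (intro smooth_intros smooth)+)+ simp
  define q where "q j = (\<Sum>l\<in>UNIV. \<Upsilon>_up x l * I x l j)" for j
  define r where "r j = e x * grad f x j + 2 * f x * e x * \<Upsilon> x j - s x * \<Upsilon> x j + q j" for j
  have "third_deriv g' ?F x i j k
     = (w x)\<^sup>2 * (third_deriv g f x i j k + g x i k * r j + g x j k * r i + g x i j * pd k s x)" for i j k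
  proof -
    have "third_deriv g' ?F x i j k = cov_deriv2 g' (\<lambda>y i j. (w y)\<^sup>2 * I y i j) x i j k"
      unfolding third_deriv_def by (rule conf.cov_deriv2_cong[OF x]) (rule hess)
    also have "\<dots> = cov_deriv2 g (\<lambda>y i j. (w y)\<^sup>2 * I y i j) x i j k
       - (\<Upsilon> x i * ((w x)\<^sup>2 * I x k j) + \<Upsilon> x k * ((w x)\<^sup>2 * I x i j) - g x i k * ((w x)\<^sup>2 * q j))
       - (\<Upsilon> x j * ((w x)\<^sup>2 * I x i k) + \<Upsilon> x k * ((w x)\<^sup>2 * I x i j) - g x j k * ((w x)\<^sup>2 * q i))"
      unfolding cov_deriv2_conf[OF x] q_def I_commute[of _ i]
      by (simp add: sum_distrib_left mult.left_commute)
    also have "cov_deriv2 g (\<lambda>y i j. (w y)\<^sup>2 * I y i j) x i j k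
        = (w x)\<^sup>2 * (cov_deriv2 g I x i j k + 2 * \<Upsilon> x k * I x i j)"
    proof -
      have "pd k (\<lambda>y. (w y)\<^sup>2) x = 2 * (w x)\<^sup>2 * \<Upsilon> x k"
        by (simp add: pd_power2[OF diff_at] smooth_w x pd_w) (simp add: power2_eq_square)
      then show ?thesis
        by (subst cov_deriv2_scale[OF x smooth_on_power[OF open_U smooth_w, of 2] smooth(6)])
          (simp add: algebra_simps)
    qed
    finally have "third_deriv g' ?F x i j k = (w x)\<^sup>2 * (cov_deriv2 g I x i j k
        - \<Upsilon> x i * I x k j - \<Upsilon> x j * I x i k + g x i k * q j + g x j k * q i)"
      by (simp add: algebra_simps)
    also have "cov_deriv2 g I x i j k - \<Upsilon> x i * I x k j - \<Upsilon> x j * I x i k + g x i k * q j + g x j k * q i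
        = third_deriv g f x i j k + g x i k * r j + g x j k * r i + g x i j * pd k s x"
      unfolding dI d1 d2 d3 d4 E[OF x] r_def I_def I1_def I2_def I3_def I4_def
      using hessian_commute[OF x f, of j k] g_commute[OF x, of j k]
      by (simp add: algebra_simps)
    finally show ?thesis .
  qed
  then show thesis by (rule that)
qed

text \<open>The trace-free symmetrised third derivative is conformally covariant between metrics of constant
  curvature, on functions of weight \<open>2\<close>.\<close>

theorem tf_sym_third_deriv_conf:
  assumes f: "smooth_on U f" and x: "x \<in> U"
    and pure: "\<And>x. x \<in> U \<Longrightarrow> \<exists>e. \<forall>k j. cov_deriv1 g \<Upsilon> x k j = \<Upsilon> x k * \<Upsilon> x j + e * g x k j"
  shows "tf_sym_third_deriv g' (\<lambda>y. (w y)\<^sup>2 * f y) x i j k = (w x)\<^sup>2 * tf_sym_third_deriv g f x i j k"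
proof -
  \<comment> \<open>the factor of \<open>g\<close> is recovered as a trace, which shows that it is smooth\<close>
  define e where "e x = (\<Sum>k\<in>UNIV. \<Sum>j\<in>UNIV.
      inv_metric g x k j * (cov_deriv1 g \<Upsilon> x k j - \<Upsilon> x k * \<Upsilon> x j)) / real CARD('n)" for x
  have e: "smooth_on U e" unfolding e_def cov_deriv1_def
    by (intro smooth_intros smooth_inv_metric smooth_christoffel smooth_\<Upsilon>) auto
  have E: "cov_deriv1 g \<Upsilon> y k j = \<Upsilon> y k * \<Upsilon> y j + e y * g y k j" if y: "y \<in> U" for y k j
  proof -
    obtain e' where e': "\<forall>k j. cov_deriv1 g \<Upsilon> y k j = \<Upsilon> y k * \<Upsilon> y j + e' * g y k j"
      using pure[OF y] by blast
    have "e y = (\<Sum>k\<in>UNIV. \<Sum>j\<in>UNIV. e' * (inv_metric g y k j * g y k j)) / real CARD('n)"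
      by (simp add: e_def e' mult_ac)
    also have "\<dots> = e'"
      by (simp only: sum_distrib_left[symmetric] metric_trace[OF y]) simp
    finally show ?thesis using e' by simp
  qed
  obtain r s where T: "\<And>i j k. third_deriv g' (\<lambda>y. (w y)\<^sup>2 * f y) x i j k
     = (w x)\<^sup>2 * (third_deriv g f x i j k + g x i k * r j + g x j k * r i + g x i j * s k)"
    using third_deriv_conf[OF f E e x] by blast
  \<comment> \<open>each of the three trace terms contributes a third of its one-form to the symmetrisation\<close>
  define z where "z k = (w x)\<^sup>2 * (2 * r k + s k) / 3" for k
  have "sym3 (third_deriv g' (\<lambda>y. (w y)\<^sup>2 * f y)) x i j k = (w x)\<^sup>2 * sym3 (third_deriv g f) x i j k
      + g x i j * z k + g x j k * z i + g x k i * z j" for i j k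
    using g_commute[OF x, of j i] g_commute[OF x, of k j] g_commute[OF x, of k i]
    unfolding sym3_def T z_def by (simp add: field_simps)
  then have "trace_free3 g (sym3 (third_deriv g' (\<lambda>y. (w y)\<^sup>2 * f y))) x i j k
      = (w x)\<^sup>2 * trace_free3 g (sym3 (third_deriv g f)) x i j k"
    by (rule trace_free3_pure_trace[OF x])
  then show ?thesis by (simp add: tf_sym_third_deriv_def trace_free3_conf[OF x])
qed

end

section \<open>Integrals, Killing tensors and compatible potentials\<close>

definition quad_form :: "('n::finite \<Rightarrow> 'n \<Rightarrow> real) \<Rightarrow> real^'n \<Rightarrow> real" where
  "quad_form A p = (\<Sum>a\<in>UNIV. \<Sum>b\<in>UNIV. A a b * p $ a * p $ b)"

definition lin_map :: "('n::finite \<Rightarrow> 'n \<Rightarrow> real) \<Rightarrow> real^'n \<Rightarrow> 'n \<Rightarrow> real" where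
  "lin_map A p i = (\<Sum>b\<in>UNIV. A i b * p $ b)"

text \<open>The Poisson bracket of \<open>K\<^sup>i\<^sup>j p\<^sub>i p\<^sub>j\<close> and \<open>G\<^sup>i\<^sup>j p\<^sub>i p\<^sub>j\<close>, for symmetric \<open>K\<close>
  and \<open>G\<close>; it vanishes if and only if \<open>K\<close> is a Killing tensor of the metric with inverse \<open>G\<close>.\<close>

definition killing_bracket :: "'n::finite comps2 \<Rightarrow> 'n comps2 \<Rightarrow> real^'n \<Rightarrow> real^'n \<Rightarrow> real" where
  "killing_bracket K G x p = (\<Sum>i\<in>UNIV.
      quad_form (\<lambda>a b. pd i (\<lambda>y. K y a b) x) p * (2 * lin_map (G x) p i)
      - 2 * lin_map (K x) p i * quad_form (\<lambda>a b. pd i (\<lambda>y. G y a b) x) p)"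

lemma pd_component: "pd i (\<lambda>q. q $ a) p = kronecker a i"
  using pd_has_derivative[OF bounded_linear_imp_has_derivative[OF bounded_linear_vec_nth], of i a p]
  by (simp add: axis_def kronecker_def)

lemma differentiable_component: "(\<lambda>q. q $ a) differentiable at p"
  using bounded_linear_imp_differentiable[OF bounded_linear_vec_nth] .

lemma dmom_quad_fun:
  assumes "\<And>i j. K x i j = K x j i"
  shows "dmom i (quad_fun K W) x p = 2 * lin_map (K x) p i"
proof -
  note d = differentiable_component
  have "pd i (\<lambda>q. (\<Sum>a\<in>UNIV. \<Sum>b\<in>UNIV. K x a b * q $ a * q $ b) + W x) p
      = (\<Sum>a\<in>UNIV. \<Sum>b\<in>UNIV. K x a b * p $ a * kronecker b i + K x a b * kronecker a i * p $ b)"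
    by (simp add: pd_add pd_sum pd_mult pd_component d)
  also have "\<dots> = (\<Sum>a\<in>UNIV. \<Sum>b\<in>UNIV. K x a b * p $ a * kronecker b i)
      + (\<Sum>a\<in>UNIV. \<Sum>b\<in>UNIV. K x a b * p $ b * kronecker a i)"
    by (simp add: sum.distrib mult_ac)
  also have "(\<Sum>a\<in>UNIV. \<Sum>b\<in>UNIV. K x a b * p $ b * kronecker a i)
      = (\<Sum>b\<in>UNIV. \<Sum>a\<in>UNIV. K x a b * p $ b * kronecker a i)" by (rule sum.swap)
  finally show ?thesis
    using assms by (simp add: dmom_def quad_fun_def[abs_def] lin_map_def)
qed

lemma dpos_quad_fun:
  assumes "open U" "x \<in> U" "\<And>i j. smooth_on U (\<lambda>y. K y i j)" "smooth_on U W"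
  shows "dpos i (quad_fun K W) x p = quad_form (\<lambda>a b. pd i (\<lambda>y. K y a b) x) p + pd i W x"
proof -
  have d: "(\<lambda>y. K y a b) differentiable at x" "W differentiable at x" for a b
    using assms smooth_on_differentiable by blast+
  then show ?thesis
    by (simp add: dpos_def quad_fun_def quad_form_def pd_add pd_sum pd_mult)
qed

text \<open>The bracket of an integral with the Hamiltonian has a part that is cubic and one that is linear
  in the momenta.  Comparing the momenta \<open>p\<close> and \<open>2 p\<close> separates them.\<close>

lemma killing_bracket_of_integral:
  assumes U: "open U" "x \<in> U"
    and K: "\<And>i j. smooth_on U (\<lambda>y. K y i j)" "\<And>i j. K x i j = K x j i" "smooth_on U W"
    and G: "\<And>i j. smooth_on U (\<lambda>y. G y i j)" "\<And>i j. G x i j = G x j i" "smooth_on U V"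
    and 0: "\<And>p. poisson (quad_fun K W) (quad_fun G V) x p = 0"
  shows "killing_bracket K G x p = 0"
proof -
  define l where "l p = (\<Sum>i\<in>UNIV. pd i W x * (2 * lin_map (G x) p i) - 2 * lin_map (K x) p i * pd i V x)" for p
  have lin2: "lin_map A (2 *\<^sub>R p) i = 2 * lin_map A p i" for A :: "'a \<Rightarrow> 'a \<Rightarrow> real" and i
    by (simp add: lin_map_def sum_distrib_left mult.left_commute)
  have quad2: "quad_form A (2 *\<^sub>R p) = 4 * quad_form A p" for A :: "'a \<Rightarrow> 'a \<Rightarrow> real"
    by (simp add: quad_form_def sum_distrib_left mult_ac)
  have sum: "killing_bracket K G x p + l p = 0" for p
    using 0[of p] unfolding poisson_def killing_bracket_def l_def
      dmom_quad_fun[of K x _ W, OF K(2)] dmom_quad_fun[of G x _ V, OF G(2)]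
      dpos_quad_fun[OF U K(1,3)] dpos_quad_fun[OF U G(1,3)]
    by (simp add: sum.distrib[symmetric] algebra_simps)
  have "l (2 *\<^sub>R p) = 2 * l p"
    by (simp add: l_def lin2 sum_distrib_left algebra_simps)
  moreover have "killing_bracket K G x (2 *\<^sub>R p) = 8 * killing_bracket K G x p"
    by (simp add: killing_bracket_def lin2 quad2 sum_distrib_left algebra_simps)
  ultimately show ?thesis using sum[of p] sum[of "2 *\<^sub>R p"] by simp
qed

lemma killing_bracket_add:
  assumes "\<And>i j. (\<lambda>y. K y i j) differentiable at x" "\<And>i j. (\<lambda>y. L y i j) differentiable at x"
  shows "killing_bracket (\<lambda>y i j. K y i j + L y i j) G x p = killing_bracket K G x p + killing_bracket L G x p"
  by (simp add: killing_bracket_def quad_form_def lin_map_def pd_add assms ring_distribs sum.distrib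
      sum_subtractf)

lemma killing_bracket_scale:
  assumes "\<And>i j. (\<lambda>y. K y i j) differentiable at x"
  shows "killing_bracket (\<lambda>y i j. r * K y i j) G x p = r * killing_bracket K G x p"
proof -
  have "quad_form (\<lambda>a b. r * A a b) p = r * quad_form A p"
    "lin_map (\<lambda>a b. r * A a b) p i = r * lin_map A p i" for A :: "'a \<Rightarrow> 'a \<Rightarrow> real" and i
    by (simp_all add: quad_form_def lin_map_def sum_distrib_left mult_ac)
  then show ?thesis
    by (simp add: killing_bracket_def pd_cmult assms sum_distrib_left algebra_simps)
qed

text \<open>A product of a nondegenerate quadratic form and a linear form vanishes only if the linear form
  does: otherwise the quadratic form vanishes off a hyperplane, and then also on it by the
  parallelogram law.\<close>

lemma quad_form_mult_linear_eq_0: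
  fixes A :: "'n::finite \<Rightarrow> 'n \<Rightarrow> real"
  assumes A: "\<And>i j. A i j = A j i" "invertible (\<chi> i j. A i j)"
    and 0: "\<And>p :: real^'n. quad_form A p * (\<Sum>i\<in>UNIV. l i * p $ i) = 0"
  shows "l i = 0"
proof (rule ccontr)
  assume "l i \<noteq> 0"
  define L where "L p = (\<Sum>i\<in>UNIV. l i * p $ i)" for p :: "real^'n"
  have L_add: "L (p + q) = L p + L q" "L (p - q) = L p - L q" for p q
    by (simp_all add: L_def algebra_simps sum.distrib sum_subtractf)
  have Li: "L (axis i 1) \<noteq> 0"
    using \<open>l i \<noteq> 0\<close> by (simp add: L_def axis_def if_distrib[of "\<lambda>z. _ * z"] cong: if_cong)
  have par: "quad_form A (p + q) + quad_form A (p - q) = 2 * quad_form A p + 2 * quad_form A q" for p q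
    by (simp add: quad_form_def sum.distrib[symmetric] sum_distrib_left algebra_simps)
  have off: "quad_form A p = 0" if "L p \<noteq> 0" for p
    using 0[of p] that by (simp add: L_def)
  have Q: "quad_form A p = 0" for p
  proof (cases "L p = 0")
    case True
    then show ?thesis
      using par[of "axis i 1" p] off[of "axis i 1 + p"] off[of "axis i 1 - p"] off[OF Li] Li
      by (simp add: L_add)
  qed (rule off)
  have "A a b = 0" for a b
  proof -
    have axis: "quad_form A (axis a 1) = A a a" for a
      by (simp add: quad_form_def axis_def if_distrib[of "\<lambda>z. _ * z"] if_distrib[of "\<lambda>z. z * _"] cong: if_cong)
    have "quad_form A (axis a 1 + axis b 1) = A a a + A b b + (A a b + A b a)"
      by (simp add: quad_form_def axis_def if_distrib[of "\<lambda>z. _ * z"] if_distrib[of "\<lambda>z. z * _"]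
          distrib_left distrib_right sum.distrib cong: if_cong)
    then show ?thesis using Q axis A(1)[of a b] by simp
  qed
  then have "(\<chi> i j. A i j) = 0" by (simp add: vec_eq_iff)
  then obtain B :: "real^'n^'n" where "0 ** B = (mat 1 :: real^'n^'n)"
    using A(2) unfolding invertible_def by auto
  then have "(0 ** B) $ i $ i = (mat 1 :: real^'n^'n) $ i $ i" by simp
  then show False by (simp add: matrix_matrix_mult_def mat_def)
qed

context conformal_patch
begin

lemma smooth_inv_square: "smooth_on U (\<lambda>y. 1 / (w y)\<^sup>2)"
  by (intro smooth_intros smooth_w) (simp add: w_nonzero)

text \<open>If Killing tensors of \<open>g\<close> and \<open>g'\<close> have the same trace-free part, they differ by a multiple
  \<open>\<mu>\<close> of the inverse metric.  The difference of the two Killing equations is the inverse metric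
  times a linear form, which therefore vanishes and determines \<open>d\<mu>\<close>.\<close>

lemma killing_difference:
  assumes K: "\<And>i j. smooth_on U (\<lambda>y. K y i j)" "\<And>p. killing_bracket K (inv_metric g) x p = 0"
    and K': "\<And>p. killing_bracket K' (inv_metric g') x p = 0"
    and \<mu>: "smooth_on U \<mu>" "\<And>y i j. y \<in> U \<Longrightarrow> K' y i j = K y i j + \<mu> y * inv_metric g y i j"
    and K_commute: "\<And>i j. K x i j = K x j i"
    and x: "x \<in> U"
  shows "(\<Sum>i\<in>UNIV. (K x b i + \<mu> x * inv_metric g x b i) * pd i (\<lambda>y. 1 / (w y)\<^sup>2) x)
     = 1 / (w x)\<^sup>2 * (\<Sum>i\<in>UNIV. inv_metric g x b i * pd i \<mu> x)"
proof -
  let ?G = "inv_metric g" and ?\<rho> = "\<lambda>y. 1 / (w y)\<^sup>2"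
  have \<rho>: "smooth_on U ?\<rho>" by (rule smooth_inv_square)
  have dG: "pd i (\<lambda>y. inv_metric g' y a b) x = ?\<rho> x * pd i (\<lambda>y. ?G y a b) x + pd i ?\<rho> x * ?G x a b" for i a b
  proof -
    have "pd i (\<lambda>y. inv_metric g' y a b) x = pd i (\<lambda>y. ?\<rho> y * ?G y a b) x"
      by (rule cong_pd[OF x]) (simp add: inv_g')
    then show ?thesis by (simp only: pd_mult[OF diff_at diff_at] \<rho> smooth_inv_metric x)
  qed
  have dK: "pd i (\<lambda>y. K' y a b) x = pd i (\<lambda>y. K y a b) x + (\<mu> x * pd i (\<lambda>y. ?G y a b) x + pd i \<mu> x * ?G x a b)" for i a b
  proof -
    have "pd i (\<lambda>y. K' y a b) x = pd i (\<lambda>y. K y a b + \<mu> y * ?G y a b) x"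
      by (rule cong_pd[OF x]) (rule \<mu>)
    then show ?thesis
      by (simp only: pd_mult[OF diff_at diff_at] pd_add[OF diff_at diff_at] K \<mu> smooth_inv_metric x
          smooth_on_mult[OF open_U])
  qed
  define l where "l b = (\<Sum>i\<in>UNIV. ?\<rho> x * pd i \<mu> x * ?G x i b - (K x i b + \<mu> x * ?G x i b) * pd i ?\<rho> x)" for b
  have lin: "quad_form (?G x) p * (\<Sum>b\<in>UNIV. l b * p $ b) = 0" for p
  proof -
    let ?Q = "quad_form (?G x) p" and ?k = "lin_map (K x) p" and ?\<gamma> = "lin_map (?G x) p"
    let ?\<kappa> = "\<lambda>i. quad_form (\<lambda>a b. pd i (\<lambda>y. K y a b) x) p"
    let ?\<eta> = "\<lambda>i. quad_form (\<lambda>a b. pd i (\<lambda>y. ?G y a b) x) p"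
    have 1: "lin_map (K' x) p i = ?k i + \<mu> x * ?\<gamma> i" for i
      by (simp add: lin_map_def \<mu>(2)[OF x] sum.distrib sum_distrib_left algebra_simps)
    have 2: "lin_map (inv_metric g' x) p i = ?\<rho> x * ?\<gamma> i" for i
      by (simp add: lin_map_def inv_g'[OF x] sum_distrib_left)
    have 3: "quad_form (\<lambda>a b. pd i (\<lambda>y. inv_metric g' y a b) x) p = ?\<rho> x * ?\<eta> i + pd i ?\<rho> x * ?Q" for i
      unfolding quad_form_def dG by (simp add: sum.distrib sum_distrib_left algebra_simps)
    have 4: "quad_form (\<lambda>a b. pd i (\<lambda>y. K' y a b) x) p = ?\<kappa> i + (\<mu> x * ?\<eta> i + pd i \<mu> x * ?Q)" for i
      unfolding quad_form_def dK by (simp add: sum.distrib sum_distrib_left algebra_simps)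
    have "0 = (\<Sum>i\<in>UNIV. ?\<rho> x * (?\<kappa> i * (2 * ?\<gamma> i) - 2 * ?k i * ?\<eta> i)
        + 2 * ?Q * (?\<rho> x * pd i \<mu> x * ?\<gamma> i - (?k i + \<mu> x * ?\<gamma> i) * pd i ?\<rho> x))"
      using K'[of p, symmetric] unfolding killing_bracket_def 1 2 3 4
      by (simp add: algebra_simps)
    also have "\<dots> = ?\<rho> x * killing_bracket K ?G x p
        + 2 * ?Q * (\<Sum>i\<in>UNIV. ?\<rho> x * pd i \<mu> x * ?\<gamma> i - (?k i + \<mu> x * ?\<gamma> i) * pd i ?\<rho> x)"
      by (simp only: sum.distrib sum_distrib_left[symmetric] killing_bracket_def)
    also have "(\<Sum>i\<in>UNIV. ?\<rho> x * pd i \<mu> x * ?\<gamma> i - (?k i + \<mu> x * ?\<gamma> i) * pd i ?\<rho> x)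
        = (\<Sum>i\<in>UNIV. \<Sum>b\<in>UNIV. (?\<rho> x * pd i \<mu> x * ?G x i b - (K x i b + \<mu> x * ?G x i b) * pd i ?\<rho> x) * p $ b)"
      by (simp add: lin_map_def sum_distrib_left sum_distrib_right sum.distrib[symmetric]
          sum_subtractf[symmetric] algebra_simps)
    also have "\<dots> = (\<Sum>b\<in>UNIV. l b * p $ b)"
      by (subst sum.swap) (simp add: l_def sum_distrib_right)
    finally show ?thesis using K(2)[of p] by simp
  qed
  have inv: "invertible (\<chi> i j. ?G x i j)"
  proof -
    have "(\<chi> i j. ?G x i j) ** (\<chi> i j. g x i j) = mat 1"
      using inverse_metric_mult(1)[OF x] by (simp add: matrix_matrix_mult_def vec_eq_iff mat_def kronecker_def)
    then show ?thesis using invertible_right_inverse by blast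
  qed
  have "l b = 0"
    by (rule quad_form_mult_linear_eq_0[of "?G x", OF inv_metric_commute[OF x] inv lin])
  then show ?thesis
    unfolding l_def using inv_metric_commute[OF x, of _ b] K_commute[of _ b]
    by (simp only: sum_subtractf sum_distrib_left) (simp add: mult_ac)
qed

text \<open>The formula for \<open>d\<mu>\<close> turns the terms with a derivative of \<open>w\<close> into \<open>V d\<mu>\<close>.\<close>

lemma contract_conf:
  assumes V: "smooth_on U V" and x: "x \<in> U" and \<mu>: "smooth_on U \<mu>"
    and K': "\<And>i j. K' x i j = K x i j + \<mu> x * inv_metric g x i j"
    and eq: "\<And>b. (\<Sum>i\<in>UNIV. (K x b i + \<mu> x * inv_metric g x b i) * pd i (\<lambda>y. 1 / (w y)\<^sup>2) x)
     = 1 / (w x)\<^sup>2 * (\<Sum>i\<in>UNIV. inv_metric g x b i * pd i \<mu> x)"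
  shows "contract g' K' (\<lambda>y. 1 / (w y)\<^sup>2 * V y) x i = contract g K V x i + pd i (\<lambda>y. \<mu> y * V y) x"
proof -
  let ?G = "inv_metric g" and ?\<rho> = "\<lambda>y. 1 / (w y)\<^sup>2"
  have \<rho>: "smooth_on U ?\<rho>" by (rule smooth_inv_square)
  have "(\<Sum>j\<in>UNIV. g' x i a * K' x a j * pd j (\<lambda>y. ?\<rho> y * V y) x)
      = (\<Sum>j\<in>UNIV. g x i a * K x a j * pd j V x) + \<mu> x * (g x i a * (\<Sum>j\<in>UNIV. ?G x a j * pd j V x))
        + V x * (g x i a * (\<Sum>j\<in>UNIV. ?G x a j * pd j \<mu> x))" for a
  proof -
    have "(w x)\<^sup>2 * ?\<rho> x = 1" using w_nonzero[OF x] by simp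
    then have "g' x i a * K' x a j * pd j (\<lambda>y. ?\<rho> y * V y) x
        = g x i a * K x a j * pd j V x + \<mu> x * g x i a * (?G x a j * pd j V x)
          + V x * g x i a * (w x)\<^sup>2 * ((K x a j + \<mu> x * ?G x a j) * pd j ?\<rho> x)" for j
      unfolding pd_mult[OF diff_at[OF \<rho> x] diff_at[OF V x]] g'_eq[OF x] K'
      by algebra
    then have "(\<Sum>j\<in>UNIV. g' x i a * K' x a j * pd j (\<lambda>y. ?\<rho> y * V y) x)
        = (\<Sum>j\<in>UNIV. g x i a * K x a j * pd j V x) + \<mu> x * g x i a * (\<Sum>j\<in>UNIV. ?G x a j * pd j V x)
          + V x * g x i a * (w x)\<^sup>2 * (\<Sum>j\<in>UNIV. (K x a j + \<mu> x * ?G x a j) * pd j ?\<rho> x)"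
      by (simp only: sum.distrib sum_distrib_left)
    then show ?thesis using w_nonzero[OF x] unfolding eq by simp
  qed
  then have "contract g' K' (\<lambda>y. ?\<rho> y * V y) x i
      = contract g K V x i + \<mu> x * (\<Sum>a\<in>UNIV. g x i a * (\<Sum>j\<in>UNIV. ?G x a j * pd j V x))
        + V x * (\<Sum>a\<in>UNIV. g x i a * (\<Sum>j\<in>UNIV. ?G x a j * pd j \<mu> x))"
    unfolding contract_def by (simp only: sum.distrib sum_distrib_left)
  then show ?thesis
    by (simp only: raise_lower(1)[OF x] pd_mult[OF diff_at[OF \<mu> x] diff_at[OF V x]]) simp
qed

lemma smooth_contract:
  assumes "\<And>i j. smooth_on U (\<lambda>y. K y i j)" "smooth_on U V"
  shows "smooth_on U (\<lambda>y. contract g K V y i)"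
  unfolding contract_def by (intro smooth_intros smooth_g assms) auto

text \<open>\<open>K' d(w\<^sup>-\<^sup>2 V)\<close> differs from \<open>K dV\<close> by the exact form \<open>d(\<mu> V)\<close>, hence is closed as
  well.\<close>

lemma compatible_conf:
  assumes V: "smooth_on U V"
    and K: "\<And>i j. smooth_on U (\<lambda>y. K y i j)" "\<And>y p. y \<in> U \<Longrightarrow> killing_bracket K (inv_metric g) y p = 0"
      "\<And>y i j. y \<in> U \<Longrightarrow> K y i j = K y j i"
    and K': "\<And>i j. smooth_on U (\<lambda>y. K' y i j)" "\<And>y p. y \<in> U \<Longrightarrow> killing_bracket K' (inv_metric g') y p = 0"
    and tf: "\<And>y i j. y \<in> U \<Longrightarrow>
      K' y i j - (\<Sum>a\<in>UNIV. \<Sum>b\<in>UNIV. g' y a b * K' y a b) * inv_metric g' y i j / real CARD('n)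
      = K y i j - (\<Sum>a\<in>UNIV. \<Sum>b\<in>UNIV. g y a b * K y a b) * inv_metric g y i j / real CARD('n)"
    and closed: "\<And>i j. pd i (\<lambda>y. contract g K V y j) x = pd j (\<lambda>y. contract g K V y i) x"
    and x: "x \<in> U"
  shows "pd i (\<lambda>y. contract g' K' (\<lambda>y. 1 / (w y)\<^sup>2 * V y) y j) x
     = pd j (\<lambda>y. contract g' K' (\<lambda>y. 1 / (w y)\<^sup>2 * V y) y i) x"
proof -
  \<comment> \<open>the trace of \<open>K' - K = \<mu> g\<^sup>-\<^sup>1\<close>, divided by \<open>n\<close>\<close>
  define \<mu> where "\<mu> y = ((\<Sum>a\<in>UNIV. \<Sum>b\<in>UNIV. g y a b * K' y a b)
      - (\<Sum>a\<in>UNIV. \<Sum>b\<in>UNIV. g y a b * K y a b)) * (1 / real CARD('n))" for y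
  have \<mu>: "smooth_on U \<mu>" unfolding \<mu>_def by (intro smooth_intros smooth_g K K') auto
  have K'_eq: "K' y i j = K y i j + \<mu> y * inv_metric g y i j" if y: "y \<in> U" for y i j
  proof -
    have "(\<Sum>a\<in>UNIV. \<Sum>b\<in>UNIV. g' y a b * K' y a b)
        = (w y)\<^sup>2 * (\<Sum>a\<in>UNIV. \<Sum>b\<in>UNIV. g y a b * K' y a b)"
      by (simp add: g'_eq[OF y] sum_distrib_left mult.assoc)
    then have "(\<Sum>a\<in>UNIV. \<Sum>b\<in>UNIV. g' y a b * K' y a b) * inv_metric g' y i j
        = (\<Sum>a\<in>UNIV. \<Sum>b\<in>UNIV. g y a b * K' y a b) * inv_metric g y i j"
      using w_nonzero[OF y] by (simp add: inv_g'[OF y])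
    with tf[OF y, of i j] show ?thesis by (simp add: \<mu>_def diff_divide_distrib left_diff_distrib)
  qed
  have conf: "contract g' K' (\<lambda>y. 1 / (w y)\<^sup>2 * V y) y i = contract g K V y i + pd i (\<lambda>y. \<mu> y * V y) y"
    if y: "y \<in> U" for y i
    using killing_difference[OF K(1) K(2)[OF y] K'(2)[OF y] \<mu> K'_eq K(3)[OF y] y]
    by (intro contract_conf V \<mu> y K'_eq)
  have \<mu>V: "smooth_on U (\<lambda>y. \<mu> y * V y)" by (intro smooth_intros \<mu> V)
  have "pd i (\<lambda>y. contract g' K' (\<lambda>y. 1 / (w y)\<^sup>2 * V y) y j) x
      = pd i (\<lambda>y. contract g K V y j) x + pd i (pd j (\<lambda>y. \<mu> y * V y)) x" for i j
  proof -
    have "pd i (\<lambda>y. contract g' K' (\<lambda>y. 1 / (w y)\<^sup>2 * V y) y j) x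
        = pd i (\<lambda>y. contract g K V y j + pd j (\<lambda>y. \<mu> y * V y) y) x"
      by (rule cong_pd[OF x]) (rule conf)
    then show ?thesis
      by (simp only: pd_add[OF diff_at diff_at] smooth_contract K(1) V x smooth_on_pd[OF \<mu>V])
  qed
  then show ?thesis using closed pd_commute[OF \<mu>V open_U x] by simp
qed

end

section \<open>Unique continuation for the Hessian equation\<close>

lemma frechet_derivative_pd:
  fixes f :: "real^'n::finite \<Rightarrow> real"
  assumes "f differentiable at x"
  shows "frechet_derivative f (at x) v = (\<Sum>k\<in>UNIV. v $ k * pd k f x)"
proof -
  have "v = (\<Sum>k\<in>UNIV. v $ k *\<^sub>R axis k 1)"
    by (simp add: vec_eq_iff axis_def if_distrib[of "\<lambda>z. _ * z"] cong: if_cong)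
  then have "frechet_derivative f (at x) v
      = frechet_derivative f (at x) (\<Sum>k\<in>UNIV. v $ k *\<^sub>R axis k 1)"
    by (rule arg_cong)
  also have "\<dots> = (\<Sum>k\<in>UNIV. v $ k * pd k f x)"
    using linear_frechet_derivative[OF assms] by (simp add: linear_sum linear_scale pd_def)
  finally show ?thesis .
qed

text \<open>Gronwall's inequality along line segments: the sum of squares of a solution grows at most
  exponentially.\<close>

lemma total_linear_system_unique:
  fixes u :: "'b::finite \<Rightarrow> real^'n::finite \<Rightarrow> real"
  assumes W: "convex W" "x0 \<in> W" "x \<in> W"
    and d: "\<And>a y. y \<in> W \<Longrightarrow> u a differentiable at y"
    and eq: "\<And>a k y. y \<in> W \<Longrightarrow> pd k (u a) y = (\<Sum>b\<in>UNIV. N y k a b * u b y)"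
    and N: "\<And>k a b. continuous_on W (\<lambda>y. N y k a b)"
    and 0: "\<And>a. u a x0 = 0"
  shows "u a x = 0"
proof -
  define v where "v = x - x0"
  define \<gamma> where "\<gamma> t = x0 + t *\<^sub>R v" for t :: real
  have \<gamma>: "\<gamma> t \<in> W" if "0 \<le> t" "t \<le> 1" for t
  proof -
    have "\<gamma> t = (1 - t) *\<^sub>R x0 + t *\<^sub>R x" by (simp add: \<gamma>_def v_def algebra_simps)
    then show ?thesis using W that by (simp add: convex_alt)
  qed
  define m where "m a b t = (\<Sum>k\<in>UNIV. v $ k * N (\<gamma> t) k a b)" for a b t
  have "continuous_on {0..1} (m a b)" for a b
    unfolding m_def
    by (intro continuous_intros continuous_on_compose2[OF N]) (auto simp: \<gamma>[unfolded \<gamma>_def] \<gamma>_def[abs_def] intro!: continuous_intros)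
  then have "bounded (m a b ` {0..1})" for a b
    by (intro compact_imp_bounded compact_continuous_image) auto
  then have "\<exists>C. \<forall>t\<in>{0..1}. \<bar>m a b t\<bar> \<le> C" for a b
    unfolding bounded_iff by (auto simp: image_iff)
  then obtain C where C: "\<And>a b t. t \<in> {0..1} \<Longrightarrow> \<bar>m a b t\<bar> \<le> C a b"
    by metis
  define K where "K = (\<Sum>a\<in>UNIV. \<Sum>b\<in>UNIV. \<bar>C a b\<bar>)"
  have mK: "\<bar>m a b t\<bar> \<le> K" if "t \<in> {0..1}" for a b t
  proof -
    have "\<bar>C a b\<bar> \<le> (\<Sum>b\<in>UNIV. \<bar>C a b\<bar>)" by (rule member_le_sum) auto
    also have "\<dots> \<le> K" unfolding K_def
      by (rule member_le_sum[of a UNIV "\<lambda>a. \<Sum>b\<in>UNIV. \<bar>C a b\<bar>"]) (auto intro: sum_nonneg)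
    finally show ?thesis using C[OF that, of a b] by linarith
  qed
  \<comment> \<open>the growth rate: \<open>2 u\<^sub>a m\<^sub>a\<^sub>b u\<^sub>b \<le> K (u\<^sub>a\<^sup>2 + u\<^sub>b\<^sup>2)\<close>, summed over all pairs of indices\<close>
  define L where "L = 2 * K * real CARD('b)"
  define f where "f t = (\<Sum>a\<in>UNIV. (u a (\<gamma> t))\<^sup>2)" for t
  have du: "((\<lambda>t. u a (\<gamma> t)) has_real_derivative (\<Sum>b\<in>UNIV. m a b t * u b (\<gamma> t))) (at t)"
    if "0 \<le> t" "t \<le> 1" for a t
  proof -
    have "(\<gamma> has_derivative (\<lambda>s. s *\<^sub>R v)) (at t)"
      unfolding \<gamma>_def[abs_def] by (auto intro!: derivative_eq_intros)
    moreover have "(u a has_derivative frechet_derivative (u a) (at (\<gamma> t))) (at (\<gamma> t))"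
      using d[OF \<gamma>[OF that]] frechet_derivative_works by blast
    ultimately have "((\<lambda>t. u a (\<gamma> t)) has_derivative (\<lambda>s. frechet_derivative (u a) (at (\<gamma> t)) (s *\<^sub>R v))) (at t)"
      by (rule has_derivative_compose)
    moreover have "frechet_derivative (u a) (at (\<gamma> t)) (s *\<^sub>R v) = (\<Sum>b\<in>UNIV. m a b t * u b (\<gamma> t)) * s" for s
    proof -
      have "(\<Sum>k\<in>UNIV. v $ k * pd k (u a) (\<gamma> t)) = (\<Sum>k\<in>UNIV. \<Sum>b\<in>UNIV. v $ k * N (\<gamma> t) k a b * u b (\<gamma> t))"
        by (simp add: eq[OF \<gamma>[OF that]] sum_distrib_left mult.assoc)
      also have "\<dots> = (\<Sum>b\<in>UNIV. m a b t * u b (\<gamma> t))"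
        by (subst sum.swap) (simp add: m_def sum_distrib_right)
      finally have "(\<Sum>k\<in>UNIV. v $ k * pd k (u a) (\<gamma> t)) = (\<Sum>b\<in>UNIV. m a b t * u b (\<gamma> t))" .
      moreover have "frechet_derivative (u a) (at (\<gamma> t)) (s *\<^sub>R v) = (\<Sum>k\<in>UNIV. v $ k * pd k (u a) (\<gamma> t)) * s"
        by (simp add: frechet_derivative_pd[OF d[OF \<gamma>[OF that]]] sum_distrib_left mult_ac)
      ultimately show ?thesis by simp
    qed
    ultimately show ?thesis by (simp add: has_field_derivative_def)
  qed
  have df: "(f has_real_derivative (\<Sum>a\<in>UNIV. 2 * u a (\<gamma> t) * (\<Sum>b\<in>UNIV. m a b t * u b (\<gamma> t)))) (at t)"
    if "0 \<le> t" "t \<le> 1" for t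
    unfolding f_def[abs_def] using that
    by (auto intro!: derivative_eq_intros du sum.cong simp: mult_ac)
  have growth: "(\<Sum>a\<in>UNIV. 2 * u a (\<gamma> t) * (\<Sum>b\<in>UNIV. m a b t * u b (\<gamma> t))) \<le> L * f t"
    if "0 \<le> t" "t \<le> 1" for t
  proof -
    have "2 * u a (\<gamma> t) * (m a b t * u b (\<gamma> t)) \<le> K * (u a (\<gamma> t))\<^sup>2 + K * (u b (\<gamma> t))\<^sup>2" for a b
    proof -
      have "2 * u a (\<gamma> t) * (m a b t * u b (\<gamma> t)) \<le> \<bar>m a b t\<bar> * \<bar>2 * u a (\<gamma> t) * u b (\<gamma> t)\<bar>"
        by (rule order_trans[OF abs_ge_self]) (simp add: abs_mult mult_ac)
      also have "\<dots> \<le> K * ((u a (\<gamma> t))\<^sup>2 + (u b (\<gamma> t))\<^sup>2)"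
        using mK[of t a b] that sum_squares_bound[of "\<bar>u a (\<gamma> t)\<bar>" "\<bar>u b (\<gamma> t)\<bar>"]
        by (intro mult_mono) (auto simp: abs_mult)
      finally show ?thesis by (simp add: distrib_left)
    qed
    then have "(\<Sum>a\<in>UNIV. 2 * u a (\<gamma> t) * (\<Sum>b\<in>UNIV. m a b t * u b (\<gamma> t)))
        \<le> (\<Sum>a\<in>UNIV. \<Sum>b\<in>UNIV. K * (u a (\<gamma> t))\<^sup>2 + K * (u b (\<gamma> t))\<^sup>2)"
      unfolding sum_distrib_left by (intro sum_mono)
    also have "\<dots> = L * f t"
      by (simp add: f_def L_def sum.distrib sum_distrib_left mult_ac)
    finally show ?thesis .
  qed
  have "f 1 * exp (- L * 1) \<le> f 0 * exp (- L * 0)"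
  proof (rule DERIV_nonpos_imp_nonincreasing[of 0 1 "\<lambda>t. f t * exp (- L * t)"])
    fix t :: real assume t: "0 \<le> t" "t \<le> 1"
    let ?f' = "\<Sum>a\<in>UNIV. 2 * u a (\<gamma> t) * (\<Sum>b\<in>UNIV. m a b t * u b (\<gamma> t))"
    have "((\<lambda>t. f t * exp (- L * t)) has_real_derivative (?f' - L * f t) * exp (- L * t)) (at t)"
      by (auto intro!: derivative_eq_intros df[OF t] simp: algebra_simps)
    moreover have "(?f' - L * f t) * exp (- L * t) \<le> 0"
      using growth[OF t] by (intro mult_nonpos_nonneg) auto
    ultimately show "\<exists>y. ((\<lambda>t. f t * exp (- L * t)) has_real_derivative y) (at t) \<and> y \<le> 0" by blast
  qed simp
  moreover have "f 0 = 0" by (simp add: f_def \<gamma>_def 0)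
  ultimately have "f 1 \<le> 0" by (simp add: mult_le_0_iff)
  then have "f 1 = 0" by (simp add: f_def antisym sum_nonneg)
  then show ?thesis
    by (simp add: f_def sum_nonneg_eq_0_iff \<gamma>_def v_def)
qed

lemma sum_option:
  "(\<Sum>a\<in>(UNIV :: 'i::finite option set). f a) = f None + (\<Sum>i\<in>UNIV. f (Some i))"
  by (simp add: UNIV_option_conv sum.reindex)

context metric_patch
begin

text \<open>Since partial derivatives commute, the equation for the Hessian of \<open>V\<close> has an integrability
  condition, whose trace expresses \<open>d\<Delta>V\<close> by \<open>dV\<close> and \<open>\<Delta>V\<close>.  So \<open>dV\<close> and \<open>\<Delta>V\<close>
  together solve a linear system that prescribes all their first derivatives.\<close>

lemma hessian_equation_unique:
  assumes n: "CARD('n) \<ge> 2"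
    and T: "\<And>i j k. smooth_on U (\<lambda>x. T x i j k)"
    and V: "smooth_on U V"
    and eq: "\<And>x i j. x \<in> U \<Longrightarrow> hessian g V x i j =
       (\<Sum>l\<in>UNIV. \<Sum>k\<in>UNIV. T x i j l * inv_metric g x l k * pd k V x)
       + g x i j * laplacian g V x / real CARD('n)"
    and W: "W \<subseteq> U" "convex W" "x0 \<in> W"
    and 0: "V x0 = 0" "\<And>i. pd i V x0 = 0" "laplacian g V x0 = 0"
    and x: "x \<in> W"
  shows "V x = 0"
proof -
  let ?n = "real CARD('n)" and ?L = "laplacian g V"
  have n0: "?n > 1" using n by simp
  define A where "A x i j k = (\<Sum>l\<in>UNIV. T x i j l * inv_metric g x l k) + christoffel g x k i j" for x i j k
  have smooth_A: "smooth_on U (\<lambda>x. A x i j k)" for i j k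
    unfolding A_def by (intro smooth_intros T smooth_inv_metric smooth_christoffel) auto
  note smooth_L = smooth_laplacian[OF V]
  have second: "pd j (pd i V) y = (\<Sum>k\<in>UNIV. A y i j k * pd k V y) + g y i j * (?L y * (1 / ?n))"
    if "y \<in> U" for y i j
  proof -
    have "pd j (pd i V) y = hessian g V y i j + (\<Sum>k\<in>UNIV. christoffel g y k i j * pd k V y)"
      by (simp add: hessian_def cov_deriv1_def grad_def[abs_def])
    also have "hessian g V y i j = (\<Sum>k\<in>UNIV. (\<Sum>l\<in>UNIV. T y i j l * inv_metric g y l k) * pd k V y)
        + g y i j * (?L y * (1 / ?n))"
      unfolding eq[OF that] by (subst sum.swap) (simp add: sum_distrib_right)
    finally show ?thesis by (simp add: A_def distrib_right sum.distrib)
  qed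
  define p where "p x i j k m = pd k (\<lambda>y. A y i j m) x + (\<Sum>l\<in>UNIV. A x i j l * A x l k m)" for x i j k m
  define q where "q x i j k = ((\<Sum>l\<in>UNIV. A x i j l * g x l k) + pd k (\<lambda>y. g y i j) x) * (1 / ?n)" for x i j k
  have third: "pd k (pd j (pd i V)) y
      = (\<Sum>m\<in>UNIV. p y i j k m * pd m V y) + q y i j k * ?L y + g y i j * (pd k ?L y * (1 / ?n))"
    if y: "y \<in> U" for y i j k
  proof -
    have s: "smooth_on U (\<lambda>y. A y i j l * pd l V y)" "smooth_on U (\<lambda>y. g y i j * (?L y * (1 / ?n)))"
      "smooth_on U (\<lambda>y. \<Sum>l\<in>UNIV. A y i j l * pd l V y)" "smooth_on U (\<lambda>y. ?L y * (1 / ?n))" for l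
      by (intro smooth_intros smooth_A V smooth_g smooth_L; simp)+
    have "pd k (pd j (pd i V)) y
        = pd k (\<lambda>y. (\<Sum>l\<in>UNIV. A y i j l * pd l V y) + g y i j * (?L y * (1 / ?n))) y"
      by (rule cong_pd[OF y]) (rule second)
    also have "\<dots> = (\<Sum>l\<in>UNIV. pd k (\<lambda>y. A y i j l * pd l V y) y) + pd k (\<lambda>y. g y i j * (?L y * (1 / ?n))) y"
      using y by (subst pd_add[OF diff_at[OF s(3)] diff_at[OF s(2)]])
        (simp_all add: pd_sum[OF _ diff_at[OF s(1)]])
    also have "\<dots> = (\<Sum>l\<in>UNIV. A y i j l * pd k (pd l V) y + pd k (\<lambda>y. A y i j l) y * pd l V y)
        + (g y i j * (pd k ?L y * (1 / ?n)) + pd k (\<lambda>y. g y i j) y * (?L y * (1 / ?n)))"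
      by (simp add: pd_mult[OF diff_at diff_at] smooth_A smooth_on_pd V smooth_g smooth_L y s(4)
          smooth_on_const del: times_divide_eq_right mult_1_right)
    also have "(\<Sum>l\<in>UNIV. A y i j l * pd k (pd l V) y + pd k (\<lambda>y. A y i j l) y * pd l V y)
        = (\<Sum>m\<in>UNIV. p y i j k m * pd m V y) + (\<Sum>l\<in>UNIV. A y i j l * g y l k) * (?L y * (1 / ?n))"
    proof -
      have "(\<Sum>l\<in>UNIV. A y i j l * (\<Sum>m\<in>UNIV. A y l k m * pd m V y))
          = (\<Sum>m\<in>UNIV. (\<Sum>l\<in>UNIV. A y i j l * A y l k m) * pd m V y)"
        by (simp add: sum_distrib_left sum_distrib_right mult.assoc) (rule sum.swap)
      then show ?thesis
        by (simp only: second[OF y] p_def distrib_left distrib_right sum.distrib)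
          (simp add: sum_distrib_right sum_distrib_left sum_divide_distrib mult.assoc)
    qed
    finally show ?thesis by (simp add: q_def algebra_simps)
  qed
  \<comment> \<open>tracing \<open>g\<^sub>i\<^sub>j \<partial>\<^sub>k\<Delta>V - g\<^sub>i\<^sub>k \<partial>\<^sub>j\<Delta>V\<close> with \<open>g\<^sup>i\<^sup>j\<close> gives \<open>(n - 1) \<partial>\<^sub>k\<Delta>V\<close>\<close>
  define c where "c x k m = ?n / (?n - 1) *
      (\<Sum>i\<in>UNIV. \<Sum>j\<in>UNIV. inv_metric g x i j * (p x i k j m - p x i j k m))" for x k m
  define d where "d x k = ?n / (?n - 1) *
      (\<Sum>i\<in>UNIV. \<Sum>j\<in>UNIV. inv_metric g x i j * (q x i k j - q x i j k))" for x k
  have dL: "pd k ?L y = (\<Sum>m\<in>UNIV. c y k m * pd m V y) + d y k * ?L y" if y: "y \<in> U" for y k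
  proof -
    let ?G = "inv_metric g y"
    have "g y i j * (pd k ?L y * (1 / ?n)) - g y i k * (pd j ?L y * (1 / ?n))
        = (\<Sum>m\<in>UNIV. (p y i k j m - p y i j k m) * pd m V y) + (q y i k j - q y i j k) * ?L y" for i j
      using pd_commute[OF smooth_on_pd[OF V] open_U y, of k j i] third[OF y]
      by (simp add: algebra_simps sum_subtractf)
    then have "(\<Sum>i\<in>UNIV. \<Sum>j\<in>UNIV. ?G i j * (g y i j * (pd k ?L y * (1 / ?n)) - g y i k * (pd j ?L y * (1 / ?n))))
        = (\<Sum>i\<in>UNIV. \<Sum>j\<in>UNIV. ?G i j * ((\<Sum>m\<in>UNIV. (p y i k j m - p y i j k m) * pd m V y)
            + (q y i k j - q y i j k) * ?L y))" by simp
    also have "\<dots> = (\<Sum>i\<in>UNIV. \<Sum>j\<in>UNIV. \<Sum>m\<in>UNIV. ?G i j * (p y i k j m - p y i j k m) * pd m V y)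
        + (\<Sum>i\<in>UNIV. \<Sum>j\<in>UNIV. ?G i j * (q y i k j - q y i j k)) * ?L y"
      by (simp add: distrib_left sum.distrib sum_distrib_left sum_distrib_right mult.assoc)
    also have "(\<Sum>i\<in>UNIV. \<Sum>j\<in>UNIV. \<Sum>m\<in>UNIV. ?G i j * (p y i k j m - p y i j k m) * pd m V y)
        = (\<Sum>i\<in>UNIV. \<Sum>m\<in>UNIV. \<Sum>j\<in>UNIV. ?G i j * (p y i k j m - p y i j k m) * pd m V y)"
      by (intro sum.cong refl sum.swap)
    also have "\<dots> = (\<Sum>m\<in>UNIV. (\<Sum>i\<in>UNIV. \<Sum>j\<in>UNIV. ?G i j * (p y i k j m - p y i j k m)) * pd m V y)"
      unfolding sum_distrib_right by (rule sum.swap)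
    also have "(\<Sum>i\<in>UNIV. \<Sum>j\<in>UNIV. ?G i j * (g y i j * (pd k ?L y * (1 / ?n)) - g y i k * (pd j ?L y * (1 / ?n))))
        = (?n - 1) / ?n * pd k ?L y"
    proof -
      have "?G i j * (g y i j * (pd k ?L y * (1 / ?n)) - g y i k * (pd j ?L y * (1 / ?n)))
          = ?G i j * g y i j * (pd k ?L y * (1 / ?n)) - (pd j ?L y * (1 / ?n)) * (?G j i * g y i k)" for i j
        using inv_metric_commute[OF y, of i j] by (simp add: algebra_simps)
      then have "(\<Sum>i\<in>UNIV. \<Sum>j\<in>UNIV. ?G i j * (g y i j * (pd k ?L y * (1 / ?n)) - g y i k * (pd j ?L y * (1 / ?n))))
          = (\<Sum>i\<in>UNIV. \<Sum>j\<in>UNIV. ?G i j * g y i j) * (pd k ?L y * (1 / ?n))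
            - (\<Sum>i\<in>UNIV. \<Sum>j\<in>UNIV. (pd j ?L y * (1 / ?n)) * (?G j i * g y i k))"
        by (simp only: sum_subtractf sum_distrib_right)
      also have "(\<Sum>i\<in>UNIV. \<Sum>j\<in>UNIV. (pd j ?L y * (1 / ?n)) * (?G j i * g y i k))
          = (\<Sum>j\<in>UNIV. (pd j ?L y * (1 / ?n)) * (\<Sum>i\<in>UNIV. ?G j i * g y i k))"
        by (subst sum.swap) (simp only: sum_distrib_left)
      finally show ?thesis using n0
        by (simp only: inverse_metric_mult[OF y] metric_trace[OF y] kronecker_sums) (simp add: field_simps)
    qed
    finally have "(?n - 1) / ?n * pd k ?L y
        = (\<Sum>m\<in>UNIV. (\<Sum>i\<in>UNIV. \<Sum>j\<in>UNIV. ?G i j * (p y i k j m - p y i j k m)) * pd m V y)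
          + (\<Sum>i\<in>UNIV. \<Sum>j\<in>UNIV. ?G i j * (q y i k j - q y i j k)) * ?L y" .
    then have "?n / (?n - 1) * ((?n - 1) / ?n * pd k ?L y)
        = (\<Sum>m\<in>UNIV. c y k m * pd m V y) + d y k * ?L y"
      by (simp only: c_def d_def distrib_left sum_distrib_left[of _ _ UNIV, where f = "\<lambda>m. _ m * pd m V y"] mult.assoc)
    then show ?thesis using n0 by simp
  qed
  \<comment> \<open>the unknowns \<open>\<Delta>V\<close>, with index \<^const>\<open>None\<close>, and \<open>\<partial>\<^sub>iV\<close>\<close>
  define u where "u a = (case a of None \<Rightarrow> ?L | Some i \<Rightarrow> pd i V)" for a
  define N where "N x k a b = (case a of
       None \<Rightarrow> (case b of None \<Rightarrow> d x k | Some m \<Rightarrow> c x k m)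
     | Some i \<Rightarrow> (case b of None \<Rightarrow> g x i k * (1 / ?n) | Some m \<Rightarrow> A x i k m))" for x k a b
  have u0: "u a y = 0" if "y \<in> W" for a y
  proof (rule total_linear_system_unique[OF W(2,3) that])
    show "u a differentiable at y" if "y \<in> W" for a y
      using that W(1) V smooth_L
      by (cases a) (auto simp: u_def intro!: diff_at smooth_on_pd)
    show "pd k (u a) y = (\<Sum>b\<in>UNIV. N y k a b * u b y)" if "y \<in> W" for a k y
    proof -
      have "y \<in> U" using that W(1) by blast
      from second[OF this, of k] dL[OF this, of k] show ?thesis
        by (cases a) (simp_all add: sum_option u_def N_def)
    qed
    have "smooth_on U (\<lambda>y. c y k m)" "smooth_on U (\<lambda>y. d y k)" for k m
      unfolding c_def d_def p_def q_def
      by (intro smooth_intros smooth_A smooth_g smooth_inv_metric; simp)+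
    moreover have "smooth_on U (\<lambda>y. g y i k * (1 / ?n))" for i k
      by (intro smooth_intros smooth_g)
    ultimately have "smooth_on U (\<lambda>y. N y k a b)" for k a b
      using smooth_A by (cases a; cases b) (simp_all add: N_def)
    then show "continuous_on W (\<lambda>y. N y k a b)" for k a b
      using smooth_on_continuous_on W(1) continuous_on_subset by blast
    show "u a x0 = 0" for a using 0 by (cases a) (auto simp: u_def)
  qed
  have "(\<lambda>_::unit. V) () x = 0"
  proof (rule total_linear_system_unique[OF W(2,3) x, where N = "\<lambda>_ _ _ _. 0"])
    show "V differentiable at y" if "y \<in> W" for y using that W(1) V diff_at by blast
    show "pd k V y = (\<Sum>b\<in>(UNIV :: unit set). 0 * V y)" if "y \<in> W" for k y
      using u0[OF that, of "Some k"] by (simp add: u_def)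
  qed (use 0 in auto)
  then show ?thesis by simp
qed

end

section \<open>From charts to the manifold\<close>

lemma chart_facts:
  assumes "smooth_manifold M \<A>" "c \<in> \<A>"
  shows chart_range_open: "open (cran c)"
    and chart_domain_open: "openin M (cdom c)"
    and cinv_cmap: "q \<in> cdom c \<Longrightarrow> cinv c (cmap c q) = q"
    and cmap_cinv: "x \<in> cran c \<Longrightarrow> cmap c (cinv c x) = x"
    and cinv_in_domain: "x \<in> cran c \<Longrightarrow> cinv c x \<in> cdom c"
    and chart_preimage_open: "open W \<Longrightarrow> openin M {q \<in> cdom c. cmap c q \<in> W}"
    and chart_image_open: "openin M N \<Longrightarrow> open (cmap c ` (N \<inter> cdom c))"
proof -
  have o: "openin M (cdom c)" and r: "open (cran c)"
    and h: "homeomorphic_map (subtopology M (cdom c)) (top_of_set (cran c)) (cmap c)"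
    using assms by (auto simp: smooth_manifold_def)
  show "openin M (cdom c)" "open (cran c)" by fact+
  have top: "topspace (subtopology M (cdom c)) = cdom c"
    using openin_subset[OF o] by (auto simp: topspace_subtopology)
  have "inj_on (cmap c) (cdom c)"
    using homeomorphic_imp_injective_map[OF h] by (simp only: top)
  then show "cinv c (cmap c q) = q" if "q \<in> cdom c"
    using that by (simp add: cinv_def)
  show "cmap c (cinv c x) = x" "cinv c x \<in> cdom c" if "x \<in> cran c"
    using that unfolding cinv_def cran_def by (auto intro: f_inv_into_f inv_into_into)
  show "openin M {q \<in> cdom c. cmap c q \<in> W}" if "open W"
  proof -
    have "openin (top_of_set (cran c)) (cran c \<inter> W)" using that by (auto simp: openin_open)
    from openin_continuous_map_preimage[OF homeomorphic_imp_continuous_map[OF h] this]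
    have "openin (subtopology M (cdom c)) {q \<in> cdom c. cmap c q \<in> cran c \<inter> W}" by (simp only: top)
    moreover have "{q \<in> cdom c. cmap c q \<in> cran c \<inter> W} = {q \<in> cdom c. cmap c q \<in> W}"
      by (auto simp: cran_def)
    ultimately show ?thesis using openin_trans_full[OF _ o] by simp
  qed
  show "open (cmap c ` (N \<inter> cdom c))" if "openin M N"
  proof -
    have "openin (subtopology M (cdom c)) (N \<inter> cdom c)"
      using that by (auto simp: openin_subtopology)
    then have "openin (top_of_set (cran c)) (cmap c ` (N \<inter> cdom c))"
      using homeomorphic_imp_open_map[OF h] by (auto simp: open_map_def)
    then show ?thesis using openin_open_trans r by blast
  qed
qed

lemma metric_patch_chart:
  assumes "smooth_manifold M \<A>" "metric_field \<A> g" "c \<in> \<A>"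
  shows "metric_patch (cran c) (g c)"
  using assms chart_range_open[OF assms(1,3)]
  by unfold_locales (auto simp: metric_field_def cov_field2_def)

lemma scalar_field_smooth: "scalar_field M \<A> f \<Longrightarrow> c \<in> \<A> \<Longrightarrow> smooth_on (cran c) (loc c f)"
  by (simp add: scalar_field_def)

definition hessian_equation ::
  "('a, 'n::finite) chart set \<Rightarrow> ('a, 'n) tensor2 \<Rightarrow> ('a, 'n) tensor3 \<Rightarrow> ('a \<Rightarrow> real) \<Rightarrow> bool" where
  "hessian_equation \<A> g T V \<longleftrightarrow> (\<forall>c\<in>\<A>. \<forall>x\<in>cran c. \<forall>i j. hessian (g c) (loc c V) x i j =
     (\<Sum>l\<in>UNIV. \<Sum>k\<in>UNIV. T c x i j l * inv_metric (g c) x l k * pd k (loc c V) x)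
     + g c x i j * laplacian (g c) (loc c V) x / real CARD('n))"

text \<open>The set of points near which \<open>V\<close> vanishes is open by definition, and closed because it
  contains every ball of a chart that it meets.\<close>

lemma hessian_equation_unique_global:
  fixes \<A> :: "('a, 'n::finite) chart set"
  assumes M: "smooth_manifold M \<A>" and n: "CARD('n) \<ge> 2" and g: "metric_field \<A> g" and T: "cov_field3 \<A> T"
    and V: "scalar_field M \<A> V" and eq: "hessian_equation \<A> g T V"
    and c: "c \<in> \<A>" "x \<in> cran c"
    and 0: "loc c V x = 0" "\<And>k. pd k (loc c V) x = 0" "laplacian (g c) (loc c V) x = 0"
  shows "V = (\<lambda>q. 0)"
proof -
  have ball_zero: "loc d V y = 0"
    if d: "d \<in> \<A>" and W: "W \<subseteq> cran d" "convex W" "z \<in> W" "y \<in> W"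
      and 0: "loc d V z = 0" "\<And>k. pd k (loc d V) z = 0" "laplacian (g d) (loc d V) z = 0" for d W y z
  proof -
    interpret metric_patch "cran d" "g d" using metric_patch_chart[OF M g d] .
    show ?thesis
      by (rule hessian_equation_unique[OF n _ scalar_field_smooth[OF V d] _ W(1-3) 0 W(4), where T = "T d"])
        (use T eq d in \<open>auto simp: cov_field3_def hessian_equation_def\<close>)
  qed
  define Z where "Z = \<Union>{N. openin M N \<and> (\<forall>q\<in>N. V q = 0)}"
  have ball_Z: "{q \<in> cdom d. cmap d q \<in> ball z r} \<subseteq> Z"
    if d: "d \<in> \<A>" and r: "ball z r \<subseteq> cran d" and y: "y \<in> ball z r"
      and 0: "loc d V y = 0" "\<And>k. pd k (loc d V) y = 0" "laplacian (g d) (loc d V) y = 0" for d z r y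
  proof -
    have "V q = 0" if q: "q \<in> cdom d" "cmap d q \<in> ball z r" for q
      using ball_zero[OF d r _ y q(2) 0] cinv_cmap[OF M d q(1)] by (simp add: loc_def)
    moreover have "openin M {q \<in> cdom d. cmap d q \<in> ball z r}"
      by (rule chart_preimage_open[OF M d]) simp
    ultimately show ?thesis unfolding Z_def by blast
  qed
  have jet_Z: "loc d V y = 0 \<and> (\<forall>k. pd k (loc d V) y = 0) \<and> laplacian (g d) (loc d V) y = 0"
    if d: "d \<in> \<A>" and y: "y \<in> cran d" "cinv d y \<in> Z" for d y
  proof -
    obtain N where N: "openin M N" "\<And>q. q \<in> N \<Longrightarrow> V q = 0" "cinv d y \<in> N"
      using y(2) unfolding Z_def by blast
    define P where "P = cmap d ` (N \<inter> cdom d)"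
    have P: "open P" "y \<in> P"
      using chart_image_open[OF M d N(1)] N(3) cmap_cinv[OF M d y(1)] cinv_in_domain[OF M d y(1)]
      unfolding P_def by (auto intro: rev_image_eqI)
    have zero: "loc d V z = 0" if "z \<in> P" for z
      using that N(2) cinv_cmap[OF M d] by (auto simp: P_def loc_def)
    have pd0: "pd k (loc d V) z = 0" if "z \<in> P" for k z
      using pd_cong[OF P(1) that, of "loc d V" "\<lambda>_. 0" k] zero by simp
    have "pd j (pd i (loc d V)) y = 0" for i j
      using pd_cong[OF P, of "pd i (loc d V)" "\<lambda>_. 0" j] pd0 by simp
    then show ?thesis using zero[OF P(2)] pd0[OF P(2)]
      by (simp add: laplacian_def hessian_def cov_deriv1_def grad_def[abs_def])
  qed
  have "openin M Z" unfolding Z_def by (rule openin_Union) auto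
  moreover have "closedin M Z"
  proof -
    have "\<exists>N. openin M N \<and> q \<in> N \<and> N \<subseteq> topspace M - Z" if q: "q \<in> topspace M" "q \<notin> Z" for q
    proof -
      obtain d where d: "d \<in> \<A>" "q \<in> cdom d"
        using q(1) M unfolding smooth_manifold_def by blast
      have "cmap d q \<in> cran d" using d(2) by (simp add: cran_def)
      then obtain r where r: "r > 0" "ball (cmap d q) r \<subseteq> cran d"
        using chart_range_open[OF M d(1)] openE by blast
      let ?N = "{p \<in> cdom d. cmap d p \<in> ball (cmap d q) r}"
      have "p \<notin> Z" if p: "p \<in> ?N" for p
      proof
        assume "p \<in> Z"
        then have "cinv d (cmap d p) \<in> Z" using cinv_cmap[OF M d(1)] p by simp
        moreover have "cmap d p \<in> cran d" using p by (simp add: cran_def)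
        ultimately have "?N \<subseteq> Z" using jet_Z[OF d(1)] ball_Z[OF d(1) r(2)] p by blast
        then show False using q(2) d(2) r(1) by auto
      qed
      moreover have N: "openin M ?N" by (rule chart_preimage_open[OF M d(1)]) simp
      ultimately show ?thesis using openin_subset[OF N] d(2) r(1) by (intro exI[of _ ?N]) auto
    qed
    then have "openin M (topspace M - Z)" by (subst openin_subopen) blast
    moreover have "Z \<subseteq> topspace M" using \<open>openin M Z\<close> openin_subset by blast
    ultimately show ?thesis by (simp add: closedin_def)
  qed
  moreover have "Z \<noteq> {}"
  proof -
    obtain r where r: "r > 0" "ball x r \<subseteq> cran c"
      using chart_range_open[OF M c(1)] c(2) openE by blast
    have "{q \<in> cdom c. cmap c q \<in> ball x r} \<subseteq> Z"
      using ball_Z[OF c(1) r(2), of x] r(1) 0 by simp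
    moreover have "cinv c x \<in> {q \<in> cdom c. cmap c q \<in> ball x r}"
      using cinv_in_domain[OF M c] cmap_cinv[OF M c] r(1) by simp
    ultimately show ?thesis by blast
  qed
  moreover have "connected_space M" using M by (simp add: smooth_manifold_def)
  ultimately have "Z = topspace M" unfolding connected_space_clopen_in by blast
  then have "V q = 0" for q
    using V unfolding Z_def scalar_field_def by blast
  then show ?thesis by blast
qed

section \<open>The space of compatible potentials\<close>

text \<open>The cubic part of the Poisson bracket is linear in \<open>K\<close>, so it vanishes on the span as it does on
  the given integrals.\<close>

lemma killing_space_facts:
  assumes M: "smooth_manifold M \<A>" and S: "properly_superintegrable M \<A> S"
    and K: "K \<in> killing_space S" and c: "c \<in> \<A>"
  shows "smooth_on (cran c) (\<lambda>x. K c x i j)"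
    and "x \<in> cran c \<Longrightarrow> K c x i j = K c x j i"
    and "x \<in> cran c \<Longrightarrow> killing_bracket (K c) (inv_metric (hmetric S c)) x p = 0"
proof -
  have g: "metric_field \<A> (hmetric S)" using S by (simp add: properly_superintegrable_def)
  interpret metric_patch "cran c" "hmetric S c" using metric_patch_chart[OF M g c] .
  let ?P = "\<lambda>K :: ('a, 'b) tensor2. (\<forall>i j. smooth_on (cran c) (\<lambda>x. K c x i j)) \<and>
      (\<forall>x\<in>cran c. \<forall>i j. K c x i j = K c x j i) \<and>
      (\<forall>x\<in>cran c. \<forall>p. killing_bracket (K c) (inv_metric (hmetric S c)) x p = 0)"
  have "?P K"
    using K unfolding killing_space_def
  proof (rule span_induct[where P = ?P])
    have zero: "(0 :: ('a, 'b) tensor2) c = (\<lambda>x i j. 0)" by (simp add: fun_eq_iff)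
    have add: "(L + L') c = (\<lambda>x i j. L c x i j + L' c x i j)" for L L' :: "('a, 'b) tensor2"
      by (simp add: fun_eq_iff)
    have scale: "(r *\<^sub>R L) c = (\<lambda>x i j. r * L c x i j)" for r and L :: "('a, 'b) tensor2"
      by (simp add: fun_eq_iff scaleR_fun_def)
    show "subspace {K. ?P K}"
    proof (rule subspaceI)
      show "0 \<in> {K. ?P K}"
        by (simp add: zero smooth_on_const killing_bracket_def quad_form_def lin_map_def)
      show "L + L' \<in> {K. ?P K}" if "L \<in> {K. ?P K}" "L' \<in> {K. ?P K}" for L L'
        using that unfolding mem_Collect_eq add
        by (simp add: killing_bracket_add diff_at smooth_on_add[OF open_U])
      show "r *\<^sub>R L \<in> {K. ?P K}" if "L \<in> {K. ?P K}" for r L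
        using that unfolding mem_Collect_eq scale
        by (simp add: killing_bracket_scale diff_at smooth_on_mult[OF open_U smooth_on_const])
    qed
    fix K assume "K \<in> fst ` hints S"
    then obtain W where "(K, W) \<in> hints S" by force
    then have F: "second_order_integral M \<A> S (K, W)"
      using S by (auto simp: properly_superintegrable_def)
    then have K: "smooth_on (cran c) (\<lambda>x. K c x i j)" "x \<in> cran c \<Longrightarrow> K c x i j = K c x j i" for i j x
      using c by (auto simp: second_order_integral_def contra_field2_def)
    have W: "smooth_on (cran c) (loc c W)"
      using F c by (auto simp: second_order_integral_def scalar_field_def)
    have V: "smooth_on (cran c) (loc c (hpot S))"
      using S c by (auto simp: properly_superintegrable_def scalar_field_def)
    have "killing_bracket (K c) (inv_metric (hmetric S c)) x p = 0" if x: "x \<in> cran c" for x p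
    proof (rule killing_bracket_of_integral[OF open_U x K(1) K(2)[OF x] W smooth_inv_metric inv_metric_commute[OF x] V])
      show "poisson (quad_fun (K c) (loc c W)) (quad_fun (inv_metric (hmetric S c)) (loc c (hpot S))) x p = 0" for p
        using F c x by (simp add: second_order_integral_def integral_fun_def[abs_def] hamiltonian_def[abs_def])
    qed
    with K show "?P K" by blast
  qed
  then show "smooth_on (cran c) (\<lambda>x. K c x i j)" "x \<in> cran c \<Longrightarrow> K c x i j = K c x j i"
    "x \<in> cran c \<Longrightarrow> killing_bracket (K c) (inv_metric (hmetric S c)) x p = 0" by blast+
qed

lemma loc_lincomb: "loc c (\<lambda>q. r * f q + s * h q) = (\<lambda>x. r * loc c f x + s * loc c h x)"
  by (simp add: loc_def)

lemma scalar_field_lincomb: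
  assumes "smooth_manifold M \<A>" "scalar_field M \<A> f" "scalar_field M \<A> h"
  shows "scalar_field M \<A> (\<lambda>q. r * f q + s * h q)"
  unfolding scalar_field_def
proof (intro conjI ballI allI impI)
  fix c assume c: "c \<in> \<A>"
  show "smooth_on (cran c) (loc c (\<lambda>q. r * f q + s * h q))"
    unfolding loc_lincomb
    by (intro smooth_on_intros[OF chart_range_open[OF assms(1) c]] smooth_on_const
        scalar_field_smooth[OF assms(2) c] scalar_field_smooth[OF assms(3) c])
qed (use assms in \<open>auto simp: scalar_field_def\<close>)

lemma subspace_Vmax:
  assumes M: "smooth_manifold M \<A>" and S: "properly_superintegrable M \<A> S"
  shows "subspace (Vmax M \<A> S)"
proof -
  have g: "metric_field \<A> (hmetric S)" using S by (simp add: properly_superintegrable_def)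
  have lincomb: "(\<lambda>q. r * V q + s * V' q) \<in> Vmax M \<A> S"
    if V: "V \<in> Vmax M \<A> S" and V': "V' \<in> Vmax M \<A> S" for V V' r s
  proof -
    have sf: "scalar_field M \<A> V" "scalar_field M \<A> V'" using V V' by (auto simp: Vmax_def)
    have "compatible \<A> (hmetric S) K (\<lambda>q. r * V q + s * V' q)" if K: "K \<in> killing_space S" for K
      unfolding compatible_def
    proof (intro ballI allI)
      fix c x i j assume c: "c \<in> \<A>" and x: "x \<in> cran c"
      interpret metric_patch "cran c" "hmetric S c" using metric_patch_chart[OF M g c] .
      let ?C = "\<lambda>V. contract (hmetric S c) (K c) (loc c V)"
      have sm: "smooth_on (cran c) (loc c V)" "smooth_on (cran c) (loc c V')"
        using sf c by (auto intro: scalar_field_smooth)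
      have smK: "smooth_on (cran c) (\<lambda>x. K c x i j)" for i j using killing_space_facts(1)[OF M S K c] .
      have smC: "smooth_on (cran c) (\<lambda>y. ?C V y i)" "smooth_on (cran c) (\<lambda>y. ?C V' y i)" for i
        unfolding contract_def by (intro smooth_intros smooth_g smK sm; simp)+
      have "?C (\<lambda>q. r * V q + s * V' q) y i = r * ?C V y i + s * ?C V' y i" if "y \<in> cran c" for y i
      proof -
        have "pd k (loc c (\<lambda>q. r * V q + s * V' q)) y = r * pd k (loc c V) y + s * pd k (loc c V') y" for k
          using that sm smooth_on_mult[OF open_U smooth_on_const]
          by (simp add: loc_lincomb pd_add[OF diff_at diff_at] pd_cmult[OF diff_at])
        then show ?thesis
          by (simp add: contract_def distrib_left sum.distrib sum_distrib_left mult_ac)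
      qed
      then have "pd j (\<lambda>y. ?C (\<lambda>q. r * V q + s * V' q) y i) x = r * pd j (\<lambda>y. ?C V y i) x + s * pd j (\<lambda>y. ?C V' y i) x" for i j
        using cong_pd[OF x, of "\<lambda>y. ?C (\<lambda>q. r * V q + s * V' q) y i" "\<lambda>y. r * ?C V y i + s * ?C V' y i" j]
          x smC smooth_on_mult[OF open_U smooth_on_const]
        by (simp add: pd_add[OF diff_at diff_at] pd_cmult[OF diff_at])
      moreover have "pd i (\<lambda>y. ?C V y j) x = pd j (\<lambda>y. ?C V y i) x" "pd i (\<lambda>y. ?C V' y j) x = pd j (\<lambda>y. ?C V' y i) x"
        using V V' K c x by (auto simp: Vmax_def compatible_def)
      ultimately show "pd i (\<lambda>y. ?C (\<lambda>q. r * V q + s * V' q) y j) x = pd j (\<lambda>y. ?C (\<lambda>q. r * V q + s * V' q) y i) x"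
        by simp
    qed
    then show ?thesis using scalar_field_lincomb[OF M sf] by (simp add: Vmax_def)
  qed
  have zero: "(\<lambda>q. 0) \<in> Vmax M \<A> S"
  proof -
    have "loc c (\<lambda>q. 0) = (\<lambda>x. 0)" for c :: "('a, 'b) chart" by (simp add: loc_def)
    moreover have "contract h K (\<lambda>x. 0) = (\<lambda>x i. 0)" for h K :: "'b comps2"
      by (simp add: contract_def fun_eq_iff)
    ultimately show ?thesis by (simp add: Vmax_def scalar_field_def compatible_def smooth_on_const)
  qed
  show ?thesis
  proof (rule subspaceI)
    show "0 \<in> Vmax M \<A> S" using zero by (simp add: zero_fun_def)
    show "V + V' \<in> Vmax M \<A> S" if "V \<in> Vmax M \<A> S" "V' \<in> Vmax M \<A> S" for V V'
      using lincomb[OF that, of 1 1] by (simp add: plus_fun_def)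
    show "r *\<^sub>R V \<in> Vmax M \<A> S" if "V \<in> Vmax M \<A> S" for r V
      using lincomb[OF that that, of r 0] by (simp add: scaleR_fun_def)
  qed
qed

text \<open>A potential is determined by its value, its differential and its Laplacian at one point.  These
  are \<open>n + 2\<close> numbers, and the space of potentials has dimension \<open>n + 2\<close>, so all values occur.\<close>

lemma Vmax_prescribed_differential:
  fixes \<A> :: "('a, 'n::finite) chart set"
  assumes M: "smooth_manifold M \<A>" and n: "CARD('n) \<ge> 2" and S: "abundant M \<A> S"
    and c: "c \<in> \<A>" and x: "x \<in> cran c"
  obtains V where "V \<in> Vmax M \<A> S" "loc c V x = 0" "\<And>k. pd k (loc c V) x = v k"
proof -
  let ?V = "Vmax M \<A> S" and ?g = "hmetric S c"
  have psi: "properly_superintegrable M \<A> S" and dim: "dim ?V = CARD('n) + 2"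
    using S by (auto simp: abundant_def)
  have g: "metric_field \<A> (hmetric S)" using psi by (simp add: properly_superintegrable_def)
  interpret metric_patch "cran c" ?g using metric_patch_chart[OF M g c] .
  obtain T where T: "structure_tensor M \<A> S T" using S by (auto simp: abundant_def)
  have sub: "subspace ?V" by (rule subspace_Vmax[OF M psi])
  have smooth: "smooth_on (cran c) (loc c V)" if "V \<in> ?V" for V
    using that c by (auto simp: Vmax_def intro: scalar_field_smooth)
  define jet where "jet V = (loc c V x, (\<chi> k. pd k (loc c V) x), laplacian ?g (loc c V) x)" for V
  have jet_lincomb: "jet (\<lambda>q. r * V q + s * V' q) = r *\<^sub>R jet V + s *\<^sub>R jet V'"
    if "V \<in> ?V" "V' \<in> ?V" for V V' r s
  proof -
    show ?thesis
      using smooth[OF that(1)] smooth[OF that(2)] x smooth_on_mult[OF open_U smooth_on_const]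
      unfolding jet_def loc_lincomb
      by (simp add: pd_add[OF diff_at diff_at] pd_cmult[OF diff_at] vec_eq_iff laplacian_def
          hessian_lincomb distrib_left sum.distrib sum_distrib_left mult_ac)
  qed
  have jet_inj: "V = 0" if "V \<in> ?V" "jet V = 0" for V
  proof -
    have "hessian_equation \<A> (hmetric S) T V"
      using T that(1) by (simp add: structure_tensor_def hessian_equation_def)
    moreover have "cov_field3 \<A> T" using T by (simp add: structure_tensor_def)
    moreover have "scalar_field M \<A> V" using that(1) by (simp add: Vmax_def)
    ultimately have "V = (\<lambda>q. 0)"
      using that(2) hessian_equation_unique_global[OF M n g _ _ _ c x]
      by (auto simp: jet_def zero_prod_def vec_eq_iff)
    then show ?thesis by (simp add: zero_fun_def)
  qed
  obtain b where b: "b \<subseteq> ?V" "independent b" "?V \<subseteq> span b" "card b = dim ?V"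
    using basis_exists[of ?V] by blast
  have span_b: "span b = ?V" using b sub by (meson span_minimal subset_antisym)
  have finb: "finite b" using b(4) dim by (metis card.infinite add_is_0 zero_neq_numeral)
  \<comment> \<open>the jet is linear on the potentials only; \<open>f\<close> is linear on all functions and agrees with it there\<close>
  obtain f :: "('a \<Rightarrow> real) \<Rightarrow> real \<times> (real^'n) \<times> real" where f: "linear f" "\<And>V. V \<in> b \<Longrightarrow> f V = jet V"
    using linear_independent_extend[OF b(2), of jet] by blast
  have f_jet: "f V = jet V" if "V \<in> span b" for V
  proof -
    have "V \<in> ?V \<and> f V = jet V"
      using that
    proof (rule span_induct[where P = "\<lambda>V. V \<in> ?V \<and> f V = jet V"])
      show "subspace {V. V \<in> ?V \<and> f V = jet V}"
      proof (rule subspaceI)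
        have z: "0 \<in> ?V" using sub subspace_0 by blast
        have "jet 0 = 0" using jet_lincomb[OF z z, of 0 0] by (simp add: zero_fun_def)
        then show "0 \<in> {V. V \<in> ?V \<and> f V = jet V}" using z linear_0[OF f(1)] by simp
        show "V + V' \<in> {V. V \<in> ?V \<and> f V = jet V}"
          if "V \<in> {V. V \<in> ?V \<and> f V = jet V}" "V' \<in> {V. V \<in> ?V \<and> f V = jet V}" for V V'
          using that jet_lincomb[of V V' 1 1] linear_add[OF f(1)] subspace_add[OF sub]
          by (simp add: plus_fun_def)
        show "r *\<^sub>R V \<in> {V. V \<in> ?V \<and> f V = jet V}" if "V \<in> {V. V \<in> ?V \<and> f V = jet V}" for r V
          using that jet_lincomb[of V V r 0] linear_scale[OF f(1)] subspace_scale[OF sub]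
          by (simp add: scaleR_fun_def)
      qed
      show "V \<in> ?V \<and> f V = jet V" if "V \<in> b" for V using that f(2) b(1) by blast
    qed
    then show ?thesis by blast
  qed
  have inj: "inj_on f (span b)"
  proof (rule inj_onI)
    fix V V' assume "V \<in> span b" "V' \<in> span b" "f V = f V'"
    then have "V - V' \<in> span b" "f (V - V') = 0"
      using linear_diff[OF f(1)] span_diff by auto
    then have "V - V' = 0" using f_jet jet_inj span_b by metis
    then show "V = V'" by simp
  qed
  have "independent (f ` b)" using linear_independent_injective_image[OF f(1) b(2) inj] .
  moreover have "card (f ` b) = DIM(real \<times> (real^'n) \<times> real)"
    using card_image[OF inj_on_subset[OF inj span_superset]] b(4) dim by simp
  ultimately have "span (f ` b) = UNIV"
    using card_ge_dim_independent[of "f ` b" UNIV] by (simp add: dim_UNIV top.extremum_unique)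
  then have "(0, (\<chi> k. v k), 0) \<in> f ` span b"
    using linear_span_image[OF f(1)] by (metis UNIV_I)
  then obtain V where V: "V \<in> span b" "(0, (\<chi> k. v k), 0) = f V" by blast
  then have "jet V = (0, (\<chi> k. v k), 0)" using f_jet by simp
  then show thesis using V(1) span_b that[of V] by (auto simp: jet_def vec_eq_iff)
qed

section \<open>Conformally equivalent systems\<close>

lemma linear_trace_free2: "linear (trace_free2 g)"
proof (rule linearI)
  show "trace_free2 g (K + L) = trace_free2 g K + trace_free2 g L" for K L
    by (simp add: trace_free2_def fun_eq_iff ring_distribs sum.distrib add_divide_distrib)
  show "trace_free2 g (r *\<^sub>R K) = r *\<^sub>R trace_free2 g K" for r K
    by (simp add: trace_free2_def fun_eq_iff scaleR_fun_def sum_distrib_left algebra_simps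
        flip: sum_distrib_left)
qed

lemma conformal_patch_chart:
  assumes "smooth_manifold M \<A>" "metric_field \<A> (hmetric S)"
    and "conformally_equivalent M \<A> \<Omega> S S'"
    and "\<forall>c\<in>\<A>. \<forall>x\<in>cran c. \<forall>i j. hmetric S' c x i j = (loc c \<Omega> x)\<^sup>2 * hmetric S c x i j"
    and c: "c \<in> \<A>"
  shows "conformal_patch (cran c) (hmetric S c) (loc c \<Omega>) (hmetric S' c)"
proof -
  have "loc c \<Omega> x \<noteq> 0" if "x \<in> cran c" for x
    using cinv_in_domain[OF assms(1) c that] openin_subset[OF chart_domain_open[OF assms(1) c]] assms(3)
    by (auto simp: conformally_equivalent_def loc_def)
  moreover have "smooth_on (cran c) (loc c \<Omega>)"
    using assms(3) c by (auto simp: conformally_equivalent_def scalar_field_def)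
  ultimately show ?thesis
    using metric_patch_chart[OF assms(1,2) c] assms(4) c
    by (simp add: conformal_patch_def conformal_patch_axioms_def)
qed

text \<open>The conformal change carries potentials to potentials, although the Killing tensors themselves
  change: only their trace-free parts agree.\<close>

lemma Vmax_conf:
  assumes M: "smooth_manifold M \<A>"
    and S: "properly_superintegrable M \<A> S" and S': "properly_superintegrable M \<A> S'"
    and conf: "conformally_equivalent M \<A> \<Omega> S S'"
    and g': "\<forall>c\<in>\<A>. \<forall>x\<in>cran c. \<forall>i j. hmetric S' c x i j = (loc c \<Omega> x)\<^sup>2 * hmetric S c x i j"
    and V: "V \<in> Vmax M \<A> S"
  shows "(\<lambda>q. 1 / (\<Omega> q)\<^sup>2 * V q) \<in> Vmax M \<A> S'"
proof -
  let ?V' = "\<lambda>q. 1 / (\<Omega> q)\<^sup>2 * V q"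
  have g: "metric_field \<A> (hmetric S)" using S by (simp add: properly_superintegrable_def)
  have loc_V': "loc c ?V' = (\<lambda>y. 1 / (loc c \<Omega> y)\<^sup>2 * loc c V y)" for c :: "('a, 'b) chart"
    by (simp add: loc_def)
  have patch: "conformal_patch (cran c) (hmetric S c) (loc c \<Omega>) (hmetric S' c)" if "c \<in> \<A>" for c
    by (rule conformal_patch_chart[OF M g conf g' that])
  have sV: "smooth_on (cran c) (loc c V)" if "c \<in> \<A>" for c
    using V that by (auto simp: Vmax_def intro: scalar_field_smooth)
  have "scalar_field M \<A> ?V'"
    unfolding scalar_field_def
  proof (intro conjI ballI allI impI)
    fix c assume c: "c \<in> \<A>"
    interpret conformal_patch "cran c" "hmetric S c" "loc c \<Omega>" "hmetric S' c" by (rule patch[OF c])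
    show "smooth_on (cran c) (loc c ?V')" unfolding loc_V'
      by (intro smooth_intros sV c smooth_w) (simp add: w_nonzero)
  qed (use V in \<open>simp add: Vmax_def scalar_field_def\<close>)
  moreover have "compatible \<A> (hmetric S') K' ?V'" if K': "K' \<in> killing_space S'" for K'
  proof -
    have "trace_free2 (hmetric S') ` killing_space S' = trace_free2 (hmetric S) ` killing_space S"
      using conf by (simp add: conformally_equivalent_def linear_span_image[OF linear_trace_free2]
          killing_space_def span_span)
    then obtain K where K: "K \<in> killing_space S"
      and tf: "trace_free2 (hmetric S') K' = trace_free2 (hmetric S) K"
      using K' by blast
    show ?thesis
      unfolding compatible_def loc_V'
    proof (intro ballI allI)
      fix c x i j assume c: "c \<in> \<A>" and x: "x \<in> cran c"
      interpret conformal_patch "cran c" "hmetric S c" "loc c \<Omega>" "hmetric S' c" by (rule patch[OF c])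
      note k = killing_space_facts[OF M S K c] and k' = killing_space_facts[OF M S' K' c]
      show "pd i (\<lambda>y. contract (hmetric S' c) (K' c) (\<lambda>y. 1 / (loc c \<Omega> y)\<^sup>2 * loc c V y) y j) x
          = pd j (\<lambda>y. contract (hmetric S' c) (K' c) (\<lambda>y. 1 / (loc c \<Omega> y)\<^sup>2 * loc c V y) y i) x"
      proof (rule compatible_conf[OF sV[OF c] k(1) k(3) k(2) k'(1) k'(3) _ _ x])
        fix y i j
        have "trace_free2 (hmetric S') K' c y i j = trace_free2 (hmetric S) K c y i j" by (simp add: tf)
        then show "K' c y i j - (\<Sum>a\<in>UNIV. \<Sum>b\<in>UNIV. hmetric S' c y a b * K' c y a b)
              * inv_metric (hmetric S' c) y i j / real CARD('b)
            = K c y i j - (\<Sum>a\<in>UNIV. \<Sum>b\<in>UNIV. hmetric S c y a b * K c y a b)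
              * inv_metric (hmetric S c) y i j / real CARD('b)"
          by (simp add: trace_free2_def)
      next
        show "pd i (\<lambda>y. contract (hmetric S c) (K c) (loc c V) y j) x
            = pd j (\<lambda>y. contract (hmetric S c) (K c) (loc c V) y i) x" for i j
          using V K c x by (auto simp: Vmax_def compatible_def)
      qed
    qed
  qed
  ultimately show ?thesis by (simp add: Vmax_def)
qed

context conformal_patch
begin

lemma pd_inv_square:
  assumes "x \<in> U" shows "pd i (\<lambda>y. 1 / (w y)\<^sup>2) x = - 2 * (1 / (w x)\<^sup>2) * \<Upsilon> x i"
proof -
  have "pd i (\<lambda>y. inverse ((w y)\<^sup>2)) x = - (2 * w x * (w x * \<Upsilon> x i) * (inverse ((w x)\<^sup>2))\<^sup>2)"
    using assms smooth_w w_nonzero[OF assms] smooth_on_power[OF open_U smooth_w, of 2]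
    by (simp add: pd_inverse[OF diff_at] pd_power2[OF diff_at] pd_w)
  then show ?thesis using w_nonzero[OF assms] by (simp add: inverse_eq_divide power2_eq_square field_simps)
qed

text \<open>At a zero of \<open>V\<close> the second derivatives of \<open>w\<close> disappear.  Of the coefficient \<open>3\<close>, two come
  from the factor \<open>w\<^sup>-\<^sup>2\<close> and one from the change of the Christoffel symbols.\<close>

lemma hessian_conf_potential:
  assumes V: "smooth_on U V" and x: "x \<in> U" and 0: "V x = 0"
  obtains s where "\<And>i j. hessian g' (\<lambda>y. 1 / (w y)\<^sup>2 * V y) x i j
     = 1 / (w x)\<^sup>2 * (hessian g V x i j - 3 * \<Upsilon> x i * pd j V x - 3 * \<Upsilon> x j * pd i V x + g x i j * s)"
proof -
  let ?\<rho> = "\<lambda>y. 1 / (w y)\<^sup>2" and ?F = "\<lambda>y. 1 / (w y)\<^sup>2 * V y"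
  have \<rho>: "smooth_on U ?\<rho>" by (rule smooth_inv_square)
  have d1: "pd i ?F y = ?\<rho> y * (pd i V y - 2 * \<Upsilon> y i * V y)" if "y \<in> U" for i y
    using that \<rho> V by (simp only: pd_mult[OF diff_at diff_at] pd_inv_square) (simp add: algebra_simps)
  have d1x: "pd i ?F x = ?\<rho> x * pd i V x" for i using d1[OF x] 0 by simp
  have d2: "pd j (pd i ?F) x = ?\<rho> x * (pd j (pd i V) x - 2 * \<Upsilon> x i * pd j V x - 2 * \<Upsilon> x j * pd i V x)" for i j
  proof -
    have s: "smooth_on U (\<lambda>y. pd i V y - 2 * \<Upsilon> y i * V y)" "smooth_on U (\<lambda>y. 2 * \<Upsilon> y i * V y)"
      "smooth_on U (\<lambda>y. 2 * \<Upsilon> y i)"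
      by (intro smooth_intros V smooth_\<Upsilon>)+
    have "pd j (pd i ?F) x = pd j (\<lambda>y. ?\<rho> y * (pd i V y - 2 * \<Upsilon> y i * V y)) x"
      by (rule cong_pd[OF x]) (rule d1)
    also have "\<dots> = ?\<rho> x * pd j (\<lambda>y. pd i V y - 2 * \<Upsilon> y i * V y) x
        + pd j ?\<rho> x * (pd i V x - 2 * \<Upsilon> x i * V x)"
      by (rule pd_mult[OF diff_at[OF \<rho> x] diff_at[OF s(1) x]])
    also have "pd j (\<lambda>y. pd i V y - 2 * \<Upsilon> y i * V y) x
        = pd j (pd i V) x - (2 * \<Upsilon> x i * pd j V x + pd j (\<lambda>y. 2 * \<Upsilon> y i) x * V x)"
      by (simp only: pd_diff[OF diff_at[OF smooth_on_pd[OF V] x] diff_at[OF s(2) x]]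
          pd_mult[OF diff_at[OF s(3) x] diff_at[OF V x]])
    finally show ?thesis by (simp only: pd_inv_square[OF x] 0) (simp add: algebra_simps)
  qed
  have h: "hessian g ?F x i j = ?\<rho> x * (hessian g V x i j - 2 * \<Upsilon> x i * pd j V x - 2 * \<Upsilon> x j * pd i V x)" for i j
  proof -
    have "(\<Sum>k\<in>UNIV. christoffel g x k i j * pd k ?F x) = ?\<rho> x * (\<Sum>k\<in>UNIV. christoffel g x k i j * pd k V x)"
      by (simp only: d1x sum_distrib_left mult.left_commute)
    then show ?thesis
      unfolding hessian_def cov_deriv1_def grad_def[abs_def] d2 by (simp add: algebra_simps)
  qed
  show thesis
  proof (rule that)
    show "hessian g' ?F x i j = ?\<rho> x * (hessian g V x i j - 3 * \<Upsilon> x i * pd j V x - 3 * \<Upsilon> x j * pd i V x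
        + g x i j * (\<Sum>l\<in>UNIV. \<Upsilon>_up x l * pd l V x))" for i j
    proof -
      have "(\<Sum>l\<in>UNIV. \<Upsilon>_up x l * pd l ?F x) = ?\<rho> x * (\<Sum>l\<in>UNIV. \<Upsilon>_up x l * pd l V x)"
        by (simp only: d1x sum_distrib_left mult.left_commute)
      then show ?thesis unfolding hessian_conf[OF x] h d1x by (simp add: algebra_simps)
    qed
  qed
qed

text \<open>Inserting a potential that vanishes at a point, with prescribed differential, into the Hessian
  equations of both systems compares their structure tensors up to a trace in the first two indices.\<close>

lemma structure_tensor_conf:
  assumes x: "x \<in> U" and V: "smooth_on U V" "V x = 0" "\<And>k. pd k V x = g x k m"
    and eq: "\<And>i j. hessian g V x i j =
       (\<Sum>l\<in>UNIV. \<Sum>k\<in>UNIV. T i j l * inv_metric g x l k * pd k V x) + g x i j * L"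
    and eq': "\<And>i j. hessian g' (\<lambda>y. 1 / (w y)\<^sup>2 * V y) x i j =
       (\<Sum>l\<in>UNIV. \<Sum>k\<in>UNIV. T' i j l * inv_metric g' x l k * pd k (\<lambda>y. 1 / (w y)\<^sup>2 * V y) x)
         + g' x i j * L'"
  obtains b where "\<And>i j. 1 / (w x)\<^sup>2 * T' i j m
     = T i j m - 3 * \<Upsilon> x i * g x j m - 3 * \<Upsilon> x j * g x i m + g x i j * b"
proof -
  let ?\<rho> = "1 / (w x)\<^sup>2"
  obtain s where s: "\<And>i j. hessian g' (\<lambda>y. 1 / (w y)\<^sup>2 * V y) x i j
     = ?\<rho> * (hessian g V x i j - 3 * \<Upsilon> x i * pd j V x - 3 * \<Upsilon> x j * pd i V x + g x i j * s)"
    using hessian_conf_potential[OF V(1) x V(2)] by blast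
  have pdV': "pd k (\<lambda>y. 1 / (w y)\<^sup>2 * V y) x = ?\<rho> * g x k m" for k
    using pd_mult[OF diff_at[OF smooth_inv_square x] diff_at[OF V(1) x], of k] V by simp
  have contract: "(\<Sum>l\<in>UNIV. \<Sum>k\<in>UNIV. X l * inv_metric g x l k * g x k m) = X m" for X
  proof -
    have "(\<Sum>k\<in>UNIV. X l * inv_metric g x l k * g x k m) = X l * kronecker l m" for l
      by (simp only: mult.assoc sum_distrib_left[symmetric] inverse_metric_mult[OF x])
    then show ?thesis by simp
  qed
  have 1: "hessian g V x i j = T i j m + g x i j * L" for i j
    unfolding eq V(3) contract ..
  have 2: "hessian g' (\<lambda>y. 1 / (w y)\<^sup>2 * V y) x i j = ?\<rho> * (?\<rho> * T' i j m) + g' x i j * L'" for i j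
  proof -
    have "(\<Sum>l\<in>UNIV. \<Sum>k\<in>UNIV. T' i j l * inv_metric g' x l k * pd k (\<lambda>y. 1 / (w y)\<^sup>2 * V y) x)
        = (\<Sum>l\<in>UNIV. \<Sum>k\<in>UNIV. ?\<rho> * ?\<rho> * T' i j l * inv_metric g x l k * g x k m)"
      unfolding pdV' inv_g'[OF x] by (simp add: algebra_simps)
    also have "\<dots> = ?\<rho> * ?\<rho> * T' i j m" by (rule contract)
    finally show ?thesis unfolding eq' by (simp only: mult.assoc)
  qed
  show thesis
  proof (rule that)
    show "?\<rho> * T' i j m = T i j m - 3 * \<Upsilon> x i * g x j m - 3 * \<Upsilon> x j * g x i m
        + g x i j * (L + s - (w x)\<^sup>2 * ((w x)\<^sup>2 * L'))" for i j
    proof -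
      have "?\<rho> * (?\<rho> * T' i j m) + g' x i j * L'
          = ?\<rho> * (T i j m + g x i j * L - 3 * \<Upsilon> x i * g x j m - 3 * \<Upsilon> x j * g x i m + g x i j * s)"
        using s[of i j] unfolding 1 2 V(3) .
      then have "(w x)\<^sup>2 * (?\<rho> * (?\<rho> * T' i j m)) + (w x)\<^sup>2 * (g' x i j * L')
          = (w x)\<^sup>2 * ?\<rho> * (T i j m + g x i j * L - 3 * \<Upsilon> x i * g x j m - 3 * \<Upsilon> x j * g x i m + g x i j * s)"
        by (metis (no_types, lifting) distrib_left mult.assoc)
      moreover have one: "(w x)\<^sup>2 * ?\<rho> = 1"
        using w_nonzero[OF x] by simp
      moreover have "(w x)\<^sup>2 * (?\<rho> * (?\<rho> * T' i j m)) = ?\<rho> * T' i j m"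
        unfolding mult.assoc[symmetric] one by simp
      ultimately show ?thesis unfolding g'_eq[OF x] by (simp add: algebra_simps)
    qed
  qed
qed

text \<open>The previous comparison only adds trace terms, which the uniqueness of the decomposition removes.\<close>

lemma tf_part_conf:
  assumes x: "x \<in> U" and n: "CARD('n) \<ge> 2"
    and rel: "\<And>m. \<exists>b. \<forall>i j. 1 / (w x)\<^sup>2 * T' i j m
       = T i j m - 3 * \<Upsilon> x i * g x j m - 3 * \<Upsilon> x j * g x i m + g x i j * b"
    and T: "\<And>i j k. T i j k = tf_sym_third_deriv g f x i j k
       + A i * g x j k + A j * g x i k - 2 / real CARD('n) * g x i j * A k"
    and T': "\<And>i j k. T' i j k = tf_sym_third_deriv g' f' x i j k
       + A' i * g' x j k + A' j * g' x i k - 2 / real CARD('n) * g' x i j * A' k"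
  shows "tf_sym_third_deriv g' f' x i j k = (w x)\<^sup>2 * tf_sym_third_deriv g f x i j k"
proof -
  let ?\<rho> = "1 / (w x)\<^sup>2" and ?n = "real CARD('n)"
  let ?S = "tf_sym_third_deriv g f x" and ?S' = "tf_sym_third_deriv g' f' x"
  define D where "D i j k = ?\<rho> * ?S' i j k - ?S i j k" for i j k
  from rel obtain b where b: "\<And>i j m. ?\<rho> * T' i j m
       = T i j m - 3 * \<Upsilon> x i * g x j m - 3 * \<Upsilon> x j * g x i m + g x i j * b m" by metis
  have inv_w2: "?\<rho> * g' x i j = g x i j" for i j using w_nonzero[OF x] by (simp add: g'_eq[OF x])
  have "D i j k = 0"
  proof (rule symmetric_trace_free_eq_0[OF x n])
    show "D i j k = D j i k" "D i j k = D i k j" for i j k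
      using tf_sym_third_deriv_symmetric[OF x, of f i j k] conf.tf_sym_third_deriv_symmetric[OF x, of f' i j k]
      by (simp_all add: D_def)
    show "(\<Sum>i\<in>UNIV. \<Sum>j\<in>UNIV. inv_metric g x i j * D i j k) = 0" for k
    proof -
      have "inv_metric g x i j * D i j k = inv_metric g' x i j * ?S' i j k - inv_metric g x i j * ?S i j k" for i j
        by (simp add: D_def inv_g'[OF x] algebra_simps)
      then show ?thesis
        using tf_sym_third_deriv_trace[OF x, of f k] conf.tf_sym_third_deriv_trace[OF x, of f' k]
        by (simp add: sum_subtractf)
    qed
    show "D i j k = (A i - A' i - 3 * \<Upsilon> x i) * g x j k + (A j - A' j - 3 * \<Upsilon> x j) * g x i k
        + g x i j * (b k - 2 / ?n * (A k - A' k))" for i j k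
    proof -
      have "?\<rho> * T' i j k = ?\<rho> * ?S' i j k + A' i * (?\<rho> * g' x j k) + A' j * (?\<rho> * g' x i k)
          - 2 / ?n * (?\<rho> * g' x i j) * A' k"
        unfolding T' by (simp only: distrib_left right_diff_distrib mult.left_commute mult.assoc)
      then show ?thesis using b[of i j k] unfolding inv_w2 T D_def
        by (simp add: algebra_simps diff_divide_distrib)
    qed
  qed
  then show ?thesis using w_nonzero[OF x] by (simp add: D_def field_simps)
qed

end

theorem theorem6p19:
  fixes M :: "'a topology" and \<A> :: "('a, 'n::finite) chart set"
    and S S' :: "('a, 'n) hsystem" and \<Omega> B B' :: "'a \<Rightarrow> real"
  assumes "CARD('n) \<ge> 3"
    and "smooth_manifold M \<A>"
    and "abundant M \<A> S" and "abundant M \<A> S'"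
    and "constant_curvature \<A> (hmetric S)" and "constant_curvature \<A> (hmetric S')"
    and "conformally_equivalent M \<A> \<Omega> S S'"
    and "\<forall>c\<in>\<A>. \<forall>x\<in>cran c. \<forall>i j. hmetric S' c x i j = (loc c \<Omega> x)\<^sup>2 * hmetric S c x i j"
    and "structure_function M \<A> S B" and "structure_function M \<A> S' B'"
  shows "\<exists>\<beta>. gauge_function M \<A> (hmetric S') \<beta> \<and> (\<forall>q\<in>topspace M. B' q = (\<Omega> q)\<^sup>2 * B q + \<beta> q)"
proof -
  note M = assms(2) and conf = assms(7) and g' = assms(8)
  have n: "CARD('n) \<ge> 2" using assms(1) by simp
  have psi: "properly_superintegrable M \<A> S" "properly_superintegrable M \<A> S'"
    using assms(3,4) by (auto simp: abundant_def)
  then have g: "metric_field \<A> (hmetric S)" by (simp add: properly_superintegrable_def)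
  have B: "scalar_field M \<A> B" "scalar_field M \<A> B'"
    using assms(9,10) by (auto simp: structure_function_def)
  obtain T where T: "structure_tensor M \<A> S T" and TB: "\<And>c x i j k. c \<in> \<A> \<Longrightarrow> x \<in> cran c \<Longrightarrow>
      T c x i j k = tf_sym_third_deriv (hmetric S c) (loc c B) x i j k
        + trace_one_form (hmetric S c) (loc c B) x i * hmetric S c x j k
        + trace_one_form (hmetric S c) (loc c B) x j * hmetric S c x i k
        - 2 / real CARD('n) * hmetric S c x i j * trace_one_form (hmetric S c) (loc c B) x k"
    using assms(9) unfolding structure_function_def Let_def by blast
  obtain T' where T': "structure_tensor M \<A> S' T'" and TB': "\<And>c x i j k. c \<in> \<A> \<Longrightarrow> x \<in> cran c \<Longrightarrow>
      T' c x i j k = tf_sym_third_deriv (hmetric S' c) (loc c B') x i j k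
        + trace_one_form (hmetric S' c) (loc c B') x i * hmetric S' c x j k
        + trace_one_form (hmetric S' c) (loc c B') x j * hmetric S' c x i k
        - 2 / real CARD('n) * hmetric S' c x i j * trace_one_form (hmetric S' c) (loc c B') x k"
    using assms(10) unfolding structure_function_def Let_def by blast
  define \<beta> where "\<beta> q = B' q - (\<Omega> q)\<^sup>2 * B q" for q
  have loc_\<beta>: "loc c \<beta> = (\<lambda>y. loc c B' y - (loc c \<Omega> y)\<^sup>2 * loc c B y)" for c :: "('a, 'n) chart"
    by (simp add: loc_def \<beta>_def)
  have patch: "conformal_patch (cran c) (hmetric S c) (loc c \<Omega>) (hmetric S' c)" if "c \<in> \<A>" for c
    by (rule conformal_patch_chart[OF M g conf g' that])
  have "gauge_function M \<A> (hmetric S') \<beta>"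
    unfolding gauge_function_def scalar_field_def
  proof (intro conjI ballI allI impI)
    show "\<beta> q = 0" if "q \<notin> topspace M" for q using B that by (simp add: \<beta>_def scalar_field_def)
  next
    fix c assume c: "c \<in> \<A>"
    interpret conformal_patch "cran c" "hmetric S c" "loc c \<Omega>" "hmetric S' c" by (rule patch[OF c])
    note smooth_B = scalar_field_smooth[OF B(1) c] and smooth_B' = scalar_field_smooth[OF B(2) c]
    have smooth_conf_B: "smooth_on (cran c) (\<lambda>y. (loc c \<Omega> y)\<^sup>2 * loc c B y)"
      by (intro smooth_intros smooth_w smooth_B)
    show "smooth_on (cran c) (loc c \<beta>)" unfolding loc_\<beta> by (intro smooth_intros smooth_B' smooth_conf_B)
    fix x i j k assume x: "x \<in> cran c"
    have rel: "\<exists>b. \<forall>i j. 1 / (loc c \<Omega> x)\<^sup>2 * T' c x i j m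
        = T c x i j m - 3 * \<Upsilon> x i * hmetric S c x j m - 3 * \<Upsilon> x j * hmetric S c x i m + hmetric S c x i j * b" for m
    proof -
      \<comment> \<open>a potential whose gradient is the coordinate vector \<open>m\<close> picks out the components \<open>T\<^sub>i\<^sub>j\<^sub>m\<close>\<close>
      obtain V where V: "V \<in> Vmax M \<A> S" "loc c V x = 0" "\<And>k. pd k (loc c V) x = hmetric S c x k m"
        using Vmax_prescribed_differential[OF M n assms(3) c x, of "\<lambda>k. hmetric S c x k m"] by blast
      let ?V' = "\<lambda>q. 1 / (\<Omega> q)\<^sup>2 * V q"
      have V': "?V' \<in> Vmax M \<A> S'" by (rule Vmax_conf[OF M psi conf g' V(1)])
      have loc_V': "loc c ?V' = (\<lambda>y. 1 / (loc c \<Omega> y)\<^sup>2 * loc c V y)" by (simp add: loc_def)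
      have smooth_V: "smooth_on (cran c) (loc c V)"
        using V(1) c by (auto simp: Vmax_def intro: scalar_field_smooth)
      have eq: "hessian (hmetric S c) (loc c V) x i j =
          (\<Sum>l\<in>UNIV. \<Sum>k\<in>UNIV. T c x i j l * inv_metric (hmetric S c) x l k * pd k (loc c V) x)
          + hmetric S c x i j * (laplacian (hmetric S c) (loc c V) x / real CARD('n))" for i j
        using T V(1) c x by (simp add: structure_tensor_def)
      have eq': "hessian (hmetric S' c) (loc c ?V') x i j =
          (\<Sum>l\<in>UNIV. \<Sum>k\<in>UNIV. T' c x i j l * inv_metric (hmetric S' c) x l k * pd k (loc c ?V') x)
          + hmetric S' c x i j * (laplacian (hmetric S' c) (loc c ?V') x / real CARD('n))" for i j
        using T' V' c x by (simp add: structure_tensor_def)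
      show ?thesis
      proof (rule structure_tensor_conf[where T = "T c x" and T' = "T' c x" and m = m,
            OF x smooth_V V(2,3) eq eq'[unfolded loc_V']])
        fix b
        assume "\<And>i j. 1 / (loc c \<Omega> x)\<^sup>2 * T' c x i j m = T c x i j m - 3 * \<Upsilon> x i * hmetric S c x j m
          - 3 * \<Upsilon> x j * hmetric S c x i m + hmetric S c x i j * b"
        then show ?thesis by blast
      qed
    qed
    have S_conf: "tf_sym_third_deriv (hmetric S' c) (loc c B') x i j k
        = (loc c \<Omega> x)\<^sup>2 * tf_sym_third_deriv (hmetric S c) (loc c B) x i j k"
      by (rule tf_part_conf[OF x n rel TB[OF c x] TB'[OF c x]])
    have pure: "\<exists>e. \<forall>k j. cov_deriv1 (hmetric S c) \<Upsilon> y k j = \<Upsilon> y k * \<Upsilon> y j + e * hmetric S c y k j"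
      if y: "y \<in> cran c" for y
    proof -
      obtain \<kappa> \<kappa>' where
        "\<And>l k i j. (\<Sum>m\<in>UNIV. hmetric S c y l m * riemann (hmetric S c) y m k i j)
          = \<kappa> * (hmetric S c y l i * hmetric S c y k j - hmetric S c y l j * hmetric S c y k i)"
        "\<And>l k i j. (\<Sum>m\<in>UNIV. hmetric S' c y l m * riemann (hmetric S' c) y m k i j)
          = \<kappa>' * (hmetric S' c y l i * hmetric S' c y k j - hmetric S' c y l j * hmetric S' c y k i)"
        using assms(5,6) c y unfolding constant_curvature_def by meson
      from schouten_pure_trace[OF assms(1) y this] show ?thesis by metis
    qed
    have "tf_sym_third_deriv (hmetric S' c) (loc c \<beta>) x i j k
        = tf_sym_third_deriv (hmetric S' c) (loc c B') x i j k
          - tf_sym_third_deriv (hmetric S' c) (\<lambda>y. (loc c \<Omega> y)\<^sup>2 * loc c B y) x i j k"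
      unfolding loc_\<beta> by (rule conf.tf_sym_third_deriv_diff[OF x smooth_B' smooth_conf_B])
    then show "tf_sym_third_deriv (hmetric S' c) (loc c \<beta>) x i j k = 0"
      using S_conf tf_sym_third_deriv_conf[OF smooth_B x pure] by simp
  qed
  moreover have "B' q = (\<Omega> q)\<^sup>2 * B q + \<beta> q" for q by (simp add: \<beta>_def)
  ultimately show ?thesis by blast
qed

end
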